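(* For every integer $n\geq 2$ there exist an $n$-dimensional noncompact complex manifold $M$ and a K\"ahler metric $g$ on $M$ which is strictly partially regular and cscK (i.e. has constant scalar curvature). Furthermore, for every $n\geq 3$ the constant scalar curvature of $g$ can be chosen to be zero, positive or negative; that is, for each of the three signs there exists such a pair $(M,g)$ with $\dim_{\mathbb{C}}M=n$ whose constant scalar curvature has that sign.
   Context: Let $M$ be an $n$-dimensional complex manifold with K\"ahler metric $g$ and associated K\"ahler form $\omega$. Assume there is a holomorphic line bundle $L$ over $M$ with $c_1(L)=[\omega]_{dR}$, and let $h$ be a Hermitian metric on $L$ with $\mathrm{Ric}(h)=\omega$, where $\mathrm{Ric}(h)$ is the two-form locally given by $\mathrm{Ric}(h)=-\frac{i}{2\pi}\partial\bar\partial\log h(\sigma(x),\sigma(x))$ for any trivializing (nowhere vanishing) local holomorphic section $\sigma$ of $L$. For a positive integer $m$, let $L^m$ be the $m$-th tensor power of $L$, $h_m$ the Hermitian metric on $L^m$ induced by $h$ (so $\mathrm{Ric}(h_m)=m\omega$), and let $\mathcal{H}_m$ be the separable complex Hilbert space of global holomorphic sections $s$ of $L^m$ with $\langle s,s\rangle_m=\int_M h_m(s(x),s(x))\frac{\omega^n}{n!}<\infty$. For a closed complex subspace $\mathcal{S}\subseteq\mathcal{H}_m$ with orthonormal basis $\{s_j\}_{j=0}^{N}$ ($\dim\mathcal{S}=N+1\le\infty$), the partial Bergman kernel is $T^{\mathcal{S}}_{mg}(x)=\sum_{j=0}^N h_m(s_j(x),s_j(x))$, $x\in M$; it does not depend on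 the chosen orthonormal basis. The metric $mg$ is called strictly partially balanced if there is a subspace $\mathcal{S}_m\subsetneq\mathcal{H}_m$, strictly contained in $\mathcal{H}_m$, such that $T^{\mathcal{S}_m}_{mg}$ is a positive constant function on $M$. The metric $g$ is called strictly partially regular if $mg$ is strictly partially balanced for all sufficiently large integers $m$ (the subspace $\mathcal{S}_m$ and the constant may depend on $m$). cscK means constant scalar curvature K\"ahler. Metrics are not required to be complete. *)

theory Defs
  imports "HOL-Analysis.Analysis"
begin

section \<open>Calculus on open subsets of complex n-space\<close>

fun Ck_on :: "nat \<Rightarrow> ('v::euclidean_space \<Rightarrow> 'w::real_normed_vector) \<Rightarrow> 'v set \<Rightarrow> bool" where
  "Ck_on 0 f S \<longleftrightarrow> continuous_on S f"
| "Ck_on (Suc k) f S \<longleftrightarrow>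
     (\<forall>z\<in>S. f differentiable (at z)) \<and> (\<forall>v. Ck_on k (\<lambda>z. frechet_derivative f (at z) v) S)"

definition smooth_on :: "('v::euclidean_space \<Rightarrow> 'w::real_normed_vector) \<Rightarrow> 'v set \<Rightarrow> bool" where
  "smooth_on f S \<longleftrightarrow> (\<forall>k. Ck_on k f S)"

text \<open>Only used for open \<open>S\<close>.\<close>

definition holo_on :: "(complex^'n \<Rightarrow> complex) \<Rightarrow> (complex^'n) set \<Rightarrow> bool" where
  "holo_on f S \<longleftrightarrow>
     (\<forall>z\<in>S. \<exists>D. (f has_derivative D) (at z) \<and> (\<forall>c v. D (c *s v) = c * D v))"

text \<open>The Wirtinger operators: \<open>wirt a\<close> is the derivative in \<open>z_a\<close>, and \<open>wirt_bar a\<close> the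
  derivative in the conjugate of \<open>z_a\<close>.\<close>

definition wirt :: "'n \<Rightarrow> (complex^'n \<Rightarrow> complex) \<Rightarrow> complex^'n \<Rightarrow> complex" where
  "wirt a f z =
     (frechet_derivative f (at z) (axis a 1) - \<i> * frechet_derivative f (at z) (axis a \<i>)) / 2"

definition wirt_bar :: "'n \<Rightarrow> (complex^'n \<Rightarrow> complex) \<Rightarrow> complex^'n \<Rightarrow> complex" where
  "wirt_bar a f z =
     (frechet_derivative f (at z) (axis a 1) + \<i> * frechet_derivative f (at z) (axis a \<i>)) / 2"

text \<open>The value on a pair of tangent vectors of the two-form obtained by applying \<open>\<partial>\<close> after
  \<open>\<partial>\<close>-bar to \<open>u\<close>; here \<open>dz_a \<and> dzbar_b\<close> sends \<open>(v, w)\<close> to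
  \<open>v_a * cnj w_b - w_a * cnj v_b\<close>.\<close>

definition ddbar :: "(complex^'n \<Rightarrow> complex) \<Rightarrow> complex^'n \<Rightarrow> complex^'n \<Rightarrow> complex^'n \<Rightarrow> complex" where
  "ddbar u z v w =
     (\<Sum>a\<in>UNIV. \<Sum>b\<in>UNIV. wirt a (wirt_bar b u) z * (v $ a * cnj (w $ b) - w $ a * cnj (v $ b)))"


section \<open>Complex manifolds\<close>

type_synonym ('a, 'n) chart = "'a set \<times> ('a \<Rightarrow> complex^'n)"

text \<open>The points are those of \<open>topspace (mtop M)\<close>. A chart is a pair of its domain and its
  coordinate map, whose values outside the domain are irrelevant.  The atlas need not be maximal.\<close>

record ('a, 'n) cmanifold =
  mtop :: "'a topology"
  atlas :: "('a, 'n::finite) chart set"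

abbreviation pts :: "('a, 'n::finite) cmanifold \<Rightarrow> 'a set" where
  "pts M \<equiv> topspace (mtop M)"

definition chart_inv :: "('a, 'n::finite) chart \<Rightarrow> complex^'n \<Rightarrow> 'a" where
  "chart_inv c = inv_into (fst c) (snd c)"

definition complex_manifold :: "('a, 'n::finite) cmanifold \<Rightarrow> bool" where
  "complex_manifold M \<longleftrightarrow>
     Hausdorff_space (mtop M) \<and> second_countable (mtop M) \<and> connected_space (mtop M) \<and>
     pts M \<noteq> {} \<and> (\<Union>c\<in>atlas M. fst c) = pts M \<and>
     (\<forall>c\<in>atlas M. openin (mtop M) (fst c) \<and> open (snd c ` fst c) \<and>
        homeomorphic_map (subtopology (mtop M) (fst c)) (top_of_set (snd c ` fst c)) (snd c)) \<and>
     (\<forall>c\<in>atlas M. \<forall>d\<in>atlas M. \<forall>a.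
        holo_on (\<lambda>z. snd d (chart_inv c z) $ a) (snd c ` (fst c \<inter> fst d)))"

definition mholo_on :: "('a, 'n::finite) cmanifold \<Rightarrow> ('a \<Rightarrow> complex) \<Rightarrow> 'a set \<Rightarrow> bool" where
  "mholo_on M f V \<longleftrightarrow> (\<forall>c\<in>atlas M. holo_on (\<lambda>z. f (chart_inv c z)) (snd c ` (fst c \<inter> V)))"

definition msmooth_on ::
    "('a, 'n::finite) cmanifold \<Rightarrow> ('a \<Rightarrow> 'w::real_normed_vector) \<Rightarrow> 'a set \<Rightarrow> bool" where
  "msmooth_on M f V \<longleftrightarrow> (\<forall>c\<in>atlas M. smooth_on (\<lambda>z. f (chart_inv c z)) (snd c ` (fst c \<inter> V)))"


section \<open>Kaehler metrics\<close>

text \<open>A Hermitian metric on the tangent bundle is given by its matrix \<open>g c x\<close> of components in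
  each chart \<open>c\<close> at each point \<open>x\<close> of the chart.  Writing \<open>H = hform (g c x)\<close>, the Riemannian
  metric is \<open>Re H\<close>, and its Kaehler form, sending \<open>(v, w)\<close> to \<open>Re (H (\<i> *s v) w)\<close>, is
  \<open>- Im H = (\<i>/2) * (\<Sum>a b. g_ab * dz_a \<and> dzbar_b)\<close>.\<close>

type_synonym ('a, 'n) hmetric = "('a, 'n) chart \<Rightarrow> 'a \<Rightarrow> complex^'n^'n"

definition hform :: "complex^'n^'n \<Rightarrow> complex^'n \<Rightarrow> complex^'n \<Rightarrow> complex" where
  "hform G v w = (\<Sum>a\<in>UNIV. \<Sum>b\<in>UNIV. G $ a $ b * v $ a * cnj (w $ b))"

definition kahler_form ::
    "('a, 'n::finite) hmetric \<Rightarrow> ('a, 'n) chart \<Rightarrow> 'a \<Rightarrow> complex^'n \<Rightarrow> complex^'n \<Rightarrow> real" where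
  "kahler_form g c x v w = - Im (hform (g c x) v w)"

definition hermitian_tangent_metric ::
    "('a, 'n::finite) cmanifold \<Rightarrow> ('a, 'n) hmetric \<Rightarrow> bool" where
  "hermitian_tangent_metric M g \<longleftrightarrow>
     (\<forall>c\<in>atlas M. \<forall>a b. smooth_on (\<lambda>z. g c (chart_inv c z) $ a $ b) (snd c ` fst c)) \<and>
     (\<forall>c\<in>atlas M. \<forall>x\<in>fst c.
        (\<forall>a b. g c x $ b $ a = cnj (g c x $ a $ b)) \<and>
        (\<forall>v. v \<noteq> 0 \<longrightarrow> Re (hform (g c x) v v) > 0)) \<and>
     (\<forall>c\<in>atlas M. \<forall>d\<in>atlas M. \<forall>x\<in>fst c \<inter> fst d. \<forall>v w.
        let T = frechet_derivative (\<lambda>z. snd d (chart_inv c z)) (at (snd c x))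
        in hform (g c x) v w = hform (g d x) (T v) (T w))"

text \<open>The last clause is the vanishing of the exterior derivative of the Kaehler form, evaluated on
  constant vector fields of a chart.\<close>

definition kahler_metric :: "('a, 'n::finite) cmanifold \<Rightarrow> ('a, 'n) hmetric \<Rightarrow> bool" where
  "kahler_metric M g \<longleftrightarrow>
     hermitian_tangent_metric M g \<and>
     (\<forall>c\<in>atlas M. \<forall>z\<in>snd c ` fst c. \<forall>u v w.
        (let \<omega> = (\<lambda>v w y. kahler_form g c (chart_inv c y) v w) in
           frechet_derivative (\<omega> v w) (at z) u
         - frechet_derivative (\<omega> u w) (at z) v
         + frechet_derivative (\<omega> u v) (at z) w = 0))"

text \<open>The components of the Ricci tensor of a Kaehler metric are \<open>- \<partial>_a \<partial>bar_b log det g\<close>.\<close>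

definition ricci :: "('a, 'n::finite) hmetric \<Rightarrow> ('a, 'n) chart \<Rightarrow> 'a \<Rightarrow> complex^'n^'n" where
  "ricci g c x = (\<chi> a b.
     - wirt a (wirt_bar b (\<lambda>z. of_real (ln (Re (det (g c (chart_inv c z))))))) (snd c x))"

text \<open>Since the Riemannian metric is \<open>Re H\<close>, the factor 4 makes this the Riemannian scalar
  curvature.\<close>

definition scalar_curvature :: "('a, 'n::finite) hmetric \<Rightarrow> ('a, 'n) chart \<Rightarrow> 'a \<Rightarrow> complex" where
  "scalar_curvature g c x =
     4 * (\<Sum>a\<in>UNIV. \<Sum>b\<in>UNIV. matrix_inv (g c x) $ b $ a * ricci g c x $ a $ b)"

definition has_constant_scalar_curvature ::
    "('a, 'n::finite) cmanifold \<Rightarrow> ('a, 'n) hmetric \<Rightarrow> real \<Rightarrow> bool" where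
  "has_constant_scalar_curvature M g k \<longleftrightarrow>
     (\<forall>c\<in>atlas M. \<forall>x\<in>fst c. scalar_curvature g c x = of_real k)"

text \<open>With \<open>\<omega> = (\<i>/2) * (\<Sum>a b. g_ab * dz_a \<and> dzbar_b)\<close>, the volume form \<open>\<omega>^n / n!\<close> is \<open>det g\<close>
  times Lebesgue measure in every chart; this determines a unique Borel measure.\<close>

definition is_volume_measure ::
    "('a, 'n::finite) cmanifold \<Rightarrow> ('a, 'n) hmetric \<Rightarrow> 'a measure \<Rightarrow> bool" where
  "is_volume_measure M g \<mu> \<longleftrightarrow>
     space \<mu> = pts M \<and> sets \<mu> = sigma_sets (pts M) {U. openin (mtop M) U} \<and>
     (\<forall>c\<in>atlas M. \<forall>A\<in>sets \<mu>. A \<subseteq> fst c \<longrightarrow>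
        emeasure \<mu> A =
          (\<integral>\<^sup>+y\<in>snd c ` A. ennreal (Re (det (g c (chart_inv c y)))) \<partial>lborel))"

definition volume_measure ::
    "('a, 'n::finite) cmanifold \<Rightarrow> ('a, 'n) hmetric \<Rightarrow> 'a measure" where
  "volume_measure M g = (THE \<mu>. is_volume_measure M g \<mu>)"


section \<open>Hermitian holomorphic line bundles\<close>

text \<open>A line bundle is given by its transition functions over a trivializing open cover, which may
  be taken countable because manifolds are second countable.  A vector in the fibre over \<open>x\<close>
  is the family of its coordinates in the trivializations around \<open>x\<close> (and 0 elsewhere).\<close>

record 'a line_bundle =
  cover :: "nat \<Rightarrow> 'a set"
  trans_fun :: "nat \<Rightarrow> nat \<Rightarrow> 'a \<Rightarrow> complex"

definition holomorphic_line_bundle ::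
    "('a, 'n::finite) cmanifold \<Rightarrow> 'a line_bundle \<Rightarrow> bool" where
  "holomorphic_line_bundle M L \<longleftrightarrow>
     (\<forall>i. openin (mtop M) (cover L i)) \<and> (\<Union>i. cover L i) = pts M \<and>
     (\<forall>i j. mholo_on M (trans_fun L i j) (cover L i \<inter> cover L j)) \<and>
     (\<forall>i. \<forall>x\<in>cover L i. trans_fun L i i x = 1) \<and>
     (\<forall>i j k. \<forall>x\<in>cover L i \<inter> cover L j \<inter> cover L k.
        trans_fun L i j x * trans_fun L j k x = trans_fun L i k x)"

definition fibre :: "'a line_bundle \<Rightarrow> 'a \<Rightarrow> (nat \<Rightarrow> complex) set" where
  "fibre L x = {v. (\<forall>i. x \<notin> cover L i \<longrightarrow> v i = 0) \<and>
     (\<forall>i j. x \<in> cover L i \<inter> cover L j \<longrightarrow> v i = trans_fun L i j x * v j)}"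

definition tensor_power :: "'a line_bundle \<Rightarrow> nat \<Rightarrow> 'a line_bundle" where
  "tensor_power L m = L\<lparr>trans_fun := (\<lambda>i j x. trans_fun L i j x ^ m)\<rparr>"

text \<open>The value at \<open>x\<close> of the trivializing section over \<open>cover L i\<close> whose \<open>i\<close>-th coordinate is 1.\<close>

definition frame :: "'a line_bundle \<Rightarrow> nat \<Rightarrow> 'a \<Rightarrow> (nat \<Rightarrow> complex)" where
  "frame L i x = (\<lambda>j. if x \<in> cover L j then trans_fun L j i x else 0)"

definition hermitian_metric ::
    "('a, 'n::finite) cmanifold \<Rightarrow> 'a line_bundle \<Rightarrow>
     ('a \<Rightarrow> (nat \<Rightarrow> complex) \<Rightarrow> (nat \<Rightarrow> complex) \<Rightarrow> complex) \<Rightarrow> bool" where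
  "hermitian_metric M L h \<longleftrightarrow>
     (\<forall>x\<in>pts M. \<forall>u\<in>fibre L x. \<forall>v\<in>fibre L x. \<forall>w\<in>fibre L x. \<forall>a b.
        h x (\<lambda>i. a * u i + b * v i) w = a * h x u w + b * h x v w \<and>
        h x w v = cnj (h x v w) \<and>
        (v \<noteq> (\<lambda>_. 0) \<longrightarrow> Re (h x v v) > 0)) \<and>
     (\<forall>i. msmooth_on M (\<lambda>x. h x (frame L i x) (frame L i x)) (cover L i))"

text \<open>The two-form \<open>Ric(h)\<close>, computed in the chart \<open>c\<close> from the trivializing section \<open>frame L i\<close>.
  It represents the first Chern class of \<open>L\<close> (Chern-Weil), so that \<open>Ric(h) = \<omega>\<close>
  contains the condition that this class is the class of \<open>\<omega>\<close>.\<close>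

definition ric_form ::
    "'a line_bundle \<Rightarrow> ('a \<Rightarrow> (nat \<Rightarrow> complex) \<Rightarrow> (nat \<Rightarrow> complex) \<Rightarrow> complex) \<Rightarrow> nat \<Rightarrow>
     ('a, 'n::finite) chart \<Rightarrow> 'a \<Rightarrow> complex^'n \<Rightarrow> complex^'n \<Rightarrow> complex" where
  "ric_form L h i c x v w =
     - (\<i> / (2 * of_real pi)) *
       ddbar (\<lambda>z. of_real (ln (Re (h (chart_inv c z)
                (frame L i (chart_inv c z)) (frame L i (chart_inv c z)))))) (snd c x) v w"

definition ric_eq_kahler_form ::
    "('a, 'n::finite) cmanifold \<Rightarrow> ('a, 'n) hmetric \<Rightarrow> 'a line_bundle \<Rightarrow>
     ('a \<Rightarrow> (nat \<Rightarrow> complex) \<Rightarrow> (nat \<Rightarrow> complex) \<Rightarrow> complex) \<Rightarrow> bool" where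
  "ric_eq_kahler_form M g L h \<longleftrightarrow>
     (\<forall>i. \<forall>c\<in>atlas M. \<forall>x\<in>fst c \<inter> cover L i. \<forall>v w.
        ric_form L h i c x v w = of_real (kahler_form g c x v w))"

text \<open>The metric on \<open>tensor_power L m\<close> whose value on the \<open>m\<close>-th power of a vector of \<open>L\<close> is the
  \<open>m\<close>-th power of the value of \<open>h\<close>.  It is computed in one trivialization around \<open>x\<close>;
  all of them give the same value.\<close>

definition power_metric ::
    "'a line_bundle \<Rightarrow> ('a \<Rightarrow> (nat \<Rightarrow> complex) \<Rightarrow> (nat \<Rightarrow> complex) \<Rightarrow> complex) \<Rightarrow> nat \<Rightarrow>
     'a \<Rightarrow> (nat \<Rightarrow> complex) \<Rightarrow> (nat \<Rightarrow> complex) \<Rightarrow> complex" where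
  "power_metric L h m x v w =
     (let i = (SOME i. x \<in> cover L i)
      in v i * cnj (w i) * h x (frame L i x) (frame L i x) ^ m)"


section \<open>Weighted Bergman spaces and partial Bergman kernels\<close>

text \<open>The fibre over a value outside \<open>pts M\<close> is zero, so a section is determined by its values
  on \<open>pts M\<close>.\<close>

type_synonym 'a sec = "'a \<Rightarrow> nat \<Rightarrow> complex"

definition holo_sections :: "('a, 'n::finite) cmanifold \<Rightarrow> 'a line_bundle \<Rightarrow> 'a sec set" where
  "holo_sections M L =
     {s. (\<forall>x. s x \<in> fibre L x) \<and> (\<forall>i. mholo_on M (\<lambda>x. s x i) (cover L i))}"

locale polarized =
  fixes M :: "('a, 'n::finite) cmanifold"
    and g :: "('a, 'n) hmetric"
    and L :: "'a line_bundle"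
    and h :: "'a \<Rightarrow> (nat \<Rightarrow> complex) \<Rightarrow> (nat \<Rightarrow> complex) \<Rightarrow> complex"
    and m :: nat
begin

definition bergman_space :: "'a sec set" where
  "bergman_space =
     {s \<in> holo_sections M (tensor_power L m).
        integrable (volume_measure M g) (\<lambda>x. Re (power_metric L h m x (s x) (s x)))}"

definition ip :: "'a sec \<Rightarrow> 'a sec \<Rightarrow> complex" where
  "ip s t = (LINT x|volume_measure M g. power_metric L h m x (s x) (t x))"

definition l2norm :: "'a sec \<Rightarrow> real" where
  "l2norm s = sqrt (Re (ip s s))"

definition closed_subspace :: "'a sec set \<Rightarrow> bool" where
  "closed_subspace S \<longleftrightarrow>
     S \<subseteq> bergman_space \<and> (\<lambda>x i. 0) \<in> S \<and>
     (\<forall>s\<in>S. \<forall>t\<in>S. \<forall>a b. (\<lambda>x i. a * s x i + b * t x i) \<in> S) \<and>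
     (\<forall>f s. (\<forall>k::nat. f k \<in> S) \<and> s \<in> bergman_space \<and>
        (\<lambda>k. l2norm (\<lambda>x i. f k x i - s x i)) \<longlonglongrightarrow> 0 \<longrightarrow> s \<in> S)"

definition orthonormal_basis :: "'a sec set \<Rightarrow> 'a sec set \<Rightarrow> bool" where
  "orthonormal_basis S B \<longleftrightarrow>
     B \<subseteq> S \<and> (\<forall>s\<in>B. \<forall>t\<in>B. ip s t = (if s = t then 1 else 0)) \<and>
     (\<forall>s\<in>S. \<forall>e>0. \<exists>F c. finite F \<and> F \<subseteq> B \<and>
        l2norm (\<lambda>x i. s x i - (\<Sum>b\<in>F. c b * b x i)) < e)"

text \<open>The partial Bergman kernel, of the space with orthonormal basis \<open>B\<close>.\<close>

definition partial_bergman_kernel :: "'a sec set \<Rightarrow> 'a \<Rightarrow> real" where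
  "partial_bergman_kernel B x = (\<Sum>\<^sub>\<infinity>s\<in>B. Re (power_metric L h m x (s x) (s x)))"

text \<open>The kernel does not depend on the choice of \<open>B\<close>.  A sum that is not summable has the
  value 0, which is excluded by \<open>k > 0\<close>.\<close>

definition strictly_partially_balanced :: bool where
  "strictly_partially_balanced \<longleftrightarrow>
     (\<exists>S. closed_subspace S \<and> S \<subset> bergman_space \<and>
        (\<exists>B k. orthonormal_basis S B \<and> k > 0 \<and>
           (\<forall>x\<in>pts M. partial_bergman_kernel B x = k)))"

end

definition strictly_partially_regular ::
    "('a, 'n::finite) cmanifold \<Rightarrow> ('a, 'n) hmetric \<Rightarrow> bool" where
  "strictly_partially_regular M g \<longleftrightarrow>
     (\<exists>L h. holomorphic_line_bundle M L \<and> hermitian_metric M L h \<and> ric_eq_kahler_form M g L h \<and>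
        (\<forall>\<^sub>F m in sequentially. polarized.strictly_partially_balanced M g L h m))"

end

theory Submission
  imports Defs
begin

text \<open>
  On the punctured disc or plane, the potential \<open>ln (1 + e |w|\<^sup>2) / e\<close> (Fubini--Study for
  \<open>e = 1\<close>, a multiple of the hyperbolic one for \<open>e < 0\<close>) has a Bergman kernel that is constant:
  the norms of the powers of \<open>w\<close> are inverse to the coefficients of the binomial series of
  \<open>(1 + e |w|\<^sup>2) powr (m / e)\<close>.  Pull back a product of such metrics under
  \<open>w\<^sub>i = z\<^sub>i\<^sup>2\<close>.  The pullback is an unramified double cover in each coordinate, so it is locally
  isometric to the product, and up to a factor the even monomials are still an orthonormal
  system with constant kernel.  They no longer span: a monomial that is odd in one coordinate
  is square integrable and orthogonal to them.  The scalar curvature is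
  \<open>8 * pi * (\<Sum>i. e i)\<close>, whose sign can be chosen at will.
\<close>

section \<open>Lebesgue measure on complex n-space\<close>

text \<open>Positivity dictates the exponents. The coefficient of \<open>s ^ k\<close> in the
  binomial series is \<open>m (m - e) (m - 2 e) ... / k!\<close>, and it has to be positive to be
  the inverse of a squared norm. This holds for every k if \<open>e < 0\<close>, and for
  \<open>e = 1\<close> up to k = m, where the series stops; hence the condition
  \<open>e i = 1 \<or> e i < 0\<close>, which still lets the sum of the \<open>e i\<close> vanish.
  Before the pullback the monomials already exhaust the square integrable holomorphic functions,
  since 1 / w is not square integrable near 0; the double cover is what makes room for a strict
  subspace. It branches where some coordinate is 0, and there the pulled-back metric degenerates, so
  these hyperplanes are removed and the metric is incomplete. The inverse relation between norms and
  coefficients comes from two recurrences in k with the same factors, one of them an integration by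
  parts. The subspace is the closure of the span of the even monomials, so that closedness and the
  basis property are matters of approximation, and strictness follows from orthogonality.\<close>

lemma prod_Basis_vec:
  "(\<Prod>b\<in>(Basis :: ('a::euclidean_space ^'n) set). f b) = (\<Prod>i\<in>UNIV. \<Prod>u\<in>Basis. f (axis i u))"
proof -
  have B: "(Basis :: ('a ^'n) set) = (\<lambda>(i, u). axis i u) ` (UNIV \<times> Basis)"
    by (auto simp: Basis_vec_def)
  have inj: "inj_on (\<lambda>(i, u). axis i u :: 'a^'n) (UNIV \<times> Basis)"
    by (auto simp: inj_on_def axis_eq_axis)
  show ?thesis
    unfolding B prod.reindex[OF inj] o_def by (simp add: prod.cartesian_product case_prod_unfold)
qed

lemma vec_lambda_measurable:
  "(\<lambda>f. \<chi> i. f i) \<in> Pi\<^sub>M UNIV (\<lambda>_::'n::finite. lborel :: 'a::euclidean_space measure) \<rightarrow>\<^sub>M (borel :: ('a^'n) measure)"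
proof (rule borel_measurable_euclidean_space[THEN iffD2], intro ballI)
  fix b :: "'a^'n" assume "b \<in> Basis"
  then obtain i u where b: "b = axis i u" "u \<in> Basis" by (auto simp: Basis_vec_def)
  show "(\<lambda>f. (\<chi> i. f i) \<bullet> b) \<in> borel_measurable (Pi\<^sub>M UNIV (\<lambda>_::'n. lborel :: 'a measure))"
    unfolding b by (simp add: inner_axis) measurable
qed

text \<open>Boxes in \<open>'a^'n\<close> are products of boxes, and their volumes determine
  \<open>lborel\<close>. Hence theorems on product measures carry over to vectors.\<close>

lemma lborel_vec_PiM:
  "distr (Pi\<^sub>M UNIV (\<lambda>_::'n::finite. lborel :: 'a::euclidean_space measure)) borel (\<lambda>f. \<chi> i. f i)
     = (lborel :: ('a^'n) measure)"
proof (rule lborel_eqI[symmetric])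
  interpret product_sigma_finite "\<lambda>_::'n. lborel :: 'a measure" ..
  note meas = vec_lambda_measurable
  fix l u :: "'a^'n" assume lu: "\<And>b. b \<in> Basis \<Longrightarrow> l \<bullet> b \<le> u \<bullet> b"
  have le: "l $ i \<bullet> b \<le> u $ i \<bullet> b" if "b \<in> Basis" for i b
    using lu[of "axis i b"] that by (auto simp: inner_axis Basis_vec_def)
  have pre: "(\<lambda>f. \<chi> i. f i) -` box l u \<inter> space (Pi\<^sub>M UNIV (\<lambda>_::'n. lborel :: 'a measure))
        = (\<Pi>\<^sub>E i\<in>UNIV. box (l $ i) (u $ i))"
    by (auto simp: space_PiM mem_box Basis_vec_def inner_axis PiE_def Pi_def)
  have "emeasure (distr (Pi\<^sub>M UNIV (\<lambda>_::'n. lborel :: 'a measure)) borel (\<lambda>f. \<chi> i. f i)) (box l u)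
      = (\<Prod>i\<in>UNIV. emeasure lborel (box (l $ i) (u $ i)))"
    by (subst emeasure_distr[OF meas]) (auto simp: pre emeasure_PiM)
  also have "\<dots> = (\<Prod>i\<in>UNIV. ennreal (\<Prod>b\<in>Basis. (u $ i - l $ i) \<bullet> b))"
    using le by (intro prod.cong refl) (simp add: emeasure_lborel_box)
  also have "\<dots> = ennreal (\<Prod>i\<in>UNIV. \<Prod>b\<in>Basis. (u $ i - l $ i) \<bullet> b)"
    using le by (intro prod_ennreal prod_nonneg) (auto simp: inner_diff_left)
  also have "\<dots> = ennreal (\<Prod>b\<in>Basis. (u - l) \<bullet> b)"
    by (simp add: prod_Basis_vec inner_axis)
  finally show "emeasure (distr (Pi\<^sub>M UNIV (\<lambda>_::'n. lborel :: 'a measure)) borel (\<lambda>f. \<chi> i. f i)) (box l u)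
      = (\<Prod>b\<in>Basis. (u - l) \<bullet> b)" .
qed simp

text \<open>Fubini for products of functions of one coordinate each. The weighted volume and the
  monomials both have this form, so every inner product of monomial sections becomes a product of
  planar integrals.\<close>

lemma
  fixes f :: "'n::finite \<Rightarrow> 'a::euclidean_space \<Rightarrow> 'b::{real_normed_field,banach,second_countable_topology}"
  assumes f: "\<And>i. integrable lborel (f i)"
  shows integrable_prod_vec: "integrable lborel (\<lambda>x :: 'a^'n. \<Prod>i\<in>UNIV. f i (x $ i))"
    and integral_prod_vec: "(LINT x|lborel. (\<Prod>i\<in>UNIV. f i ((x :: 'a^'n) $ i))) = (\<Prod>i\<in>UNIV. integral\<^sup>L lborel (f i))"
proof -
  interpret product_sigma_finite "\<lambda>_::'n. lborel :: 'a measure" ..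
  have [measurable]: "f i \<in> borel_measurable borel" for i
    using borel_measurable_integrable[OF f[of i]] by simp
  note meas = vec_lambda_measurable
  have [measurable]: "(\<lambda>x :: 'a^'n. x $ i) \<in> borel \<rightarrow>\<^sub>M borel" for i
    by (intro borel_measurable_continuous_onI continuous_intros)
  have m: "(\<lambda>x :: 'a^'n. \<Prod>i\<in>UNIV. f i (x $ i)) \<in> borel_measurable borel"
    by measurable
  show "integrable lborel (\<lambda>x :: 'a^'n. \<Prod>i\<in>UNIV. f i (x $ i))"
    unfolding lborel_vec_PiM[symmetric]
    by (subst integrable_distr_eq[OF meas]) (use m product_integrable_prod[of UNIV f] f in auto)
  show "(LINT x|lborel. (\<Prod>i\<in>UNIV. f i ((x :: 'a^'n) $ i))) = (\<Prod>i\<in>UNIV. integral\<^sup>L lborel (f i))"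
    unfolding lborel_vec_PiM[symmetric]
    by (subst integral_distr[OF meas]) (use m product_integral_prod[of UNIV f] f in auto)
qed

section \<open>Planar Lebesgue measure: rotations and radial functions\<close>

lemma lborel_complex_vec2:
  "distr lborel borel (\<lambda>v :: real^2. Complex (v $ 1) (v $ 2)) = (lborel :: complex measure)"
proof (rule lborel_eqI[symmetric])
  have meas [measurable]: "(\<lambda>v :: real^2. Complex (v $ 1) (v $ 2)) \<in> borel \<rightarrow>\<^sub>M borel"
    unfolding complex_eq by (intro borel_measurable_continuous_onI continuous_intros)
  fix l u :: complex assume lu: "\<And>b. b \<in> Basis \<Longrightarrow> l \<bullet> b \<le> u \<bullet> b"
  have le: "Re l \<le> Re u" "Im l \<le> Im u"
    using lu[of 1] lu[of \<i>] by (auto simp: Basis_complex_def)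
  have pre: "(\<lambda>v :: real^2. Complex (v $ 1) (v $ 2)) -` box l u = box (vector [Re l, Im l]) (vector [Re u, Im u])"
    by (auto simp: mem_box_cart mem_box Basis_complex_def forall_2)
  show "emeasure (distr lborel borel (\<lambda>v :: real^2. Complex (v $ 1) (v $ 2))) (box l u) = (\<Prod>b\<in>Basis. (u - l) \<bullet> b)"
    using le
    apply (subst emeasure_distr)
    apply (auto simp: pre Basis_complex_def)
    apply (subst emeasure_lborel_box)
     apply (auto simp: prod_Basis_vec inner_axis UNIV_2 mult.commute)
     apply (auto simp: Basis_vec_def inner_axis UNIV_2)
    done
qed simp

text \<open>Multiplication by a unit number is an orthogonal map of the plane. The plane is
  identified with \<open>real^2\<close> so that the invariance of volume under orthogonal
  transformations applies.\<close>

lemma lborel_complex_rotate: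
  assumes c: "cmod c = 1"
  shows "distr lborel borel ((*) c) = (lborel :: complex measure)"
proof (rule lborel_eqI[symmetric])
  define T where "T = (\<lambda>v :: real^2. Complex (v $ 1) (v $ 2))"
  define T' where "T' = (\<lambda>z. vector [Re z, Im z] :: real^2)"
  have TT': "T (T' z) = z" "T' (T v) = v" for z v
    by (auto simp: T_def T'_def vec_eq_iff forall_2)
  have meas [measurable]: "T \<in> borel \<rightarrow>\<^sub>M borel"
    unfolding complex_eq T_def by (intro borel_measurable_continuous_onI continuous_intros)
  \<comment> \<open>A preimage under multiplication by c is an image under multiplication by its
    inverse, so the orthogonal map is taken to be the inverse rotation.\<close>
  define f where "f = (\<lambda>v. T' (inverse c * T v))"
  have nT: "norm (T' z) = cmod z" for z
    by (simp add: T'_def norm_vec_def L2_set_def UNIV_2 cmod_def)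
  have nT2: "cmod (T v) = norm v" for v
    using nT[of "T v"] TT' by simp
  have "linear f"
    by (rule linearI) (auto simp: f_def T_def T'_def vec_eq_iff forall_2 complex_eq algebra_simps add_divide_distrib)
  then have orth: "orthogonal_transformation f"
    using c by (simp add: orthogonal_transformation f_def nT nT2 norm_mult norm_inverse)
  fix l u :: complex assume lu: "\<And>b. b \<in> Basis \<Longrightarrow> l \<bullet> b \<le> u \<bullet> b"
  have pre: "T -` box l u = box (T' l) (T' u)"
    by (auto simp: mem_box_cart mem_box Basis_complex_def forall_2 T_def T'_def)
  have "c \<noteq> 0" using c by auto
  have pre2: "T -` (((*) c) -` box l u) = f ` (T -` box l u)"
  proof (intro set_eqI iffI)
    fix v assume v: "v \<in> T -` (((*) c) -` box l u)"
    have "inverse c * (c * T v) = T v" using \<open>c \<noteq> 0\<close> by simp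
    then have "f (T' (c * T v)) = v" by (simp only: f_def TT')
    moreover have "T' (c * T v) \<in> T -` box l u" using v by (simp add: TT')
    ultimately show "v \<in> f ` (T -` box l u)" by (metis imageI)
  next
    fix v assume "v \<in> f ` (T -` box l u)"
    then obtain x where "v = T' (inverse c * T x)" "T x \<in> box l u" by (auto simp: f_def)
    moreover have "c * (inverse c * T x) = T x" using \<open>c \<noteq> 0\<close> by (simp add: field_simps)
    ultimately show "v \<in> T -` (((*) c) -` box l u)" by (simp only: TT' vimage_eq)
  qed
  have b: "T -` box l u \<in> lmeasurable" unfolding pre by simp
  have cm: "((*) c) -` box l u \<in> sets borel"
    using measurable_sets[of "(*) c" borel borel "box l u"] by simp
  have bs: "T -` (((*) c) -` box l u) \<in> sets borel"
    using measurable_sets[OF meas cm] by simp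
  have "emeasure (distr lborel borel ((*) c)) (box l u) = emeasure lborel (((*) c) -` box l u)"
    by (subst emeasure_distr) auto
  also have "\<dots> = emeasure (distr lborel borel T) (((*) c) -` box l u)"
    unfolding T_def lborel_complex_vec2 ..
  also have "\<dots> = emeasure lborel (T -` (((*) c) -` box l u))"
    using cm by (subst emeasure_distr) auto
  also have "\<dots> = emeasure lebesgue (f ` (T -` box l u))"
    using bs by (simp add: pre2)
  also have "\<dots> = measure lebesgue (f ` (T -` box l u))"
    using measurable_orthogonal_image[OF orth b] by (simp add: emeasure_eq_measure2)
  also have "\<dots> = measure lebesgue (T -` box l u)"
    using measure_orthogonal_image[OF orth b] by simp
  also have "\<dots> = emeasure lebesgue (T -` box l u)"
    using b by (simp add: emeasure_eq_measure2)
  also have "\<dots> = emeasure lborel (T -` box l u)"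
    by (simp add: pre)
  also have "\<dots> = emeasure (distr lborel borel T) (box l u)"
    by (subst emeasure_distr) auto
  also have "\<dots> = (\<Prod>b\<in>Basis. (u - l) \<bullet> b)"
    unfolding T_def lborel_complex_vec2 using lu by simp
  finally show "emeasure (distr lborel borel ((*) c)) (box l u) = (\<Prod>b\<in>Basis. (u - l) \<bullet> b)" .
qed simp

text \<open>The disc of squared radius t has area \<open>pi * t\<close>, so the distribution
  function is linear on the half-line. This is integration in polar coordinates for radial
  functions.\<close>

lemma distr_cmod_square:
  "distr lborel borel (\<lambda>z. (cmod z)\<^sup>2) = density lborel (\<lambda>r::real. ennreal (pi * indicator {0..} r))"
proof (rule measure_eqI_generator_eq[where E = "range atMost" and A = "\<lambda>i. {..real i}" and \<Omega> = UNIV])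
  have "borel = sigma UNIV (range (\<lambda>a::real. {..a}))" by (rule borel_eq_atMost)
  then have borel: "sets borel = sigma_sets UNIV (range (atMost :: real \<Rightarrow> _))"
    by (metis sets_measure_of subset_UNIV Pow_UNIV)
  show "Int_stable (range (atMost :: real \<Rightarrow> _))" by (auto simp: Int_stable_def)
  show "sets (distr lborel borel (\<lambda>z. (cmod z)\<^sup>2)) = sigma_sets UNIV (range atMost)"
    unfolding sets_distr sets_density sets_lborel by (rule borel)
  show "sets (density lborel (\<lambda>r::real. ennreal (pi * indicator {0..} r))) = sigma_sets UNIV (range atMost)"
    unfolding sets_distr sets_density sets_lborel by (rule borel)
  have L: "emeasure (distr lborel borel (\<lambda>z. (cmod z)\<^sup>2)) {..t} = ennreal (pi * max t 0)" for t
  proof -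
    have "emeasure (distr lborel borel (\<lambda>z. (cmod z)\<^sup>2)) {..t} = emeasure lborel {z. (cmod z)\<^sup>2 \<le> t}"
      by (subst emeasure_distr) (auto simp: vimage_def)
    also have "\<dots> = ennreal (pi * max t 0)"
    proof (cases "t \<ge> 0")
      case True
      have "{z. (cmod z)\<^sup>2 \<le> t} = cball 0 (sqrt t)"
        by (auto simp: real_le_rsqrt sqrt_le_D) (metis True norm_ge_zero power_mono real_sqrt_pow2)
      then show ?thesis using True by (simp add: emeasure_cball unit_ball_vol_2)
    next
      case False
      then have "{z. (cmod z)\<^sup>2 \<le> t} = {}"
        by (auto simp: not_le) (smt (verit) zero_le_power2)
      then show ?thesis using False by simp
    qed
    finally show ?thesis .
  qed
  show "emeasure (distr lborel borel (\<lambda>z. (cmod z)\<^sup>2)) {..real i} \<noteq> \<infinity>" for i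
    by (simp add: L)
  fix X :: "real set" assume "X \<in> range atMost"
  then obtain t where X: "X = {..t}" by auto
  have "emeasure (density lborel (\<lambda>r::real. ennreal (pi * indicator {0..} r))) {..t}
      = (\<integral>\<^sup>+ r. ennreal (pi * indicator {0..} r) * indicator {..t} r \<partial>lborel)"
    by (subst emeasure_density) auto
  also have "\<dots> = (\<integral>\<^sup>+ r. ennreal pi * indicator {0..t} r \<partial>lborel)"
    by (intro nn_integral_cong) (auto split: split_indicator)
  also have "\<dots> = ennreal (pi * max t 0)"
    by (subst nn_integral_cmult_indicator) (auto simp: ennreal_mult max_def emeasure_lborel_Icc_eq)
  finally show "emeasure (distr lborel borel (\<lambda>z. (cmod z)\<^sup>2)) X
      = emeasure (density lborel (\<lambda>r::real. ennreal (pi * indicator {0..} r))) X"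
    by (simp add: X L)
qed (auto simp: real_arch_simple)

lemma
  fixes F :: "real \<Rightarrow> real"
  assumes [measurable]: "F \<in> borel_measurable borel"
  shows integrable_radial: "integrable lborel (\<lambda>z. F ((cmod z)\<^sup>2)) \<longleftrightarrow> set_integrable lborel {0..} F"
    and integral_radial: "(LINT z|lborel. F ((cmod z)\<^sup>2)) = pi * (LINT r:{0..}|lborel. F r)"
proof -
  have "integrable lborel (\<lambda>z. F ((cmod z)\<^sup>2)) \<longleftrightarrow> integrable (distr lborel borel (\<lambda>z. (cmod z)\<^sup>2)) F"
    by (subst integrable_distr_eq) auto
  also have "\<dots> \<longleftrightarrow> integrable lborel (\<lambda>r. pi * (indicator {0..} r * F r))"
    unfolding distr_cmod_square by (subst integrable_density) (auto simp: mult.assoc)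
  finally show "integrable lborel (\<lambda>z. F ((cmod z)\<^sup>2)) \<longleftrightarrow> set_integrable lborel {0..} F"
    by (simp add: set_integrable_def)
  have "(LINT z|lborel. F ((cmod z)\<^sup>2)) = integral\<^sup>L (distr lborel borel (\<lambda>z. (cmod z)\<^sup>2)) F"
    by (subst integral_distr) auto
  also have "\<dots> = (LINT r|lborel. pi * (indicator {0..} r * F r))"
    unfolding distr_cmod_square by (subst integral_density) (auto simp: mult.assoc)
  finally show "(LINT z|lborel. F ((cmod z)\<^sup>2)) = pi * (LINT r:{0..}|lborel. F r)"
    by (simp add: set_lebesgue_integral_def)
qed

text \<open>Rotation by the angle \<open>pi / (k - l)\<close> changes the sign of the integrand.\<close>

lemma integral_radial_monomials:
  fixes w :: "real \<Rightarrow> real"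
  assumes [measurable]: "w \<in> borel_measurable borel" and "k \<noteq> l"
  shows "(LINT z|lborel. of_real (w (cmod z)) * z ^ k * cnj z ^ l) = 0"
proof -
  define \<theta> where "\<theta> = pi / (real k - real l)"
  define c where "c = cis \<theta>"
  have "c ^ k * cnj c ^ l = cis (real k * \<theta> - real l * \<theta>)"
    by (simp only: c_def cis_cnj Complex.DeMoivre cis_mult) (simp add: algebra_simps)
  also have "real k * \<theta> - real l * \<theta> = (real k - real l) * \<theta>"
    by (simp add: algebra_simps)
  also have "\<dots> = pi"
    using \<open>k \<noteq> l\<close> by (simp add: \<theta>_def)
  finally have c: "c ^ k * cnj c ^ l = -1" by simp
  have n: "cmod c = 1" by (simp add: c_def)
  have mc [measurable]: "cnj \<in> borel \<rightarrow>\<^sub>M borel"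
    by (intro borel_measurable_continuous_onI continuous_intros)
  define I where "I = (LINT z|lborel. of_real (w (cmod z)) * z ^ k * cnj z ^ l)"
  have "I = (LINT z|distr lborel borel ((*) c). of_real (w (cmod z)) * z ^ k * cnj z ^ l)"
    unfolding lborel_complex_rotate[OF n] I_def ..
  also have "\<dots> = (LINT z|lborel. of_real (w (cmod (c * z))) * (c * z) ^ k * cnj (c * z) ^ l)"
    by (subst integral_distr) auto
  also have "\<dots> = (LINT z|lborel. (c ^ k * cnj c ^ l) * (of_real (w (cmod z)) * z ^ k * cnj z ^ l))"
    by (intro Bochner_Integration.integral_cong refl) (simp add: norm_mult n power_mult_distrib mult_ac)
  also have "\<dots> = - I"
    unfolding c I_def by simp
  finally show ?thesis by (simp add: I_def)
qed

section \<open>Radial moments\<close>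

text \<open>The bound on \<open>r = |w|\<close>, that is on the square of \<open>|z|\<close>. It is
  an extended real so that the plane (\<open>e > 0\<close>) and the disc (\<open>e < 0\<close>)
  share one interval integral.\<close>

definition radius :: "real \<Rightarrow> ereal" where
  "radius e = (if e > 0 then \<infinity> else ereal (sqrt (- (1 / e))))"

lemma radius_pos: "e \<noteq> 0 \<Longrightarrow> 0 < radius e"
  by (auto simp: radius_def field_simps)

lemma less_radius_iff:
  assumes "e \<noteq> 0" "0 < r"
  shows "ereal r < radius e \<longleftrightarrow> 0 < 1 + e * r\<^sup>2"
proof (cases "e > 0")
  case True
  then show ?thesis by (simp add: radius_def add_pos_nonneg)
next
  case False
  have "ereal r < radius e \<longleftrightarrow> sqrt (r\<^sup>2) < sqrt (- (1 / e))"
    using assms False by (simp add: radius_def)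
  also have "\<dots> \<longleftrightarrow> r\<^sup>2 < - (1 / e)" by (rule real_sqrt_less_iff)
  also have "\<dots> \<longleftrightarrow> 0 < 1 + e * r\<^sup>2" using assms False by (auto simp: field_simps)
  finally show ?thesis .
qed

text \<open>The sign condition covers two mechanisms: for \<open>e > 0\<close> the base tends to
  infinity and the exponent is negative, for \<open>e < 0\<close> the base tends to 0 and the
  exponent is positive.\<close>

lemma powr_tendsto_0_at_radius:
  assumes "e * \<gamma> < 0"
  shows "(((\<lambda>r. (1 + e * r\<^sup>2) powr \<gamma>) \<circ> real_of_ereal) \<longlongrightarrow> 0) (at_left (radius e))"
proof (cases "e > 0")
  case True
  then have "\<gamma> < 0" using assms by (simp add: mult_less_0_iff)
  moreover have "filterlim (\<lambda>r. 1 + e * r\<^sup>2) at_top at_top"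
    using True by real_asymp
  ultimately show ?thesis
    using True by (simp add: radius_def ereal_tendsto_simps tendsto_neg_powr)
next
  case False
  then have e: "e < 0" "\<gamma> > 0" using assms by (auto simp: mult_less_0_iff)
  define R where "R = sqrt (- (1 / e))"
  have R: "1 + e * R\<^sup>2 = 0" using e by (simp add: R_def real_sqrt_pow2_iff field_simps)
  have "((\<lambda>r. 1 + e * r\<^sup>2) \<longlongrightarrow> 1 + e * R\<^sup>2) (at_left R)"
    by (intro tendsto_intros)
  moreover have "eventually (\<lambda>r. 0 \<le> 1 + e * r\<^sup>2) (at_left R)"
  proof -
    have "R > 0" using e by (simp add: R_def field_simps)
    then have "eventually (\<lambda>r. r \<in> {0<..<R}) (at_left R)" by (rule eventually_at_left_real)
    then show ?thesis
    proof eventually_elim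
      case (elim r)
      then have "r\<^sup>2 \<le> R\<^sup>2" by (intro power_mono) auto
      then have "e * r\<^sup>2 \<ge> e * R\<^sup>2" using e by (intro mult_left_mono_neg) auto
      then show ?case using R by simp
    qed
  qed
  ultimately have "((\<lambda>r. (1 + e * r\<^sup>2) powr \<gamma>) \<longlongrightarrow> 0 powr \<gamma>) (at_left R)"
    using e unfolding R by (intro tendsto_powr2) auto
  then show ?thesis using False e by (simp add: radius_def R_def ereal_tendsto_simps)
qed

text \<open>An antiderivative is \<open>(1 + e * r^2) powr \<gamma> / (2 * e * \<gamma>)\<close>; it
  vanishes at the outer end, so the value comes from r = 0 alone.\<close>

lemma
  assumes "e * \<gamma> < 0"
  shows radial_powr_integrable: "set_integrable lborel (einterval 0 (radius e)) (\<lambda>r. r * (1 + e * r\<^sup>2) powr (\<gamma> - 1))"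
    and radial_powr_integral: "(LBINT r=0..radius e. r * (1 + e * r\<^sup>2) powr (\<gamma> - 1)) = - (1 / (2 * e * \<gamma>))"
proof -
  have e: "e \<noteq> 0" "\<gamma> \<noteq> 0" using assms by auto
  have pos: "0 < 1 + e * r\<^sup>2" "0 < r" if "0 < ereal r" "ereal r < radius e" for r
    using less_radius_iff[OF e(1), of r] that by auto
  have der: "DERIV (\<lambda>r. (1 + e * r\<^sup>2) powr \<gamma> / (2 * e * \<gamma>)) r :> r * (1 + e * r\<^sup>2) powr (\<gamma> - 1)"
    if "0 < ereal r" "ereal r < radius e" for r
  proof -
    have "DERIV (\<lambda>r. 1 + e * r\<^sup>2) r :> 2 * e * r"
      by (auto intro!: derivative_eq_intros)
    from DERIV_cdivide[OF DERIV_fun_powr[OF this pos(1)[OF that], of \<gamma>], of "2 * e * \<gamma>"]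
    show ?thesis using e by (simp add: mult_ac)
  qed
  have cont: "isCont (\<lambda>r. r * (1 + e * r\<^sup>2) powr (\<gamma> - 1)) r" if "0 < ereal r" "ereal r < radius e" for r
    using pos[OF that] by (intro continuous_intros) auto
  have nonneg: "AE r in lborel. 0 < ereal r \<longrightarrow> ereal r < radius e \<longrightarrow> 0 \<le> r * (1 + e * r\<^sup>2) powr (\<gamma> - 1)"
    by (intro AE_I2) (simp add: less_imp_le)
  have "((\<lambda>r. (1 + e * r\<^sup>2) powr \<gamma> / (2 * e * \<gamma>)) \<longlongrightarrow> (1 + e * 0\<^sup>2) powr \<gamma> / (2 * e * \<gamma>)) (at_right 0)"
    using e by (intro tendsto_intros) auto
  then have A: "(((\<lambda>r. (1 + e * r\<^sup>2) powr \<gamma> / (2 * e * \<gamma>)) \<circ> real_of_ereal) \<longlongrightarrow> 1 / (2 * e * \<gamma>)) (at_right 0)"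
    by (simp add: zero_ereal_def ereal_tendsto_simps)
  have B: "(((\<lambda>r. (1 + e * r\<^sup>2) powr \<gamma> / (2 * e * \<gamma>)) \<circ> real_of_ereal) \<longlongrightarrow> 0) (at_left (radius e))"
    using tendsto_divide_zero[OF powr_tendsto_0_at_radius[OF assms], of "2 * e * \<gamma>"] by (simp add: o_def)
  note * = interval_integral_FTC_nonneg[OF radius_pos[OF e(1)] der cont nonneg A B]
  show "set_integrable lborel (einterval 0 (radius e)) (\<lambda>r. r * (1 + e * r\<^sup>2) powr (\<gamma> - 1))"
    using *(1) by (simp add: zero_ereal_def)
  show "(LBINT r=0..radius e. r * (1 + e * r\<^sup>2) powr (\<gamma> - 1)) = - (1 / (2 * e * \<gamma>))"
    using *(2) by (simp add: zero_ereal_def)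
qed

section \<open>Binomial coefficients and the recurrence of the moments\<close>

definition degrees :: "real \<Rightarrow> nat \<Rightarrow> nat set" where
  "degrees e m = {k. e = 1 \<longrightarrow> k \<le> m}"

text \<open>Coefficient of \<open>s ^ k\<close> in \<open>(1 + e * s) powr (m / e)\<close>, equal to
  \<open>m (m - e) ... (m - (k - 1) e) / k!\<close> for nonzero e. For \<open>e = 1\<close> it
  vanishes beyond k = m, which is the cutoff in \<open>degrees\<close>.\<close>

definition expansion_coeff :: "real \<Rightarrow> nat \<Rightarrow> nat \<Rightarrow> real" where
  "expansion_coeff e m k = ((real m / e) gchoose k) * e ^ k"

lemma expansion_coeff_Suc:
  assumes "e \<noteq> 0"
  shows "real (Suc k) * expansion_coeff e m (Suc k) = (real m - real k * e) * expansion_coeff e m k"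
proof -
  have "real (Suc k) * expansion_coeff e m (Suc k) = (real (Suc k) * ((real m / e) gchoose Suc k)) * e ^ Suc k"
    by (simp add: expansion_coeff_def)
  also have "real (Suc k) * ((real m / e) gchoose Suc k) = (real m / e - real k) * ((real m / e) gchoose k)"
    using gbinomial_mult_1[of "real m / e" k] by (simp add: algebra_simps)
  also have "(real m / e - real k) * ((real m / e) gchoose k) * e ^ Suc k
      = (real m / e * e - real k * e) * (((real m / e) gchoose k) * e ^ k)"
    by (simp only: power_Suc) algebra
  finally show ?thesis using assms by (simp add: expansion_coeff_def)
qed

lemma expansion_coeff_0: "expansion_coeff e m 0 = 1"
  by (simp add: expansion_coeff_def)

text \<open>The disjunction makes all coefficients with index in \<open>degrees\<close> positive.
  For \<open>e < 0\<close> the bound \<open>- e < m\<close> makes the exponent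
  \<open>- (m / e) - 2\<close> of the weighted volume greater than -1, which is integrability at the
  rim of the disc.\<close>

locale admissible =
  fixes e :: real and m :: nat
  assumes e: "e = 1 \<or> e < 0" and m: "- e < real m" "0 < m"
begin

lemma e_nonzero: "e \<noteq> 0"
  using e by auto

lemma degrees_Suc: "Suc k \<in> degrees e m \<Longrightarrow> k \<in> degrees e m \<and> 0 < real m - real k * e"
proof (cases "e = 1")
  case False
  then have "e < 0" using e by auto
  then have "real k * e \<le> 0" by (simp add: mult_nonneg_nonpos)
  moreover have "0 < real m" using m by simp
  ultimately show ?thesis using False by (simp add: degrees_def del: of_nat_0_less_iff)
qed (simp add: degrees_def)

lemma expansion_coeff_pos: "k \<in> degrees e m \<Longrightarrow> 0 < expansion_coeff e m k"
proof (induction k)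
  case (Suc k)
  then have "0 < real (Suc k) * expansion_coeff e m (Suc k)"
    using degrees_Suc[of k] unfolding expansion_coeff_Suc[OF e_nonzero] by simp
  then show ?case by (simp add: zero_less_mult_iff)
qed (simp add: expansion_coeff_0)

text \<open>For \<open>e = 1\<close> this is the finite binomial theorem. For \<open>e < 0\<close>
  the points of the disc satisfy \<open>|e * s| < 1\<close>, where Newton's series converges; its
  terms are nonnegative, so it is also an unordered sum.\<close>

lemma has_sum_cf:
  assumes "0 \<le> s" "0 < 1 + e * s"
  shows "((\<lambda>k. expansion_coeff e m k * s ^ k) has_sum (1 + e * s) powr (real m / e)) (degrees e m)"
proof (cases "e = 1")
  case True
  have "(\<Sum>k\<le>m. expansion_coeff e m k * s ^ k) = (1 + s) ^ m"
    using binomial_ring[of s 1 m] by (simp add: expansion_coeff_def True add.commute flip: binomial_gbinomial)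
  moreover have "degrees e m = {..m}" by (auto simp: degrees_def True)
  ultimately show ?thesis
    using True assms by (simp add: has_sum_finite_iff powr_realpow)
next
  case False
  then have "e < 0" using e by auto
  then have "\<bar>e * s\<bar> < 1" using assms by (auto simp: abs_mult)
  from gen_binomial_real[OF this, of "real m / e"]
  have "(\<lambda>k. expansion_coeff e m k * s ^ k) sums (1 + e * s) powr (real m / e)"
    by (simp add: expansion_coeff_def power_mult_distrib mult_ac)
  moreover have "degrees e m = UNIV" using False by (simp add: degrees_def)
  moreover have "0 \<le> expansion_coeff e m k * s ^ k" for k
    using expansion_coeff_pos[of k] assms \<open>degrees e m = UNIV\<close> by simp
  ultimately show ?thesis
    using sums_nonneg_imp_has_sum by auto
qed

text \<open>Up to a constant the squared norm of \<open>w ^ k\<close> in polar coordinates: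
  \<open>r ^ (2 * k)\<close> from the monomial, one more r from the area element, the exponent
  \<open>- (m / e)\<close> from the bundle metric and -2 from the volume.\<close>

definition moment :: "nat \<Rightarrow> real" where
  "moment k = (LBINT r=0..radius e. r ^ (2 * k + 1) * (1 + e * r\<^sup>2) powr (- (real m / e) - 2))"

lemma pos_below_radius: "0 < 1 + e * r\<^sup>2" "0 < r" if "0 < ereal r" "ereal r < radius e" for r
    using less_radius_iff[OF e_nonzero, of r] that by auto

text \<open>The product is \<open>- m - e\<close>. The exponent is one above that of the weighted
  volume, so it is the \<open>\<gamma>\<close> to which \<open>radial_powr_integral\<close> is
  applied for \<open>moment 0\<close>.\<close>

lemma exponent_sign: "e * (- (real m / e) - 1) < 0"
  using e m by (auto simp: field_simps)

lemma moment_integrable: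
  assumes "k \<in> degrees e m"
  shows "set_integrable lborel (einterval 0 (radius e)) (\<lambda>r. r ^ (2 * k + 1) * (1 + e * r\<^sup>2) powr (- (real m / e) - 2))"
proof -
  \<comment> \<open>Comparison with an integrand of known integral: on the plane
    \<open>r ^ (2 * k)\<close> is absorbed by \<open>(1 + r^2) ^ m\<close>, leaving
    \<open>\<gamma> = -1\<close>; on the disc it is bounded by a constant.\<close>
  obtain C \<gamma> where C: "e * \<gamma> < 0"
    "\<And>r. 0 < r \<Longrightarrow> 0 < 1 + e * r\<^sup>2 \<Longrightarrow> r ^ (2 * k) * (1 + e * r\<^sup>2) powr (- (real m / e) - 2) \<le> C * (1 + e * r\<^sup>2) powr (\<gamma> - 1)"
  proof (cases "e = 1")
    case True
    have "r ^ (2 * k) * (1 + e * r\<^sup>2) powr (- (real m / e) - 2) \<le> 1 * (1 + e * r\<^sup>2) powr (-1 - 1)" for r :: real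
    proof -
      have "r ^ (2 * k) \<le> (1 + r\<^sup>2) ^ k" unfolding power_mult by (rule power_mono) auto
      also have "\<dots> \<le> (1 + r\<^sup>2) ^ m"
        using assms True by (intro power_increasing) (auto simp: degrees_def)
      also have "\<dots> = (1 + r\<^sup>2) powr (real m)" by (simp add: powr_realpow add_pos_nonneg)
      finally have "r ^ (2 * k) * (1 + r\<^sup>2) powr (- real m - 2) \<le> (1 + r\<^sup>2) powr (real m) * (1 + r\<^sup>2) powr (- real m - 2)"
        by (rule mult_right_mono) auto
      then show ?thesis using True by (simp flip: powr_add)
    qed
    then show ?thesis using that[of "-1" 1] True by simp
  next
    case False
    then have "e < 0" using e by auto
    have "r ^ (2 * k) \<le> (- (1 / e)) ^ k" if "0 < 1 + e * r\<^sup>2" for r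
      unfolding power_mult using that \<open>e < 0\<close> by (intro power_mono) (auto simp: field_simps)
    then have "r ^ (2 * k) * (1 + e * r\<^sup>2) powr (- (real m / e) - 2) \<le> (- (1 / e)) ^ k * (1 + e * r\<^sup>2) powr (- (real m / e) - 2)"
      if "0 < 1 + e * r\<^sup>2" for r
      using that by (intro mult_right_mono) auto
    moreover have "- (real m / e) - 2 = (- (real m / e) - 1) - 1" by simp
    ultimately show ?thesis using that[OF exponent_sign, of "(- (1 / e)) ^ k"] by metis
  qed
  have "set_integrable lborel (einterval 0 (radius e)) (\<lambda>r. C * (r * (1 + e * r\<^sup>2) powr (\<gamma> - 1)))"
    using radial_powr_integrable[OF C(1)] by simp
  then show ?thesis
  proof (rule set_integrable_bound)
    show "set_borel_measurable lborel (einterval 0 (radius e)) (\<lambda>r. r ^ (2 * k + 1) * (1 + e * r\<^sup>2) powr (- (real m / e) - 2))"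
      unfolding set_borel_measurable_def by measurable
    show "AE r in lborel. r \<in> einterval 0 (radius e) \<longrightarrow>
        norm (r ^ (2 * k + 1) * (1 + e * r\<^sup>2) powr (- (real m / e) - 2)) \<le> norm (C * (r * (1 + e * r\<^sup>2) powr (\<gamma> - 1)))"
    proof (intro AE_I2 impI)
      fix r assume "r \<in> einterval 0 (radius e)"
      then have r: "0 < r" "0 < 1 + e * r\<^sup>2" using pos_below_radius by (auto simp: einterval_def)
      have "r * (r ^ (2 * k) * (1 + e * r\<^sup>2) powr (- (real m / e) - 2)) \<le> r * (C * (1 + e * r\<^sup>2) powr (\<gamma> - 1))"
        using r C(2)[of r] by (intro mult_left_mono) auto
      moreover have "0 \<le> r * (r ^ (2 * k) * (1 + e * r\<^sup>2) powr (- (real m / e) - 2))" using r by simp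
      ultimately have "norm (r * (r ^ (2 * k) * (1 + e * r\<^sup>2) powr (- (real m / e) - 2))) \<le> norm (r * (C * (1 + e * r\<^sup>2) powr (\<gamma> - 1)))"
        unfolding real_norm_def by linarith
      then show "norm (r ^ (2 * k + 1) * (1 + e * r\<^sup>2) powr (- (real m / e) - 2)) \<le> norm (C * (r * (1 + e * r\<^sup>2) powr (\<gamma> - 1)))"
        by (simp only: power_add power_one_right mult_ac)
    qed
  qed
qed

text \<open>The value is \<open>1 / (2 * (m + e))\<close>, so the constant kernel found in the end
  is the product of the numbers \<open>(m + e i) / 2\<close>.\<close>

lemma moment_0_pos: "0 < moment 0"
proof -
  have "moment 0 = (LBINT r=0..radius e. r * (1 + e * r\<^sup>2) powr ((- (real m / e) - 1) - 1))"
    by (simp add: moment_def algebra_simps)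
  also have "\<dots> = - (1 / (2 * (e * (- (real m / e) - 1))))"
    by (subst radial_powr_integral[OF exponent_sign]) (simp add: mult.assoc)
  also have "\<dots> > 0" using exponent_sign by (auto simp: divide_less_0_iff)
  finally show ?thesis .
qed

text \<open>Integration by parts: the derivative of \<open>F\<close> below is twice the difference
  of the integrands of the two sides, and \<open>F\<close> vanishes at both ends. The factors are
  those of \<open>expansion_coeff_Suc\<close> on exchanged sides, so the product of coefficient and
  moment does not change with k.\<close>

lemma moment_Suc:
  assumes k: "Suc k \<in> degrees e m"
  shows "real (Suc k) * moment k = (real m - real k * e) * moment (Suc k)"
proof -
  define W where "W = (\<lambda>r::real. (1 + e * r\<^sup>2) powr (- (real m / e) - 2))"
  define F where "F = (\<lambda>r::real. r ^ (2 * k + 2) * (1 + e * r\<^sup>2) powr (- (real m / e) - 1))"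
  define f where "f = (\<lambda>r. (2 * real (Suc k)) * (r ^ (2 * k + 1) * W r) - (2 * (real m - real k * e)) * (r ^ (2 * Suc k + 1) * W r))"
  have k': "k \<in> degrees e m" using degrees_Suc[OF k] by simp
  note I = moment_integrable[OF k', folded W_def] moment_integrable[OF k, folded W_def]
  have int: "set_integrable lborel (einterval 0 (radius e)) f"
    unfolding f_def W_def by (intro set_integral_diff set_integrable_mult_right moment_integrable k k')
  have der: "(F has_vector_derivative f r) (at r)" if "0 < ereal r" "ereal r < radius e" for r
  proof -
    define X where "X = 1 + e * r\<^sup>2"
    have X: "X > 0" "r > 0" using pos_below_radius[OF that] by (auto simp: X_def)
    have P: "X powr (- (real m / e) - 1) = W r * X"
    proof -
      have "W r * X = X powr (- (real m / e) - 2) * X powr 1"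
        using X by (simp add: W_def X_def)
      also have "\<dots> = X powr (- (real m / e) - 1)" unfolding powr_add[symmetric] by (rule arg_cong) simp
      finally show ?thesis ..
    qed
    have P2: "X powr (- (real m / e) - 1 - 1) = W r"
      by (simp add: W_def X_def[symmetric] algebra_simps)
    have "DERIV (\<lambda>r. r ^ (2 * k + 2)) r :> real (2 * k + 2) * r ^ (2 * k + 1)"
      using DERIV_pow[of "2 * k + 2" r] by simp
    moreover have "DERIV (\<lambda>r. 1 + e * r\<^sup>2) r :> e * (2 * r)"
      by (auto intro!: derivative_eq_intros)
    then have "DERIV (\<lambda>r. (1 + e * r\<^sup>2) powr (- (real m / e) - 1)) r :> (- (real m / e) - 1) * X powr (- (real m / e) - 1 - 1) * (e * (2 * r))"
      using DERIV_fun_powr[of "\<lambda>r. 1 + e * r\<^sup>2" "e * (2 * r)" r "- (real m / e) - 1"] X by (simp add: X_def)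
    ultimately have "DERIV F r :> real (2 * k + 2) * r ^ (2 * k + 1) * X powr (- (real m / e) - 1)
        + (- (real m / e) - 1) * X powr (- (real m / e) - 1 - 1) * (e * (2 * r)) * r ^ (2 * k + 2)"
      unfolding F_def X_def by (rule DERIV_mult)
    moreover have "real (2 * k + 2) * r ^ (2 * k + 1) * X powr (- (real m / e) - 1)
        + (- (real m / e) - 1) * X powr (- (real m / e) - 1 - 1) * (e * (2 * r)) * r ^ (2 * k + 2) = f r"
      unfolding P P2 f_def unfolding X_def using e_nonzero
      by (simp add: field_simps power2_eq_square)
    ultimately show ?thesis by (simp add: has_real_derivative_iff_has_vector_derivative)
  qed
  have cont: "isCont f r" if "0 < ereal r" "ereal r < radius e" for r
    using pos_below_radius[OF that] unfolding f_def W_def by (intro continuous_intros) auto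
  have "(F \<longlongrightarrow> 0 ^ (2 * k + 2) * (1 + e * 0\<^sup>2) powr (- (real m / e) - 1)) (at_right 0)"
    unfolding F_def by (intro tendsto_intros) auto
  then have A: "((F \<circ> real_of_ereal) \<longlongrightarrow> 0) (at_right 0)"
    by (simp add: zero_ereal_def ereal_tendsto_simps)
  have B: "((F \<circ> real_of_ereal) \<longlongrightarrow> 0) (at_left (radius e))"
  proof (cases "e = 1")
    case True
    \<comment> \<open>Decay at infinity rests on k < m, which is the membership of
      \<open>Suc k\<close> in \<open>degrees\<close>.\<close>
    have "real k - real m < 0" using k True by (simp add: degrees_def)
    then have lim: "((\<lambda>r::real. (1 + r\<^sup>2) powr (real k - real m)) \<longlongrightarrow> 0) at_top"
      by (intro tendsto_neg_powr) (auto, real_asymp)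
    have le: "norm (F r) \<le> (1 + r\<^sup>2) powr (real k - real m)" for r
    proof -
      have "r ^ (2 * k + 2) = (r\<^sup>2) ^ (k + 1)" using power_mult[of r 2 "k + 1"] by simp
      also have "\<dots> \<le> (1 + r\<^sup>2) ^ (k + 1)" by (intro power_mono) auto
      also have "\<dots> = (1 + r\<^sup>2) powr (real k + 1)"
        using powr_realpow[of "1 + r\<^sup>2" "k + 1"] by (simp add: add_pos_nonneg add.commute)
      finally have "r ^ (2 * k + 2) * (1 + r\<^sup>2) powr (- real m - 1) \<le> (1 + r\<^sup>2) powr (real k + 1) * (1 + r\<^sup>2) powr (- real m - 1)"
        by (intro mult_right_mono) auto
      moreover have "F r = r ^ (2 * k + 2) * (1 + r\<^sup>2) powr (- real m - 1)"
        by (simp add: F_def True)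
      moreover have "0 \<le> r ^ (2 * k + 2) * (1 + r\<^sup>2) powr (- real m - 1)"
        by (intro mult_nonneg_nonneg zero_le_even_power) auto
      moreover have "(1 + r\<^sup>2) powr (real k + 1) * (1 + r\<^sup>2) powr (- real m - 1) = (1 + r\<^sup>2) powr (real k - real m)"
        unfolding powr_add[symmetric] by (rule arg_cong) simp
      ultimately show ?thesis unfolding real_norm_def by linarith
    qed
    have "(F \<longlongrightarrow> 0) at_top"
      by (rule Lim_null_comparison[OF always_eventually lim]) (use le in blast)
    then show ?thesis using True by (simp add: radius_def ereal_tendsto_simps)
  next
    case False
    then have neg: "e < 0" using e by auto
    define R where "R = sqrt (- (1 / e))"
    have "((\<lambda>r. (1 + e * r\<^sup>2) powr (- (real m / e) - 1)) \<longlongrightarrow> 0) (at_left R)"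
      using powr_tendsto_0_at_radius[OF exponent_sign] neg by (simp add: radius_def R_def ereal_tendsto_simps)
    then have "(F \<longlongrightarrow> R ^ (2 * k + 2) * 0) (at_left R)"
      unfolding F_def by (intro tendsto_intros)
    then show ?thesis using neg by (simp add: radius_def R_def ereal_tendsto_simps)
  qed
  have "(LBINT r=0..radius e. f r) = 0 - 0"
    by (rule interval_integral_FTC_integrable[OF _ _ _ int A B])
      (use der cont radius_pos e_nonzero in \<open>auto simp: zero_ereal_def\<close>)
  moreover have "(LBINT r=0..radius e. f r) = 2 * real (Suc k) * moment k - 2 * (real m - real k * e) * moment (Suc k)"
  proof -
    define E where "E = einterval 0 (radius e)"
    have E: "(LBINT r=0..radius e. g r) = (LBINT r:E. g r)" for g :: "real \<Rightarrow> real"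
      using radius_pos[OF e_nonzero] by (simp add: interval_lebesgue_integral_def E_def less_imp_le)
    have "(LBINT r=0..radius e. f r) = (LBINT r:E. (2 * real (Suc k)) * (r ^ (2 * k + 1) * W r))
        - (LBINT r:E. (2 * (real m - real k * e)) * (r ^ (2 * Suc k + 1) * W r))"
      unfolding E f_def using I unfolding E_def W_def by (intro set_integral_diff set_integrable_mult_right)
    also have "\<dots> = 2 * real (Suc k) * (LBINT r:E. r ^ (2 * k + 1) * W r)
        - 2 * (real m - real k * e) * (LBINT r:E. r ^ (2 * Suc k + 1) * W r)"
      by (simp only: set_integral_mult_right)
    finally show ?thesis unfolding moment_def E W_def .
  qed
  ultimately have "2 * (real (Suc k) * moment k) = 2 * ((real m - real k * e) * moment (Suc k))"
    by (simp only: mult.assoc)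
  then show ?thesis by linarith
qed

text \<open>The two recurrences cancel. This is the identity behind the constant kernel: the squared
  norm of \<open>w ^ k\<close> is inversely proportional to its coefficient in the binomial
  series.\<close>

lemma expansion_coeff_moment: "k \<in> degrees e m \<Longrightarrow> expansion_coeff e m k * moment k = moment 0"
proof (induction k)
  case (Suc k)
  let ?d = "real m - real k * e"
  have d: "?d > 0" "k \<in> degrees e m" using degrees_Suc[OF Suc.prems] by auto
  have "?d * (real (Suc k) * (expansion_coeff e m (Suc k) * moment (Suc k))) = (real (Suc k) * expansion_coeff e m (Suc k)) * (?d * moment (Suc k))"
    by simp
  also have "\<dots> = ?d * (real (Suc k) * (expansion_coeff e m k * moment k))"
    unfolding expansion_coeff_Suc[OF e_nonzero] moment_Suc[OF Suc.prems, symmetric] by simp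
  finally show ?case using d Suc.IH by simp
qed (simp add: expansion_coeff_0)

end

text \<open>One coordinate factor of the volume density times the m-th power of the bundle metric,
  with \<open>t = |z|\<close>. Here \<open>4 * t^2\<close> is the Jacobian of squaring, and the
  value 0 elsewhere allows integrals over the whole plane.\<close>

definition rweight :: "real \<Rightarrow> nat \<Rightarrow> real \<Rightarrow> real" where
  "rweight e m t = (if 0 < t \<and> 0 < 1 + e * t ^ 4 then 4 / pi * t\<^sup>2 * (1 + e * t ^ 4) powr (- (real m / e) - 2) else 0)"

lemma rweight_measurable [measurable]: "rweight e m \<in> borel_measurable borel"
  unfolding rweight_def[abs_def] by measurable

lemma rweight_nonneg: "0 \<le> rweight e m t"
  by (simp add: rweight_def)

context admissible
begin

text \<open>In the variable \<open>r = |z|^2 = |w|\<close> the factor pi of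
  \<open>integral_radial\<close> cancels the one in \<open>rweight\<close>, and the squared modulus
  of \<open>z ^ (2 * k)\<close> is \<open>r ^ (2 * k)\<close>.\<close>

lemma
  assumes k: "k \<in> degrees e m"
  shows integrable_rweight_even: "integrable lborel (\<lambda>z::complex. rweight e m (cmod z) * (cmod z) ^ (4 * k))"
    and integral_rweight_even: "(LINT z::complex|lborel. rweight e m (cmod z) * (cmod z) ^ (4 * k)) = 4 * moment k"
proof -
  define F where "F = (\<lambda>r. if 0 < r \<and> 0 < 1 + e * r\<^sup>2 then 4 / pi * r * (1 + e * r\<^sup>2) powr (- (real m / e) - 2) * r ^ (2 * k) else 0)"
  have [measurable]: "F \<in> borel_measurable borel" unfolding F_def by measurable
  have eq: "rweight e m (cmod z) * (cmod z) ^ (4 * k) = F ((cmod z)\<^sup>2)" for z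
  proof -
    have "(cmod z) ^ 4 = ((cmod z)\<^sup>2)\<^sup>2" "(cmod z) ^ (4 * k) = ((cmod z)\<^sup>2) ^ (2 * k)"
      by (simp_all flip: power_mult)
    then show ?thesis by (simp add: rweight_def F_def)
  qed
  have ind: "indicator {0..} r *\<^sub>R F r = 4 / pi * (indicator (einterval 0 (radius e)) r *\<^sub>R (r ^ (2 * k + 1) * (1 + e * r\<^sup>2) powr (- (real m / e) - 2)))" for r
    using less_radius_iff[OF e_nonzero, of r] by (auto simp: F_def einterval_iff split: split_indicator)
  have "set_integrable lborel {0..} F"
    using moment_integrable[OF k] unfolding set_integrable_def ind by simp
  then show "integrable lborel (\<lambda>z::complex. rweight e m (cmod z) * (cmod z) ^ (4 * k))"
    unfolding eq by (subst integrable_radial) auto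
  have "(LINT r:{0..}|lborel. F r) = 4 / pi * moment k"
    unfolding set_lebesgue_integral_def ind moment_def interval_lebesgue_integral_def
    using radius_pos[OF e_nonzero] by (simp add: less_imp_le set_lebesgue_integral_def)
  then show "(LINT z::complex|lborel. rweight e m (cmod z) * (cmod z) ^ (4 * k)) = 4 * moment k"
    unfolding eq by (subst integral_radial) auto
qed

definition exponents :: "nat set" where
  "exponents = {a. integrable lborel (\<lambda>z::complex. rweight e m (cmod z) * (cmod z) ^ (2 * a))}"

lemma even_exponent: "k \<in> degrees e m \<Longrightarrow> 2 * k \<in> exponents"
  using integrable_rweight_even[of k] by (simp add: exponents_def)

text \<open>The first monomial missed by the even ones. Since \<open>|z|^2 \<le> 1 + |z|^4\<close>,
  it is dominated by the monomials of degree 0 and 2, which are square integrable because 0 and 1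
  lie in \<open>degrees\<close> for \<open>0 < m\<close>.\<close>

lemma Suc_0_exponent: "Suc 0 \<in> exponents"
proof -
  have "0 \<in> degrees e m" "1 \<in> degrees e m" using m by (auto simp: degrees_def)
  then have "integrable lborel (\<lambda>z::complex. rweight e m (cmod z) * (cmod z) ^ (4 * 0) + rweight e m (cmod z) * (cmod z) ^ (4 * 1))"
    by (intro Bochner_Integration.integrable_add integrable_rweight_even)
  then show ?thesis
    unfolding exponents_def mem_Collect_eq
  proof (rule Bochner_Integration.integrable_bound)
    show "AE z in lborel. norm (rweight e m (cmod z) * (cmod z) ^ (2 * Suc 0))
        \<le> norm (rweight e m (cmod z) * (cmod z) ^ (4 * 0) + rweight e m (cmod z) * (cmod z) ^ (4 * 1))"
    proof (intro AE_I2)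
      fix z
      have "(cmod z)\<^sup>2 \<le> 1 + (cmod z) ^ 4"
      proof -
        have "0 \<le> ((cmod z)\<^sup>2 - 1)\<^sup>2" "0 \<le> (cmod z)\<^sup>2" by simp_all
        moreover have "((cmod z)\<^sup>2 - 1)\<^sup>2 = (cmod z) ^ 4 - 2 * (cmod z)\<^sup>2 + 1"
          by (simp add: power2_diff flip: power_mult)
        ultimately show ?thesis by linarith
      qed
      then have "rweight e m (cmod z) * (cmod z)\<^sup>2 \<le> rweight e m (cmod z) * (1 + (cmod z) ^ 4)"
        by (intro mult_left_mono rweight_nonneg)
      then show "norm (rweight e m (cmod z) * (cmod z) ^ (2 * Suc 0))
        \<le> norm (rweight e m (cmod z) * (cmod z) ^ (4 * 0) + rweight e m (cmod z) * (cmod z) ^ (4 * 1))"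
        using rweight_nonneg[of e m "cmod z"] by (simp add: distrib_left)
    qed
  qed measurable
qed

lemma integrable_rweight_monomials:
  assumes "a \<in> exponents" "b \<in> exponents"
  shows "integrable lborel (\<lambda>z. of_real (rweight e m (cmod z)) * z ^ a * cnj z ^ b)"
proof -
  have mc [measurable]: "cnj \<in> borel \<rightarrow>\<^sub>M borel"
    by (intro borel_measurable_continuous_onI continuous_intros)
  have "integrable lborel (\<lambda>z::complex. rweight e m (cmod z) * (cmod z) ^ (2 * a) + rweight e m (cmod z) * (cmod z) ^ (2 * b))"
    using assms by (intro Bochner_Integration.integrable_add) (auto simp: exponents_def)
  then show ?thesis
  proof (rule Bochner_Integration.integrable_bound)
    show "AE z in lborel. norm (of_real (rweight e m (cmod z)) * z ^ a * cnj z ^ b)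
        \<le> norm (rweight e m (cmod z) * (cmod z) ^ (2 * a) + rweight e m (cmod z) * (cmod z) ^ (2 * b))"
    proof (intro AE_I2)
      fix z
      define A B where "A = cmod z ^ a" and "B = cmod z ^ b"
      have AB: "0 \<le> A" "0 \<le> B" by (auto simp: A_def B_def)
      have "2 * (A * B) \<le> A\<^sup>2 + B\<^sup>2" using sum_squares_bound[of A B] by simp
      then have "A * B \<le> A\<^sup>2 + B\<^sup>2" using AB by (smt (verit) mult_nonneg_nonneg)
      then have "rweight e m (cmod z) * (A * B) \<le> rweight e m (cmod z) * (A\<^sup>2 + B\<^sup>2)"
        by (intro mult_left_mono rweight_nonneg)
      then show "norm (of_real (rweight e m (cmod z)) * z ^ a * cnj z ^ b)
        \<le> norm (rweight e m (cmod z) * (cmod z) ^ (2 * a) + rweight e m (cmod z) * (cmod z) ^ (2 * b))"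
        using rweight_nonneg[of e m "cmod z"]
        by (simp add: norm_mult norm_power A_def B_def algebra_simps power_mult[symmetric] power2_eq_square mult_2_right mult_2 power_add)
    qed
  qed measurable
qed

text \<open>Distinct powers are orthogonal by rotation; equal powers give
  \<open>4 * moment k\<close>, rewritten through \<open>expansion_coeff_moment\<close>. Odd
  exponents a are included for the sake of the section outside the span.\<close>

lemma integral_rweight_monomials:
  assumes "k \<in> degrees e m"
  shows "(LINT z|lborel. of_real (rweight e m (cmod z)) * z ^ a * cnj z ^ (2 * k))
     = (if a = 2 * k then of_real (4 * moment 0 / expansion_coeff e m k) else 0)"
proof (cases "a = 2 * k")
  case True
  have "of_real (rweight e m (cmod z)) * z ^ (2 * k) * cnj z ^ (2 * k) = complex_of_real (rweight e m (cmod z) * (cmod z) ^ (4 * k))" for z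
  proof -
    have "z ^ (2 * k) * cnj z ^ (2 * k) = (z * cnj z) ^ (2 * k)" by (simp add: power_mult_distrib)
    also have "\<dots> = of_real ((cmod z) ^ (4 * k))" 
      unfolding complex_norm_square[symmetric] by (simp flip: power_mult)
    finally show ?thesis by (simp add: mult.assoc)
  qed
  then have "(LINT z|lborel. of_real (rweight e m (cmod z)) * z ^ (2 * k) * cnj z ^ (2 * k))
      = complex_of_real (LINT z::complex|lborel. rweight e m (cmod z) * (cmod z) ^ (4 * k))"
    by (simp only: integral_complex_of_real)
  also have "\<dots> = of_real (4 * (moment 0 / expansion_coeff e m k))"
    using expansion_coeff_pos[OF assms] unfolding integral_rweight_even[OF assms] expansion_coeff_moment[OF assms, symmetric] by simp
  finally show ?thesis using True by simp
next
  case False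
  then show ?thesis using integral_radial_monomials[of "rweight e m" a "2 * k"] by simp
qed

end

section \<open>Smoothness and Wirtinger derivatives\<close>

lemma has_derivative_cong_open:
  assumes "open S" "z \<in> S" "\<And>x. x \<in> S \<Longrightarrow> f x = g x"
  shows "(f has_derivative D) (at z) \<longleftrightarrow> (g has_derivative D) (at z)"
  using assms by (metis has_derivative_transform_within_open)

lemma differentiable_cong_open:
  assumes "open S" "z \<in> S" "\<And>x. x \<in> S \<Longrightarrow> f x = g x"
  shows "f differentiable (at z) \<longleftrightarrow> g differentiable (at z)"
  using has_derivative_cong_open[OF assms] by (simp add: differentiable_def)

lemma frechet_derivative_cong_open:
  assumes "open S" "z \<in> S" "\<And>x. x \<in> S \<Longrightarrow> f x = g x"
  shows "frechet_derivative f (at z) = frechet_derivative g (at z)"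
  using has_derivative_cong_open[OF assms] by (simp add: frechet_derivative_def)

lemma Ck_on_cong:
  assumes "open S" "\<And>x. x \<in> S \<Longrightarrow> f x = g x"
  shows "Ck_on k f S \<longleftrightarrow> Ck_on k g S"
  using assms(2)
proof (induction k arbitrary: f g)
  case 0
  then show ?case by (simp cong: continuous_on_cong)
next
  case (Suc k)
  have "frechet_derivative f (at z) = frechet_derivative g (at z)" if "z \<in> S" for z
    by (rule frechet_derivative_cong_open[OF assms(1) that Suc.prems])
  then have "Ck_on k (\<lambda>z. frechet_derivative f (at z) v) S \<longleftrightarrow> Ck_on k (\<lambda>z. frechet_derivative g (at z) v) S" for v
    by (intro Suc.IH) simp
  moreover have "f differentiable (at z) \<longleftrightarrow> g differentiable (at z)" if "z \<in> S" for z
    by (rule differentiable_cong_open[OF assms(1) that Suc.prems])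
  ultimately show ?case by simp
qed

lemma smooth_on_cong:
  "open S \<Longrightarrow> (\<And>x. x \<in> S \<Longrightarrow> f x = g x) \<Longrightarrow> smooth_on f S \<longleftrightarrow> smooth_on g S"
  by (simp add: smooth_on_def Ck_on_cong[of S f g])

lemma Ck_on_Suc_imp: "Ck_on (Suc k) f S \<Longrightarrow> Ck_on k f S"
proof (induction k arbitrary: f)
  case 0
  then have "f differentiable_on S"
    by (auto intro: differentiable_at_imp_differentiable_on)
  then show ?case
    by (simp add: differentiable_imp_continuous_on)
next
  case (Suc k)
  then show ?case by (metis Ck_on.simps(2))
qed

lemma Ck_on_const: "Ck_on k (\<lambda>_. c) S"
  by (induction k arbitrary: c) (auto simp: frechet_derivative_const)

lemma Ck_on_SucI:
  assumes "open S" "\<And>z. z \<in> S \<Longrightarrow> (f has_derivative D z) (at z)" "\<And>v. Ck_on k (\<lambda>z. D z v) S"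
  shows "Ck_on (Suc k) f S"
proof -
  have "Ck_on k (\<lambda>z. frechet_derivative f (at z) v) S" for v
  proof -
    have "frechet_derivative f (at z) v = D z v" if "z \<in> S" for z
      using frechet_derivative_at[OF assms(2)[OF that]] by simp
    then show ?thesis
      using Ck_on_cong[OF assms(1), of "\<lambda>z. frechet_derivative f (at z) v" "\<lambda>z. D z v" k] assms(3)[of v] by blast
  qed
  then show ?thesis using assms by (auto simp: differentiable_def)
qed

lemma Ck_on_SucD:
  assumes "Ck_on (Suc k) f S" "z \<in> S"
  shows "(f has_derivative frechet_derivative f (at z)) (at z)"
  using assms by (simp flip: frechet_derivative_works)

lemma Ck_on_linear:
  assumes "bounded_linear f" "open S"
  shows "Ck_on k f S"
proof (cases k)
  case 0
  then show ?thesis using assms by (simp add: linear_continuous_on)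
next
  case (Suc j)
  then show ?thesis
    unfolding Suc using assms by (intro Ck_on_SucI[where D = "\<lambda>_. f"] Ck_on_const bounded_linear_imp_has_derivative)
qed

lemma Ck_on_compose_linear:
  assumes "bounded_linear L" "open S"
  shows "Ck_on k f S \<Longrightarrow> Ck_on k (\<lambda>z. L (f z)) S"
proof (induction k arbitrary: f)
  case 0
  then show ?case using assms by (simp add: bounded_linear.continuous_on)
next
  case (Suc k)
  show ?case
  proof (rule Ck_on_SucI[OF assms(2)])
    show "((\<lambda>z. L (f z)) has_derivative (\<lambda>v. L (frechet_derivative f (at z) v))) (at z)" if "z \<in> S" for z
      using bounded_linear.has_derivative[OF assms(1) Ck_on_SucD[OF Suc.prems that]] .
    show "Ck_on k (\<lambda>z. L (frechet_derivative f (at z) v)) S" for v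
      by (rule Suc.IH) (use Suc.prems in simp)
  qed
qed

lemma Ck_on_add:
  assumes "open S"
  shows "Ck_on k f S \<Longrightarrow> Ck_on k g S \<Longrightarrow> Ck_on k (\<lambda>z. f z + g z) S"
proof (induction k arbitrary: f g)
  case 0
  then show ?case by (simp add: continuous_on_add)
next
  case (Suc k)
  show ?case
  proof (rule Ck_on_SucI[OF assms])
    show "((\<lambda>z. f z + g z) has_derivative (\<lambda>v. frechet_derivative f (at z) v + frechet_derivative g (at z) v)) (at z)"
      if "z \<in> S" for z
      using has_derivative_add[OF Ck_on_SucD[OF Suc.prems(1) that] Ck_on_SucD[OF Suc.prems(2) that]] .
    show "Ck_on k (\<lambda>z. frechet_derivative f (at z) v + frechet_derivative g (at z) v) S" for v
      by (rule Suc.IH) (use Suc.prems in simp_all)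
  qed
qed

lemma Ck_on_mult:
  fixes f g :: "_ \<Rightarrow> real"
  assumes "open S"
  shows "Ck_on k f S \<Longrightarrow> Ck_on k g S \<Longrightarrow> Ck_on k (\<lambda>z. f z * g z) S"
proof (induction k arbitrary: f g)
  case 0
  then show ?case by (simp add: continuous_on_mult)
next
  case (Suc k)
  \<comment> \<open>The product rule keeps one factor undifferentiated, so f and g are also needed
    at the lower order k.\<close>
  have f: "Ck_on k f S" and g: "Ck_on k g S"
    using Suc.prems Ck_on_Suc_imp by blast+
  show ?case
  proof (rule Ck_on_SucI[OF assms])
    show "((\<lambda>z. f z * g z) has_derivative (\<lambda>v. f z * frechet_derivative g (at z) v + frechet_derivative f (at z) v * g z)) (at z)"
      if "z \<in> S" for z
      using has_derivative_mult[OF Ck_on_SucD[OF Suc.prems(1) that] Ck_on_SucD[OF Suc.prems(2) that]] .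
    show "Ck_on k (\<lambda>z. f z * frechet_derivative g (at z) v + frechet_derivative f (at z) v * g z) S" for v
    proof (rule Ck_on_add[OF assms])
      show "Ck_on k (\<lambda>z. f z * frechet_derivative g (at z) v) S"
        by (rule Suc.IH[OF f]) (use Suc.prems in simp)
      show "Ck_on k (\<lambda>z. frechet_derivative f (at z) v * g z) S"
        by (rule Suc.IH[OF _ g]) (use Suc.prems in simp)
    qed
  qed
qed

text \<open>The exponent is arbitrary in the induction, since differentiating lowers it by one.
  Negative exponents provide the reciprocals in the metric.\<close>

lemma Ck_on_powr:
  fixes f :: "_ \<Rightarrow> real"
  assumes "open S" "\<And>z. z \<in> S \<Longrightarrow> 0 < f z"
  shows "Ck_on k f S \<Longrightarrow> Ck_on k (\<lambda>z. f z powr a) S"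
proof (induction k arbitrary: a)
  case 0
  then show ?case using assms(2) by (auto intro!: continuous_intros) (metis less_irrefl)
next
  case (Suc k)
  have "((\<lambda>z. f z powr a) has_derivative (\<lambda>v. a * f z powr (a - 1) * frechet_derivative f (at z) v)) (at z)" if "z \<in> S" for z
  proof -
    have "DERIV (\<lambda>x. x powr a) (f z) :> a * f z powr (a - 1)"
      using assms(2)[OF that] by (auto intro!: derivative_eq_intros simp: powr_diff)
    then show ?thesis
      using has_derivative_compose[OF Ck_on_SucD[OF Suc.prems that], of "\<lambda>x. x powr a" "(*) (a * f z powr (a - 1))"]
      by (simp add: has_field_derivative_def)
  qed
  moreover have "Ck_on k (\<lambda>z. a * f z powr (a - 1) * frechet_derivative f (at z) v) S" for v
  proof (rule Ck_on_mult[OF assms(1)])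
    show "Ck_on k (\<lambda>z. a * f z powr (a - 1)) S"
      by (rule Ck_on_mult[OF assms(1) Ck_on_const Suc.IH[OF Ck_on_Suc_imp[OF Suc.prems]]])
  qed (use Suc.prems in simp)
  ultimately show ?case by (intro Ck_on_SucI[OF assms(1)])
qed

lemma smooth_on_const: "smooth_on (\<lambda>_. c) S"
  by (simp add: smooth_on_def Ck_on_const)

lemma smooth_on_prod:
  fixes f :: "'i \<Rightarrow> _ \<Rightarrow> real"
  assumes "open S" "\<And>i. i \<in> I \<Longrightarrow> smooth_on (f i) S"
  shows "smooth_on (\<lambda>z. \<Prod>i\<in>I. f i z) S"
  using assms(2)
proof (induction I rule: infinite_finite_induct)
  case (insert i I)
  then show ?case using assms(1) by (simp add: smooth_on_def Ck_on_mult)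
qed (auto simp: smooth_on_const)

section \<open>Wirtinger derivatives of coordinatewise radial functions\<close>

lemma wirt_cong:
  assumes "open S" "z \<in> S" "\<And>x. x \<in> S \<Longrightarrow> f x = g x"
  shows "wirt a f z = wirt a g z" "wirt_bar a f z = wirt_bar a g z"
  using frechet_derivative_cong_open[OF assms] by (simp_all add: wirt_def wirt_bar_def)

text \<open>A real-linear map of the plane has the form \<open>p * x + q * cnj x\<close>, and p and
  q are the two Wirtinger derivatives; all other coordinates drop out on
  \<open>axis a\<close>.\<close>

lemma wirt_coordinatewise:
  fixes z :: "complex^'n"
  assumes "\<And>b. (F b has_derivative (\<lambda>x. p b * x + q b * cnj x)) (at (z $ b))"
  shows "wirt a (\<lambda>z. \<Sum>b\<in>UNIV. F b (z $ b)) z = p a" "wirt_bar a (\<lambda>z. \<Sum>b\<in>UNIV. F b (z $ b)) z = q a"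
proof -
  have "((\<lambda>z. F b (z $ b)) has_derivative (\<lambda>v. p b * v $ b + q b * cnj (v $ b))) (at z)" for b
    using has_derivative_compose[OF bounded_linear_imp_has_derivative[OF bounded_linear_vec_nth, of b] assms[of b]] .
  then have "((\<lambda>z. \<Sum>b\<in>UNIV. F b (z $ b)) has_derivative (\<lambda>v. \<Sum>b\<in>UNIV. p b * v $ b + q b * cnj (v $ b))) (at z)"
    by (intro has_derivative_sum)
  then have *: "frechet_derivative (\<lambda>z. \<Sum>b\<in>UNIV. F b (z $ b)) (at z) = (\<lambda>v. \<Sum>b\<in>UNIV. p b * v $ b + q b * cnj (v $ b))"
    by (rule frechet_derivative_at[symmetric])
  have "(\<Sum>b\<in>UNIV. p b * axis a c $ b + q b * cnj (axis a c $ b)) = p a * c + q a * cnj c" for c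
  proof -
    have "(\<Sum>b\<in>UNIV. p b * axis a c $ b + q b * cnj (axis a c $ b)) = (\<Sum>b\<in>UNIV. if b = a then p b * c + q b * cnj c else 0)"
      by (intro sum.cong) (auto simp: axis_def)
    then show ?thesis by simp
  qed
  then show "wirt a (\<lambda>z. \<Sum>b\<in>UNIV. F b (z $ b)) z = p a" "wirt_bar a (\<lambda>z. \<Sum>b\<in>UNIV. F b (z $ b)) z = q a"
    by (simp_all add: wirt_def wirt_bar_def * algebra_simps)
qed

lemma wirt_coordinate:
  fixes z :: "complex^'n"
  assumes "(F has_derivative (\<lambda>x. p * x + q * cnj x)) (at (z $ b))"
  shows "wirt a (\<lambda>z. F (z $ b)) z = (if a = b then p else 0)"
proof -
  \<comment> \<open>The function of one coordinate is written as a sum whose other terms are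
    zero.\<close>
  have "wirt a (\<lambda>z. \<Sum>c\<in>UNIV. (if c = b then F else (\<lambda>_. 0)) (z $ c)) z = (if a = b then p else 0)"
    using assms by (subst wirt_coordinatewise[where p = "\<lambda>c. if c = b then p else 0" and q = "\<lambda>c. if c = b then q else 0"]) auto
  moreover have "(\<lambda>z. \<Sum>c\<in>UNIV. (if c = b then F else (\<lambda>_. 0)) (z $ c)) = (\<lambda>z. F (z $ b))"
    by (auto simp: fun_eq_iff if_distrib[of "\<lambda>f. f _"] cong: if_cong)
  ultimately show ?thesis by simp
qed

lemma has_derivative_cmod_square:
  "((\<lambda>x::complex. (cmod x)\<^sup>2) has_derivative (\<lambda>v. 2 * Re (cnj x * v))) (at x)"
  unfolding cmod_power2
  by (auto intro!: derivative_eq_intros simp: fun_eq_iff algebra_simps)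

lemma complex_2_Re: "complex_of_real (2 * Re w) = w + cnj w"
  by (simp add: complex_eq_iff)

lemma has_derivative_radial:
  assumes "DERIV \<phi> ((cmod x)\<^sup>2) :> d"
  shows "((\<lambda>x. complex_of_real (\<phi> ((cmod x)\<^sup>2))) has_derivative (\<lambda>v. (of_real d * cnj x) * v + (of_real d * x) * cnj v)) (at x)"
proof -
  have "((\<lambda>x. \<phi> ((cmod x)\<^sup>2)) has_derivative (\<lambda>v. d * (2 * Re (cnj x * v)))) (at x)"
    using has_derivative_compose[OF has_derivative_cmod_square, of \<phi> "(*) d" x] assms by (simp add: has_field_derivative_def)
  then have "((\<lambda>x. complex_of_real (\<phi> ((cmod x)\<^sup>2))) has_derivative (\<lambda>v. of_real (d * (2 * Re (cnj x * v))))) (at x)"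
    by (rule has_derivative_of_real)
  moreover have "complex_of_real (d * (2 * Re (cnj x * v))) = (of_real d * cnj x) * v + (of_real d * x) * cnj v" for v
    unfolding of_real_mult[of d] complex_2_Re by (simp add: algebra_simps)
  ultimately show ?thesis by simp
qed

lemma has_derivative_radial_times:
  assumes "DERIV \<psi> ((cmod x)\<^sup>2) :> d"
  shows "((\<lambda>x. complex_of_real (\<psi> ((cmod x)\<^sup>2)) * x) has_derivative
     (\<lambda>v. of_real ((cmod x)\<^sup>2 * d + \<psi> ((cmod x)\<^sup>2)) * v + (of_real d * x\<^sup>2) * cnj v)) (at x)"
proof -
  have *: "complex_of_real ((cmod x)\<^sup>2) = x * cnj x" by (rule complex_norm_square)
  show ?thesis
    using has_derivative_mult[OF has_derivative_radial[OF assms] has_derivative_ident]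
    by (rule has_derivative_eq_rhs)
      (simp add: fun_eq_iff * algebra_simps power2_eq_square[of x] del: of_real_power)
qed

text \<open>Differentiating twice, only the diagonal entries \<open>(s \<phi>'(s))'\<close> at \<open>s = |z\<^sub>a|\<^sup>2\<close> survive.\<close>

lemma wirt_wirt_bar_radial:
  fixes z :: "complex^'n"
  assumes S: "open S" "z \<in> S"
    and u: "\<And>x. x \<in> S \<Longrightarrow> u x = (\<Sum>b\<in>UNIV. complex_of_real (\<phi> b ((cmod (x $ b))\<^sup>2)))"
    and \<phi>: "\<And>x b. x \<in> S \<Longrightarrow> DERIV (\<phi> b) ((cmod (x $ b))\<^sup>2) :> \<psi> b ((cmod (x $ b))\<^sup>2)"
    and \<psi>: "DERIV (\<psi> b) ((cmod (z $ b))\<^sup>2) :> d"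
  shows "wirt a (wirt_bar b u) z = (if a = b then of_real ((cmod (z $ b))\<^sup>2 * d + \<psi> b ((cmod (z $ b))\<^sup>2)) else 0)"
proof -
  have "wirt_bar b u x = of_real (\<psi> b ((cmod (x $ b))\<^sup>2)) * x $ b" if "x \<in> S" for x
  proof -
    have "wirt_bar b u x = wirt_bar b (\<lambda>x. \<Sum>b\<in>UNIV. complex_of_real (\<phi> b ((cmod (x $ b))\<^sup>2))) x"
      using wirt_cong(2)[OF S(1) that u] by simp
    also have "\<dots> = of_real (\<psi> b ((cmod (x $ b))\<^sup>2)) * x $ b"
      using has_derivative_radial[OF \<phi>[OF that]] by (rule wirt_coordinatewise(2))
    finally show ?thesis .
  qed
  then have "wirt a (wirt_bar b u) z = wirt a (\<lambda>x. (\<lambda>y. of_real (\<psi> b ((cmod y)\<^sup>2)) * y) (x $ b)) z"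
    by (intro wirt_cong(1)[OF S]) auto
  also have "\<dots> = (if a = b then of_real ((cmod (z $ b))\<^sup>2 * d + \<psi> b ((cmod (z $ b))\<^sup>2)) else 0)"
    by (rule wirt_coordinate[OF has_derivative_radial_times[OF \<psi>]])
  finally show ?thesis .
qed

section \<open>The incomplete examples\<close>

text \<open>With \<open>w_i = z_i^2\<close> the inequality is \<open>1 + e i * |w_i|^2 > 0\<close>.
  The coordinates avoid 0 because the pulled-back metric degenerates there.\<close>

definition region :: "('n::finite \<Rightarrow> real) \<Rightarrow> (complex^'n) set" where
  "region e = {z. \<forall>i. z $ i \<noteq> 0 \<and> 0 < 1 + e i * ((cmod (z $ i))\<^sup>2)\<^sup>2}"

definition region_mfd :: "('n::finite \<Rightarrow> real) \<Rightarrow> (complex^'n, 'n) cmanifold" where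
  "region_mfd e = \<lparr>mtop = top_of_set (region e), atlas = {(region e, id)}\<rparr>"

text \<open>
  With \<open>s = |z\<^sub>a|\<^sup>2\<close> this is \<open>1 / pi\<close> times the complex Hessian of \<open>ln (1 + e * s\<^sup>2) / e\<close>.  The factor
  reconciles \<open>\<omega> = (\<i>/2) * (\<Sum>a b. g_ab * dz_a \<and> dzbar_b)\<close> with the \<open>\<i> / (2 * pi)\<close> in \<open>ric_form\<close>.
\<close>

definition gcoef :: "real \<Rightarrow> real \<Rightarrow> real" where
  "gcoef e s = 4 / pi * s / (1 + e * s\<^sup>2)\<^sup>2"

definition gmetric :: "('n::finite \<Rightarrow> real) \<Rightarrow> (complex^'n, 'n) hmetric" where
  "gmetric e c x = (\<chi> a b. if a = b then of_real (gcoef (e a) ((cmod (x $ a))\<^sup>2)) else 0)"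

text \<open>The trivial bundle. Covers are indexed by all natural numbers, so the same
  trivialization is repeated, a fibre vector over the region is a constant sequence, and
  \<open>herm\<close> can read it off at index 0.\<close>

definition lbundle :: "('n::finite \<Rightarrow> real) \<Rightarrow> (complex^'n) line_bundle" where
  "lbundle e = \<lparr>cover = \<lambda>_. region e, trans_fun = \<lambda>_ _ _. 1\<rparr>"

text \<open>The exponential of minus the sum of the potentials
  \<open>ln (1 + e i * |w_i|^2) / e i\<close>; thus \<open>- ln (weight e x)\<close> is a Kaehler
  potential up to normalization.\<close>

definition weight :: "('n::finite \<Rightarrow> real) \<Rightarrow> complex^'n \<Rightarrow> real" where
  "weight e x = (\<Prod>i\<in>UNIV. (1 + e i * ((cmod (x $ i))\<^sup>2)\<^sup>2) powr (- (1 / e i)))"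

definition herm :: "('n::finite \<Rightarrow> real) \<Rightarrow> complex^'n \<Rightarrow> (nat \<Rightarrow> complex) \<Rightarrow> (nat \<Rightarrow> complex) \<Rightarrow> complex" where
  "herm e x u v = u 0 * cnj (v 0) * of_real (weight e x)"

lemma region_mfd_simps [simp]: "mtop (region_mfd e) = top_of_set (region e)" "atlas (region_mfd e) = {(region e, id)}"
  "cover (lbundle e) = (\<lambda>_. region e)" "trans_fun (lbundle e) = (\<lambda>_ _ _. 1)"
  by (simp_all add: region_mfd_def lbundle_def)

lemma chart_inv_id [simp]: "z \<in> U \<Longrightarrow> chart_inv (U, id) z = z"
  unfolding chart_inv_def using inv_into_f_f[of id U z] by simp

lemma open_region: "open (region e)"
proof -
  have "region e = (\<Inter>i\<in>UNIV. {z. z $ i \<noteq> 0} \<inter> {z. 0 < 1 + e i * ((cmod (z $ i))\<^sup>2)\<^sup>2})"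
    by (auto simp: region_def)
  also have "open \<dots>"
    by (intro open_INT open_Int open_Collect_neq open_Collect_less continuous_intros ballI) auto
  finally show ?thesis .
qed

lemma region_nonempty: "region e \<noteq> {}"
proof -
  have "0 < 1 + a * ((1 / (1 + \<bar>a\<bar>))\<^sup>2)\<^sup>2" for a :: real
  proof -
    \<comment> \<open>Since \<open>t \<le> 1\<close> and \<open>|a| * t < 1\<close>, also
      \<open>|a| * t^4 < 1\<close>, whatever the sign of a.\<close>
    define t where "t = 1 / (1 + \<bar>a\<bar>)"
    have t: "0 < t" "t \<le> 1" "\<bar>a\<bar> * t < 1" by (auto simp: t_def divide_simps)
    have "(t\<^sup>2)\<^sup>2 = t ^ 4" by (simp flip: power_mult)
    also have "\<dots> \<le> t ^ 1" using t by (intro power_decreasing) auto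
    finally have "\<bar>a\<bar> * (t\<^sup>2)\<^sup>2 \<le> \<bar>a\<bar> * t" by (simp add: mult_left_mono)
    then have "\<bar>a * (t\<^sup>2)\<^sup>2\<bar> < 1" using t by (simp add: abs_mult)
    then show ?thesis by (simp add: t_def)
  qed
  moreover have "1 + \<bar>a\<bar> \<noteq> 0" for a :: real by linarith
  ultimately have "(\<chi> i. complex_of_real (1 / (1 + \<bar>e i\<bar>))) \<in> region e"
    unfolding region_def mem_Collect_eq vec_lambda_beta norm_of_real power2_abs
    by (metis divide_eq_0_iff of_real_eq_0_iff zero_neq_one)
  then show ?thesis by auto
qed

text \<open>The domain is the image of a convex set under the coordinatewise exponential map.\<close>

lemma connected_region: "connected (region e)"
proof -
  define C where "C = {z :: complex^'a. \<forall>i. 0 < 1 + e i * exp (4 * Re (z $ i))}"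
  \<comment> \<open>The condition is void for \<open>c \<ge> 0\<close>. For \<open>c < 0\<close> it
    bounds x from above because exp is increasing, so it passes from \<open>max x y\<close> to the
    convex combination below it.\<close>
  have one: "0 < 1 + c * exp (4 * (u * x) + 4 * (v * y))"
    if "0 < 1 + c * exp (4 * x)" "0 < 1 + c * exp (4 * y)" "0 \<le> u" "0 \<le> v" "u + v = 1" for c u v x y :: real
  proof (cases "c \<ge> 0")
    case True
    then show ?thesis by (simp add: add_pos_nonneg)
  next
    case False
    have "u * x + v * y \<le> u * max x y + v * max x y"
      using that by (intro add_mono mult_left_mono) auto
    also have "\<dots> = max x y" using that by (simp flip: distrib_right)
    finally have "exp (4 * (u * x + v * y)) \<le> exp (4 * max x y)" by simp
    then have "c * exp (4 * max x y) \<le> c * exp (4 * (u * x + v * y))" using False by simp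
    moreover have "0 < 1 + c * exp (4 * max x y)" using that by (simp add: max_def)
    ultimately show ?thesis unfolding distrib_left[symmetric] by linarith
  qed
  have "convex C"
    unfolding convex_def C_def by (auto simp: one)
  then have "connected ((\<lambda>z. \<chi> i. exp (z $ i)) ` C)"
    by (intro connected_continuous_image convex_connected continuous_intros)
  moreover have "(\<lambda>z. \<chi> i. exp (z $ i)) ` C = region e"
  proof (intro set_eqI iffI)
    have ex4: "exp x ^ 4 = exp (4 * x)" for x :: real
      by (simp flip: exp_of_nat_mult)
    then have ex: "((exp x)\<^sup>2)\<^sup>2 = exp (4 * x)" for x :: real
      by (simp flip: power_mult)
    {
      fix w assume "w \<in> (\<lambda>z. \<chi> i. exp (z $ i)) ` C"
      then show "w \<in> region e" by (auto simp: C_def region_def norm_exp_eq_Re ex4)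
    next
      fix w assume w: "w \<in> region e"
      define z where "z = (\<chi> i. Ln (w $ i))"
      have "(\<chi> i. exp (z $ i)) = w" using w by (simp add: z_def region_def vec_eq_iff)
      moreover have "exp (4 * Re (z $ i)) = ((cmod (w $ i))\<^sup>2)\<^sup>2" for i
        using w unfolding ex[symmetric] by (simp add: z_def region_def)
      then have "z \<in> C" using w by (simp add: C_def region_def)
      ultimately show "w \<in> (\<lambda>z. \<chi> i. exp (z $ i)) ` C" by (metis (no_types, lifting) imageI)
    }
  qed
  ultimately show ?thesis by simp
qed

lemma second_countable_euclidean: "second_countable (euclidean :: 'a::second_countable_topology topology)"
proof -
  obtain B :: "'a set set" where B: "countable B" "\<And>C. C \<in> B \<Longrightarrow> open C"
    "\<And>S. open S \<Longrightarrow> \<exists>U. U \<subseteq> B \<and> S = \<Union>U"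
    using univ_second_countable by blast
  have "\<exists>U\<in>B. x \<in> U \<and> U \<subseteq> V" if "open V" "x \<in> V" for V x
    using B(3)[OF that(1)] that(2) by blast
  then show ?thesis unfolding second_countable_def using B(1,2) by (intro exI[of _ B]) auto
qed

lemma holo_on_coord: "open U \<Longrightarrow> (\<And>z. z \<in> U \<Longrightarrow> f z = z $ a) \<Longrightarrow> holo_on f U"
proof -
  assume U: "open U" and f: "\<And>z. z \<in> U \<Longrightarrow> f z = z $ a"
  have "(f has_derivative (\<lambda>v. v $ a)) (at z)" if "z \<in> U" for z
    using has_derivative_cong_open[OF U that f] bounded_linear_imp_has_derivative[OF bounded_linear_vec_nth[of a]] by simp
  then show ?thesis unfolding holo_on_def by (intro ballI exI[of _ "\<lambda>v. v $ a"]) auto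
qed

lemma complex_manifold_mfd: "complex_manifold (region_mfd e)"
  unfolding complex_manifold_def
  using open_region[of e] region_nonempty[of e] connected_region[of e]
  by (auto simp: Hausdorff_space_subtopology second_countable_subtopology second_countable_euclidean
      connected_space_subtopology subtopology_subtopology openin_open_eq intro!: holo_on_coord)

text \<open>A compact open subset of Euclidean space is empty.\<close>

lemma not_compact_mfd: "\<not> compact_space (mtop (region_mfd e))"
  using compact_open[of "region e"] open_region[of e] region_nonempty[of e]
  by (auto simp: compact_space_subtopology compactin_euclidean_iff compact_space_def compactin_subtopology)


section \<open>Smoothness, positivity and closedness of the metric\<close>

lemma region_pos: "x \<in> region e \<Longrightarrow> 0 < 1 + e i * ((cmod (x $ i))\<^sup>2)\<^sup>2" "x \<in> region e \<Longrightarrow> 0 < (cmod (x $ i))\<^sup>2"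
  by (auto simp: region_def)

lemma gcoef_pos: "x \<in> region e \<Longrightarrow> 0 < gcoef (e i) ((cmod (x $ i))\<^sup>2)"
  using region_pos[of x e i] by (simp add: gcoef_def)

lemma smooth_on_of_real:
  assumes "open S" "smooth_on f S"
  shows "smooth_on (\<lambda>z. complex_of_real (f z)) S"
  using assms bounded_linear_of_real Ck_on_compose_linear unfolding smooth_on_def by blast

lemma smooth_cmod_square: "open S \<Longrightarrow> smooth_on (\<lambda>z::complex^'n. (cmod (z $ i))\<^sup>2) S"
proof -
  assume S: "open S"
  have "bounded_linear (\<lambda>z::complex^'n. Re (z $ i))" "bounded_linear (\<lambda>z::complex^'n. Im (z $ i))"
    using bounded_linear_compose[OF bounded_linear_Re bounded_linear_vec_nth]
      bounded_linear_compose[OF bounded_linear_Im bounded_linear_vec_nth] by auto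
  then show ?thesis
    unfolding cmod_power2 unfolding smooth_on_def power2_eq_square using S
    by (intro allI Ck_on_add Ck_on_mult Ck_on_linear)
qed

lemma smooth_on_mult:
  fixes f g :: "_ \<Rightarrow> real"
  shows "open S \<Longrightarrow> smooth_on f S \<Longrightarrow> smooth_on g S \<Longrightarrow> smooth_on (\<lambda>z. f z * g z) S"
  by (simp add: smooth_on_def Ck_on_mult)

lemma smooth_powr:
  "smooth_on (\<lambda>z::complex^'n. (1 + e i * ((cmod (z $ i))\<^sup>2)\<^sup>2) powr a) (region e)"
proof -
  have "smooth_on (\<lambda>z::complex^'n. e i * ((cmod (z $ i))\<^sup>2)\<^sup>2) (region e)"
    unfolding power2_eq_square[of "(cmod _)\<^sup>2"]
    by (intro smooth_on_mult smooth_cmod_square smooth_on_const open_region)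
  then show ?thesis
    unfolding smooth_on_def using region_pos(1)
    by (intro allI Ck_on_powr Ck_on_add Ck_on_const open_region) auto
qed

lemma smooth_gcoef: "smooth_on (\<lambda>z::complex^'n. gcoef (e i) ((cmod (z $ i))\<^sup>2)) (region e)"
proof -
  \<comment> \<open>The quotient is expressed by a real power with exponent -2, which brings it
    under \<open>smooth_powr\<close>.\<close>
  have "gcoef (e i) ((cmod (z $ i))\<^sup>2) = 4 / pi * (cmod (z $ i))\<^sup>2 * (1 + e i * ((cmod (z $ i))\<^sup>2)\<^sup>2) powr (-2)"
    if "z \<in> region e" for z :: "complex^'n"
    using region_pos(1)[OF that, of i] by (simp add: gcoef_def powr_minus divide_inverse)
  moreover have "smooth_on (\<lambda>z::complex^'n. 4 / pi * (cmod (z $ i))\<^sup>2 * (1 + e i * ((cmod (z $ i))\<^sup>2)\<^sup>2) powr (-2)) (region e)"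
    by (intro smooth_on_mult smooth_cmod_square smooth_on_const smooth_powr open_region)
  ultimately show ?thesis
    using smooth_on_cong[OF open_region] by (metis (no_types, lifting))
qed

lemma smooth_weight: "smooth_on (weight e) (region e)"
  unfolding weight_def[abs_def] by (intro smooth_on_prod open_region smooth_powr)

lemma weight_pos: "x \<in> region e \<Longrightarrow> 0 < weight e x"
  unfolding weight_def using region_pos(1)[of x e] by (intro prod_pos ballI) (simp only: powr_gt_zero, metis less_irrefl)

lemma hform_gmetric:
  "hform (gmetric e c x) v w = (\<Sum>a\<in>UNIV. of_real (gcoef (e a) ((cmod (x $ a))\<^sup>2)) * (v $ a * cnj (w $ a)))"
proof -
  have "(\<Sum>b\<in>UNIV. gmetric e c x $ a $ b * v $ a * cnj (w $ b))
      = (\<Sum>b\<in>UNIV. if b = a then of_real (gcoef (e a) ((cmod (x $ a))\<^sup>2)) * v $ a * cnj (w $ b) else 0)" for a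
    by (intro sum.cong) (auto simp: gmetric_def)
  then show ?thesis by (simp add: hform_def mult.assoc)
qed

lemma Im_of_real_mult: "Im (complex_of_real r * w) = r * Im w"
  by simp

lemma frechet_derivative_id_region:
  "x \<in> region e \<Longrightarrow> frechet_derivative (\<lambda>z. id (chart_inv (region e, id) z)) (at x) = (\<lambda>v. v)"
proof -
  assume x: "x \<in> region e"
  have "((\<lambda>z. id (chart_inv (region e, id) z)) has_derivative (\<lambda>v. v)) (at x)"
    by (subst has_derivative_cong_open[OF open_region x, of _ "\<lambda>z. z"]) auto
  then show ?thesis by (rule frechet_derivative_at[symmetric])
qed

lemma hermitian_gmetric: "hermitian_tangent_metric (region_mfd e) (gmetric e)"
  unfolding hermitian_tangent_metric_def
proof (intro conjI ballI allI impI, unfold region_mfd_simps singleton_iff)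
  fix c :: "(complex^'a) set \<times> (complex^'a \<Rightarrow> complex^'a)" and a b assume c: "c = (region e, id)"
  have "smooth_on (\<lambda>z. gmetric e c z $ a $ b) (region e)"
  proof (cases "a = b")
    case True
    then show ?thesis by (simp add: gmetric_def smooth_on_of_real open_region smooth_gcoef)
  next
    case False
    then show ?thesis by (simp add: gmetric_def smooth_on_const)
  qed
  then show "smooth_on (\<lambda>z. gmetric e c (chart_inv c z) $ a $ b) (snd c ` fst c)"
    unfolding c using smooth_on_cong[OF open_region, of e "\<lambda>z. gmetric e (region e, id) (chart_inv (region e, id) z) $ a $ b" "\<lambda>z. gmetric e (region e, id) z $ a $ b"] by simp
next
  fix c :: "(complex^'a) set \<times> (complex^'a \<Rightarrow> complex^'a)" and x a b
  show "gmetric e c x $ b $ a = cnj (gmetric e c x $ a $ b)" by (simp add: gmetric_def)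
next
  fix c :: "(complex^'a) set \<times> (complex^'a \<Rightarrow> complex^'a)" and x v :: "complex^'a"
  assume c: "c = (region e, id)" and "x \<in> fst c" and v: "v \<noteq> 0"
  then have x: "x \<in> region e" by simp
  have "Re (hform (gmetric e c x) v v) = (\<Sum>a\<in>UNIV. gcoef (e a) ((cmod (x $ a))\<^sup>2) * (cmod (v $ a))\<^sup>2)"
    unfolding hform_gmetric complex_norm_square[symmetric] by simp
  moreover obtain a where "v $ a \<noteq> 0" using v by (auto simp: vec_eq_iff)
  ultimately show "0 < Re (hform (gmetric e c x) v v)"
    using gcoef_pos[OF x] by (auto intro!: sum_pos2[of _ a] mult_nonneg_nonneg simp: less_imp_le)
next
  fix c d :: "(complex^'a) set \<times> (complex^'a \<Rightarrow> complex^'a)" and x v w :: "complex^'a"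
  assume c: "c = (region e, id)" and d: "d = (region e, id)" and "x \<in> fst c \<inter> fst d"
  then have x: "x \<in> region e" by simp
  show "let T = frechet_derivative (\<lambda>z. snd d (chart_inv c z)) (at (snd c x))
        in hform (gmetric e c x) v w = hform (gmetric e d x) (T v) (T w)"
    unfolding c d using frechet_derivative_id_region[OF x] by simp
qed

text \<open>Each diagonal entry depends on its own coordinate only, so the form is a sum of
  two-forms pulled back from coordinate planes. Their exterior derivatives come from three-forms on
  a real plane and vanish; this is the identity \<open>cyclic\<close>.\<close>

lemma kahler_gmetric: "kahler_metric (region_mfd e) (gmetric e)"
  unfolding kahler_metric_def
proof (intro conjI hermitian_gmetric ballI allI, unfold region_mfd_simps singleton_iff)
  fix c :: "(complex^'a) set \<times> (complex^'a \<Rightarrow> complex^'a)" and z u v w :: "complex^'a"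
  assume c: "c = (region e, id)" and "z \<in> snd c ` fst c"
  then have z: "z \<in> region e" by simp
  define \<omega> where "\<omega> = (\<lambda>v w y. kahler_form (gmetric e) c (chart_inv c y) v w)"
  have "\<exists>d. DERIV (gcoef (e a)) ((cmod (z $ a))\<^sup>2) :> d" for a
    using region_pos(1)[OF z, of a] unfolding gcoef_def
    by (intro exI) (auto intro!: derivative_eq_intros)
  then obtain d where d: "\<And>a. DERIV (gcoef (e a)) ((cmod (z $ a))\<^sup>2) :> d a" by metis
  have D: "frechet_derivative (\<omega> v w) (at z) u
      = (\<Sum>a\<in>UNIV. (d a * (2 * Re (cnj (z $ a) * u $ a))) * (- Im (v $ a * cnj (w $ a))))" for u v w
  proof -
    have "\<omega> v w y = (\<Sum>a\<in>UNIV. gcoef (e a) ((cmod (y $ a))\<^sup>2) * (- Im (v $ a * cnj (w $ a))))" if "y \<in> region e" for y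
      using that unfolding \<omega>_def kahler_form_def hform_gmetric c by (simp only: chart_inv_id Im_sum Im_of_real_mult sum_negf[symmetric] mult_minus_right)
    moreover have "((\<lambda>y. \<Sum>a\<in>UNIV. gcoef (e a) ((cmod (y $ a))\<^sup>2) * (- Im (v $ a * cnj (w $ a)))) has_derivative
        (\<lambda>u. \<Sum>a\<in>UNIV. (d a * (2 * Re (cnj (z $ a) * u $ a))) * (- Im (v $ a * cnj (w $ a))))) (at z)"
    proof (intro has_derivative_sum has_derivative_mult_left)
      fix a
      have "((\<lambda>y::complex^'a. (cmod (y $ a))\<^sup>2) has_derivative (\<lambda>u. 2 * Re (cnj (z $ a) * u $ a))) (at z)"
        using has_derivative_compose[OF bounded_linear_imp_has_derivative[OF bounded_linear_vec_nth, of a] has_derivative_cmod_square] .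
      from has_derivative_compose[OF this, of "gcoef (e a)" "(*) (d a)"] d[of a]
      show "((\<lambda>y. gcoef (e a) ((cmod (y $ a))\<^sup>2)) has_derivative (\<lambda>u. d a * (2 * Re (cnj (z $ a) * u $ a)))) (at z)"
        by (simp add: has_field_derivative_def)
    qed
    ultimately have "(\<omega> v w has_derivative (\<lambda>u. \<Sum>a\<in>UNIV. (d a * (2 * Re (cnj (z $ a) * u $ a))) * (- Im (v $ a * cnj (w $ a))))) (at z)"
      using has_derivative_cong_open[OF open_region z, of "\<omega> v w"] by (metis (no_types, lifting))
    then have "frechet_derivative (\<omega> v w) (at z) = (\<lambda>u. \<Sum>a\<in>UNIV. (d a * (2 * Re (cnj (z $ a) * u $ a))) * (- Im (v $ a * cnj (w $ a))))"
      by (rule frechet_derivative_at[symmetric])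
    then show ?thesis by (simp only:)
  qed
  have cyclic: "c * (2 * Re (p * u)) * - Im (v * cnj w) - c * (2 * Re (p * v)) * - Im (u * cnj w)
      + c * (2 * Re (p * w)) * - Im (u * cnj v) = 0" for c :: real and p u v w :: complex
    by (simp add: algebra_simps)
  have "frechet_derivative (\<omega> v w) (at z) u - frechet_derivative (\<omega> u w) (at z) v
         + frechet_derivative (\<omega> u v) (at z) w = 0"
    unfolding D sum_subtractf[symmetric] sum.distrib[symmetric]
    by (intro sum.neutral ballI cyclic)
  then show "let \<omega> = (\<lambda>v w y. kahler_form (gmetric e) c (chart_inv c y) v w) in
           frechet_derivative (\<omega> v w) (at z) u
         - frechet_derivative (\<omega> u w) (at z) v
         + frechet_derivative (\<omega> u v) (at z) w = 0"
    by (simp only: Let_def \<omega>_def)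
qed

section \<open>Ricci tensor and scalar curvature\<close>

lemma det_gmetric: "det (gmetric e c x) = of_real (\<Prod>a\<in>UNIV. gcoef (e a) ((cmod (x $ a))\<^sup>2))"
  by (subst det_diagonal) (auto simp: gmetric_def)

lemma matrix_inv_unique:
  fixes A B :: "'a::semiring_1^'n^'n"
  assumes "A ** B = mat 1" "B ** A = mat 1"
  shows "matrix_inv A = B"
proof -
  have "A ** matrix_inv A = mat 1"
    unfolding matrix_inv_def using assms by (metis (mono_tags, lifting) someI_ex)
  then show ?thesis
    using assms(2) by (metis matrix_mul_assoc matrix_mul_lid matrix_mul_rid)
qed

lemma matrix_inv_gmetric:
  assumes "x \<in> region e"
  shows "matrix_inv (gmetric e c x) = (\<chi> a b. if a = b then of_real (1 / gcoef (e a) ((cmod (x $ a))\<^sup>2)) else 0)"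
proof -
  have nz: "gcoef (e a) ((cmod (x $ a))\<^sup>2) \<noteq> 0" for a using gcoef_pos[OF assms, of a] by simp
  have *: "(\<chi> a b. if a = b then f a else 0) ** (\<chi> a b. if a = b then g a else 0) = (mat 1 :: complex^'a^'a)"
    if "\<And>a. f a * g a = 1" for f g :: "'a \<Rightarrow> complex"
  proof -
    have "(\<Sum>k\<in>UNIV. (if a = k then f a else 0) * (if k = b then g k else 0)) = (if a = b then 1 else 0)" for a b
    proof -
      have "(\<Sum>k\<in>UNIV. (if a = k then f a else 0) * (if k = b then g k else 0))
          = (\<Sum>k\<in>UNIV. if k = a then f a * (if k = b then g k else 0) else 0)"
        by (intro sum.cong) auto
      then show ?thesis using that by simp
    qed
    then show ?thesis by (simp add: matrix_matrix_mult_def mat_def vec_eq_iff)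
  qed
  show ?thesis
    unfolding gmetric_def using nz by (intro matrix_inv_unique *) (simp_all flip: of_real_mult)
qed

text \<open>The differentiated function is itself the derivative of \<open>ln (gcoef c s)\<close> in
  s.\<close>

lemma DERIV_ricci_potential:
  fixes t c :: real
  assumes "0 < t" "0 < 1 + c * t\<^sup>2"
  shows "DERIV (\<lambda>s. 1 / s - 4 * c * s / (1 + c * s\<^sup>2)) t
    :> - 1 / t\<^sup>2 - (4 * c * (1 + c * t\<^sup>2) - 4 * c * t * (2 * c * t)) / (1 + c * t\<^sup>2)\<^sup>2"
proof -
  have 1: "DERIV (\<lambda>s. 1 / s) t :> - 1 / t\<^sup>2"
    using assms by (auto intro!: derivative_eq_intros simp: power2_eq_square)
  have 2: "DERIV (\<lambda>s. 4 * c * s) t :> 4 * c"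
    by (auto intro!: derivative_eq_intros)
  have 3: "DERIV (\<lambda>s. 1 + c * s\<^sup>2) t :> 2 * c * t"
    by (auto intro!: derivative_eq_intros)
  have "DERIV (\<lambda>s. 4 * c * s / (1 + c * s\<^sup>2)) t :> (4 * c * (1 + c * t\<^sup>2) - 4 * c * t * (2 * c * t)) / (1 + c * t\<^sup>2)\<^sup>2"
    using DERIV_divide[OF 2 3] assms(2) unfolding power2_eq_square[of "1 + _"] by simp
  from DERIV_diff[OF 1 this] show ?thesis .
qed

text \<open>In \<open>ln (gcoef (e a) s)\<close> the term \<open>ln s\<close> is pluriharmonic, and
  the rest is up to a constant \<open>- 2 * e a\<close> times the potential whose Hessian is
  \<open>pi * gcoef\<close>. So every coordinate factor is Einstein with its own constant
  \<open>2 * pi * e a\<close>.\<close>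

lemma ricci_gmetric:
  assumes x: "x \<in> region e"
  shows "ricci (gmetric e) (region e, id) x $ a $ b
    = (if a = b then of_real (2 * pi * e a * gcoef (e a) ((cmod (x $ a))\<^sup>2)) else 0)"
proof -
  define s where "s = (\<lambda>b x. (cmod ((x::complex^'a) $ b))\<^sup>2)"
  define \<psi> where "\<psi> = (\<lambda>b s. 1 / s - 4 * e b * s / (1 + e b * s\<^sup>2))"
  define d where "d = - 1 / (s b x)\<^sup>2 - (4 * e b * (1 + e b * (s b x)\<^sup>2) - 4 * e b * s b x * (2 * e b * s b x)) / (1 + e b * (s b x)\<^sup>2)\<^sup>2"
  have pos: "0 < s b y" "0 < 1 + e b * (s b y)\<^sup>2" if "y \<in> region e" for b y
    using region_pos[OF that] by (auto simp: s_def)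
  have "wirt a (wirt_bar b (\<lambda>z. of_real (ln (Re (det (gmetric e (region e, id) (chart_inv (region e, id) z))))))) x
      = (if a = b then of_real ((cmod (x $ b))\<^sup>2 * d + \<psi> b ((cmod (x $ b))\<^sup>2)) else 0)"
  proof (rule wirt_wirt_bar_radial[OF open_region x, where \<phi> = "\<lambda>b s. ln (gcoef (e b) s)"])
    fix y assume y: "y \<in> region e"
    have "ln (\<Prod>a\<in>UNIV. gcoef (e a) ((cmod (y $ a))\<^sup>2)) = (\<Sum>a\<in>UNIV. ln (gcoef (e a) ((cmod (y $ a))\<^sup>2)))"
      using gcoef_pos[OF y] by (intro ln_prod) (auto simp: less_imp_neq[symmetric])
    then show "complex_of_real (ln (Re (det (gmetric e (region e, id) (chart_inv (region e, id) y))))) =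
         (\<Sum>b\<in>UNIV. of_real (ln (gcoef (e b) ((cmod (y $ b))\<^sup>2))))"
      unfolding chart_inv_id[OF y] det_gmetric Re_complex_of_real by simp
    fix b
    define t where "t = (cmod (y $ b))\<^sup>2"
    have t: "0 < t" "0 < 1 + e b * t\<^sup>2" using pos[OF y, of b] by (auto simp: t_def s_def)
    have "DERIV (\<lambda>s. ln (4 / pi) + ln s - 2 * ln (1 + e b * s\<^sup>2)) t :> \<psi> b t"
      using t by (auto intro!: derivative_eq_intros simp: \<psi>_def)
    moreover have "\<forall>\<^sub>F s in nhds t. s \<in> {s. 0 < s \<and> 0 < 1 + e b * s\<^sup>2}"
      using t by (intro eventually_nhds_in_open open_Collect_conj open_Collect_less continuous_intros) auto
    then have ev: "\<forall>\<^sub>F s in nhds t. ln (gcoef (e b) s) = ln (4 / pi) + ln s - 2 * ln (1 + e b * s\<^sup>2)"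
      by eventually_elim (simp add: gcoef_def ln_div ln_mult ln_realpow)
    ultimately have "DERIV (\<lambda>s. ln (gcoef (e b) s)) t :> \<psi> b t"
      using DERIV_cong_ev[OF refl ev refl] by simp
    then show "DERIV (\<lambda>s. ln (gcoef (e b) s)) ((cmod (y $ b))\<^sup>2) :> \<psi> b ((cmod (y $ b))\<^sup>2)"
      by (simp add: t_def)
  next
    show "DERIV (\<psi> b) ((cmod (x $ b))\<^sup>2) :> d"
      using pos[OF x, of b] unfolding \<psi>_def d_def s_def by (intro DERIV_ricci_potential)
  qed
  moreover have "(cmod (x $ b))\<^sup>2 * d + \<psi> b ((cmod (x $ b))\<^sup>2) = - (2 * pi * e b * gcoef (e b) ((cmod (x $ b))\<^sup>2))"
  proof -
    define t X where "t = s b x" and "X = 1 + e b * t\<^sup>2"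
    have t: "0 < t" "0 < X" using pos[OF x, of b] by (auto simp: t_def X_def)
    have aux: "t * (- 1 / t\<^sup>2 - Y / X\<^sup>2) + (1 / t - W / X) = (- (t * Y) - W * X) / X\<^sup>2" for Y W
      using t by (simp add: field_simps power2_eq_square)
    \<comment> \<open>Once \<open>e b * t^2\<close> is expressed through \<open>X\<close>, the terms
      linear in \<open>X\<close> cancel in the numerator.\<close>
    have et: "e b * t\<^sup>2 = X - 1" by (simp add: X_def)
    have "t * (- 1 / t\<^sup>2 - (4 * e b * X - 4 * e b * t * (2 * e b * t)) / X\<^sup>2) + (1 / t - 4 * e b * t / X)
        = (- (4 * e b * t * X) + 8 * e b * t * (e b * t\<^sup>2) - 4 * e b * t * X) / X\<^sup>2"
      unfolding aux by (rule arg_cong[where f = "\<lambda>y. y / _"]) (simp add: algebra_simps power2_eq_square)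
    also have "\<dots> = - (8 * e b * t / X\<^sup>2)"
      unfolding et by (simp add: algebra_simps)
    also have "\<dots> = - (2 * pi * e b * (4 / pi * t / X\<^sup>2))"
      using t by (simp add: field_simps)
    finally show ?thesis
      unfolding \<psi>_def d_def gcoef_def t_def X_def s_def .
  qed
  ultimately show ?thesis by (simp add: ricci_def)
qed

lemma scalar_curvature_gmetric:
  assumes x: "x \<in> region e"
  shows "scalar_curvature (gmetric e) (region e, id) x = of_real (8 * pi * (\<Sum>a\<in>UNIV. e a))"
proof -
  have "(\<Sum>b\<in>UNIV. matrix_inv (gmetric e (region e, id) x) $ b $ a * ricci (gmetric e) (region e, id) x $ a $ b) = of_real (2 * pi * e a)" for a
  proof -
    have "(\<Sum>b\<in>UNIV. matrix_inv (gmetric e (region e, id) x) $ b $ a * ricci (gmetric e) (region e, id) x $ a $ b)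
        = (\<Sum>b\<in>UNIV. if b = a then of_real (2 * pi * e a) else 0)"
      unfolding matrix_inv_gmetric[OF x] ricci_gmetric[OF x] using gcoef_pos[OF x, of a]
      by (intro sum.cong) auto
    then show ?thesis by simp
  qed
  then show ?thesis by (simp add: scalar_curvature_def sum_distrib_left mult.assoc)
qed

lemma constant_scalar_curvature: "has_constant_scalar_curvature (region_mfd e) (gmetric e) (8 * pi * (\<Sum>a\<in>UNIV. e a))"
  by (simp add: has_constant_scalar_curvature_def scalar_curvature_gmetric del: of_real_mult of_real_sum)

section \<open>The trivial bundle and its Hermitian metric\<close>

lemma tensor_power_lbundle [simp]: "tensor_power (lbundle e) m = lbundle e"
  by (simp add: tensor_power_def lbundle_def)

lemma frame_lbundle [simp]: "frame (lbundle e) i x = (\<lambda>j. if x \<in> region e then 1 else 0)"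
  by (simp add: frame_def)

lemma fibre_lbundle: "v \<in> fibre (lbundle e) x \<longleftrightarrow> (if x \<in> region e then \<forall>i. v i = v 0 else \<forall>i. v i = 0)"
proof -
  have "(\<forall>i j. v i = v j) \<longleftrightarrow> (\<forall>i. v i = v 0)" by metis
  then show ?thesis by (simp add: fibre_def)
qed

lemma holo_on_cong:
  assumes "open U" "\<And>z. z \<in> U \<Longrightarrow> f z = g z"
  shows "holo_on f U \<longleftrightarrow> holo_on g U"
proof -
  have "(f has_derivative D) (at z) \<longleftrightarrow> (g has_derivative D) (at z)" if "z \<in> U" for z D
    by (rule has_derivative_cong_open[OF assms(1) that assms(2)])
  then show ?thesis unfolding holo_on_def by simp
qed

lemma mholo_on_mfd: "mholo_on (region_mfd e) f (region e) \<longleftrightarrow> holo_on f (region e)"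
  unfolding mholo_on_def using holo_on_cong[OF open_region, of e "\<lambda>z. f (chart_inv (region e, id) z)" f] by simp

lemma msmooth_on_mfd: "msmooth_on (region_mfd e) f (region e) \<longleftrightarrow> smooth_on f (region e)"
  unfolding msmooth_on_def using smooth_on_cong[OF open_region, of e "\<lambda>z. f (chart_inv (region e, id) z)" f] by simp

lemma holo_on_const: "holo_on (\<lambda>_. c) U"
  unfolding holo_on_def by (intro ballI exI[of _ "\<lambda>_. 0"]) auto

lemma holomorphic_lbundle: "holomorphic_line_bundle (region_mfd e) (lbundle e)"
  by (simp add: holomorphic_line_bundle_def mholo_on_mfd holo_on_const)

lemma hermitian_herm: "hermitian_metric (region_mfd e) (lbundle e) (herm e)"
  unfolding hermitian_metric_def
proof (intro conjI ballI allI impI)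
  fix x u v w a b
  assume x: "x \<in> pts (region_mfd e)" and "v \<in> fibre (lbundle e) x"
  then have v: "\<forall>i. v i = v 0" by (simp add: fibre_lbundle)
  show "herm e x (\<lambda>i. a * u i + b * v i) w = a * herm e x u w + b * herm e x v w"
    by (simp add: herm_def algebra_simps)
  show "herm e x w v = cnj (herm e x v w)"
    by (simp add: herm_def)
  assume "v \<noteq> (\<lambda>_. 0)"
  then have "v 0 \<noteq> 0" using v by (metis ext)
  then show "0 < Re (herm e x v v)"
    using x weight_pos[of x e] unfolding herm_def complex_norm_square[symmetric] by simp
next
  fix i
  have "smooth_on (\<lambda>x. complex_of_real (weight e x)) (region e)"
    by (intro smooth_on_of_real open_region smooth_weight)
  then have "smooth_on (\<lambda>x. herm e x (frame (lbundle e) i x) (frame (lbundle e) i x)) (region e)"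
    by (subst smooth_on_cong[OF open_region, of _ _ "\<lambda>x. complex_of_real (weight e x)"]) (auto simp: herm_def)
  then show "msmooth_on (region_mfd e) (\<lambda>x. herm e x (frame (lbundle e) i x) (frame (lbundle e) i x)) (cover (lbundle e) i)"
    by (simp only: msmooth_on_mfd region_mfd_simps)
qed

lemma DERIV_potential:
  fixes t c :: real
  assumes "c \<noteq> 0" "0 < 1 + c * t\<^sup>2"
  shows "DERIV (\<lambda>s. - (1 / c) * ln (1 + c * s\<^sup>2)) t :> - 2 * t / (1 + c * t\<^sup>2)"
    and "DERIV (\<lambda>s. - 2 * s / (1 + c * s\<^sup>2)) t :> (- 2 * (1 + c * t\<^sup>2) - - 2 * t * (2 * c * t)) / (1 + c * t\<^sup>2)\<^sup>2"
proof -
  have 2: "DERIV (\<lambda>s. - 2 * s) t :> - 2"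
    by (auto intro!: derivative_eq_intros)
  have 3: "DERIV (\<lambda>s. 1 + c * s\<^sup>2) t :> 2 * c * t"
    by (auto intro!: derivative_eq_intros)
  show "DERIV (\<lambda>s. - 2 * s / (1 + c * s\<^sup>2)) t :> (- 2 * (1 + c * t\<^sup>2) - - 2 * t * (2 * c * t)) / (1 + c * t\<^sup>2)\<^sup>2"
    using DERIV_divide[OF 2 3] assms(2) unfolding power2_eq_square[of "1 + _"] by simp
  have "DERIV (\<lambda>s. ln (1 + c * s\<^sup>2)) t :> inverse (1 + c * t\<^sup>2) * (2 * c * t)"
    by (rule DERIV_chain2[OF DERIV_ln[OF assms(2)] 3])
  then have "DERIV (\<lambda>s. - (1 / c) * ln (1 + c * s\<^sup>2)) t :> - (1 / c) * (inverse (1 + c * t\<^sup>2) * (2 * c * t))"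
    by (rule DERIV_cmult)
  moreover have "- (1 / c) * (inverse X * (2 * c * t)) = - 2 * t / X" for X
    using assms(1) by (simp add: divide_inverse)
  ultimately show "DERIV (\<lambda>s. - (1 / c) * ln (1 + c * s\<^sup>2)) t :> - 2 * t / (1 + c * t\<^sup>2)"
    by (simp only:)
qed

lemma ln_weight:
  assumes "x \<in> region e"
  shows "ln (weight e x) = (\<Sum>b\<in>UNIV. - (1 / e b) * ln (1 + e b * ((cmod (x $ b))\<^sup>2)\<^sup>2))"
proof -
  have nz: "1 + e b * ((cmod (x $ b))\<^sup>2)\<^sup>2 \<noteq> 0" for b using region_pos(1)[OF assms, of b] by linarith
  have "ln (weight e x) = (\<Sum>b\<in>UNIV. ln ((1 + e b * ((cmod (x $ b))\<^sup>2)\<^sup>2) powr (- (1 / e b))))"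
    unfolding weight_def using nz by (intro ln_prod) (auto simp only: finite powr_eq_0_iff)
  then show ?thesis by (simp only: ln_powr)
qed

text \<open>The complex Hessian of \<open>ln (weight e x)\<close> is diagonal with entries
  \<open>- pi * gcoef\<close>, and \<open>v_a * cnj w_a - w_a * cnj v_a\<close> is
  \<open>2 * \<i>\<close> times an imaginary part. The prefactor \<open>- \<i> / (2 * pi)\<close>
  leaves \<open>- gcoef\<close> times that imaginary part, as in \<open>kahler_form\<close>.\<close>

lemma ric_eq_herm:
  assumes e: "\<And>i. e i \<noteq> 0"
  shows "ric_eq_kahler_form (region_mfd e) (gmetric e) (lbundle e) (herm e)"
proof -
  have "ric_form (lbundle e) (herm e) i (region e, id) x v w = of_real (kahler_form (gmetric e) (region e, id) x v w)"
    if x: "x \<in> region e" for i x v w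
  proof -
    define u where "u = (\<lambda>z. complex_of_real (ln (Re (herm e (chart_inv (region e, id) z)
                (frame (lbundle e) i (chart_inv (region e, id) z)) (frame (lbundle e) i (chart_inv (region e, id) z))))))"
    have u: "u y = (\<Sum>b\<in>UNIV. of_real (- (1 / e b) * ln (1 + e b * ((cmod (y $ b))\<^sup>2)\<^sup>2)))" if y: "y \<in> region e" for y
    proof -
      have "u y = of_real (ln (weight e y))"
        using y by (simp add: u_def herm_def)
      then show ?thesis unfolding ln_weight[OF y] of_real_sum .
    qed
    have dd: "wirt a (wirt_bar b u) x = (if a = b then of_real (- pi * gcoef (e b) ((cmod (x $ b))\<^sup>2)) else 0)" for a b
    proof -
      define t X where "t = (cmod (x $ b))\<^sup>2" and "X = 1 + e b * t\<^sup>2"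
      have X: "X > 0" using region_pos(1)[OF x] by (simp add: X_def t_def)
      have et: "e b * t\<^sup>2 = X - 1" by (simp add: X_def)
      have "wirt a (wirt_bar b u) x = (if a = b then of_real (t * ((- 2 * X - - 2 * t * (2 * e b * t)) / X\<^sup>2) + - 2 * t / X) else 0)"
        unfolding t_def X_def
      proof (rule wirt_wirt_bar_radial[OF open_region x, where \<phi> = "\<lambda>b s. - (1 / e b) * ln (1 + e b * s\<^sup>2)"
              and \<psi> = "\<lambda>b s. - 2 * s / (1 + e b * s\<^sup>2)"])
        show "u y = (\<Sum>b\<in>UNIV. of_real (- (1 / e b) * ln (1 + e b * ((cmod (y $ b))\<^sup>2)\<^sup>2)))" if "y \<in> region e" for y
          by (rule u[OF that])
        show "DERIV (\<lambda>s. - (1 / e b) * ln (1 + e b * s\<^sup>2)) ((cmod (y $ b))\<^sup>2) :> - 2 * (cmod (y $ b))\<^sup>2 / (1 + e b * ((cmod (y $ b))\<^sup>2)\<^sup>2)"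
          if "y \<in> region e" for y b
          by (rule DERIV_potential(1)[OF e region_pos(1)[OF that]])
        show "DERIV (\<lambda>s. - 2 * s / (1 + e b * s\<^sup>2)) ((cmod (x $ b))\<^sup>2) :>
            (- 2 * (1 + e b * ((cmod (x $ b))\<^sup>2)\<^sup>2) - - 2 * (cmod (x $ b))\<^sup>2 * (2 * e b * (cmod (x $ b))\<^sup>2)) / (1 + e b * ((cmod (x $ b))\<^sup>2)\<^sup>2)\<^sup>2"
          by (rule DERIV_potential(2)[OF e region_pos(1)[OF x]])
      qed
      moreover have "t * ((- 2 * X - - 2 * t * (2 * e b * t)) / X\<^sup>2) + - 2 * t / X = (- 4 * t * X + 4 * t * (e b * t\<^sup>2)) / X\<^sup>2"
        using X by (simp add: field_simps power2_eq_square)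
      moreover have "\<dots> = - pi * (4 / pi * t / X\<^sup>2)"
        unfolding et by (simp add: algebra_simps)
      ultimately show ?thesis unfolding gcoef_def t_def X_def by simp
    qed
    have "ric_form (lbundle e) (herm e) i (region e, id) x v w
        = - (\<i> / (2 * of_real pi)) * (\<Sum>a\<in>UNIV. \<Sum>b\<in>UNIV. wirt a (wirt_bar b u) x * (v $ a * cnj (w $ b) - w $ a * cnj (v $ b)))"
      by (simp add: ric_form_def ddbar_def u_def)
    also have "(\<Sum>a\<in>UNIV. \<Sum>b\<in>UNIV. wirt a (wirt_bar b u) x * (v $ a * cnj (w $ b) - w $ a * cnj (v $ b)))
        = (\<Sum>a\<in>UNIV. of_real (- pi * gcoef (e a) ((cmod (x $ a))\<^sup>2)) * (v $ a * cnj (w $ a) - w $ a * cnj (v $ a)))"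
    proof (rule sum.cong[OF refl])
      fix a
      have "(\<Sum>b\<in>UNIV. wirt a (wirt_bar b u) x * (v $ a * cnj (w $ b) - w $ a * cnj (v $ b)))
          = (\<Sum>b\<in>UNIV. if b = a then of_real (- pi * gcoef (e a) ((cmod (x $ a))\<^sup>2)) * (v $ a * cnj (w $ a) - w $ a * cnj (v $ a)) else 0)"
        by (intro sum.cong) (auto simp: dd)
      then show "(\<Sum>b\<in>UNIV. wirt a (wirt_bar b u) x * (v $ a * cnj (w $ b) - w $ a * cnj (v $ b)))
          = of_real (- pi * gcoef (e a) ((cmod (x $ a))\<^sup>2)) * (v $ a * cnj (w $ a) - w $ a * cnj (v $ a))"
        by simp
    qed
    also have "- (\<i> / (2 * of_real pi)) * \<dots> = (\<Sum>a\<in>UNIV. of_real (- (gcoef (e a) ((cmod (x $ a))\<^sup>2) * Im (v $ a * cnj (w $ a)))))"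
    proof (unfold sum_distrib_left, rule sum.cong[OF refl])
      fix a
      define I where "I = Im (v $ a * cnj (w $ a))"
      have I: "v $ a * cnj (w $ a) - w $ a * cnj (v $ a) = 2 * \<i> * of_real I"
        by (simp add: complex_eq_iff I_def)
      show "- (\<i> / (2 * of_real pi)) * (of_real (- pi * gcoef (e a) ((cmod (x $ a))\<^sup>2)) * (v $ a * cnj (w $ a) - w $ a * cnj (v $ a)))
          = of_real (- (gcoef (e a) ((cmod (x $ a))\<^sup>2) * Im (v $ a * cnj (w $ a))))"
        unfolding I I_def[symmetric] by (simp add: field_simps)
    qed
    also have "\<dots> = of_real (kahler_form (gmetric e) (region e, id) x v w)"
      unfolding kahler_form_def hform_gmetric Im_sum Im_of_real_mult by (simp only: of_real_sum sum_negf of_real_minus)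
    finally show ?thesis .
  qed
  then show ?thesis by (simp add: ric_eq_kahler_form_def)
qed

section \<open>Volume measure\<close>

definition dens :: "('n::finite \<Rightarrow> real) \<Rightarrow> complex^'n \<Rightarrow> real" where
  "dens e x = indicator (region e) x * (\<Prod>a\<in>UNIV. gcoef (e a) ((cmod (x $ a))\<^sup>2))"

text \<open>The measure to be described lives on the region alone, while \<open>dens\<close> is
  extended by 0 so that integrals can be moved to \<open>lborel\<close> on the whole space.\<close>

definition vol :: "('n::finite \<Rightarrow> real) \<Rightarrow> (complex^'n) measure" where
  "vol e = restrict_space (density lborel (\<lambda>x. ennreal (dens e x))) (region e)"

lemma region_measurable [measurable]: "region e \<in> sets borel"
  by (rule borel_open[OF open_region])

lemma dens_measurable [measurable]: "dens e \<in> borel_measurable borel"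
proof -
  have "gcoef c \<in> borel_measurable borel" for c
    unfolding gcoef_def[abs_def] by measurable
  moreover have "(\<lambda>x::complex^'a. (cmod (x $ a))\<^sup>2) \<in> borel_measurable borel" for a
    by (intro borel_measurable_continuous_onI continuous_intros)
  ultimately have "(\<lambda>x::complex^'a. gcoef (e a) ((cmod (x $ a))\<^sup>2)) \<in> borel_measurable borel" for a
    by (rule measurable_compose[rotated])
  then show ?thesis
    unfolding dens_def[abs_def] by (intro borel_measurable_times borel_measurable_prod borel_measurable_indicator region_measurable)
qed

lemma dens_nonneg: "0 \<le> dens e x"
proof (cases "x \<in> region e")
  case True
  then show ?thesis
    unfolding dens_def using gcoef_pos[of x e] by (intro mult_nonneg_nonneg prod_nonneg) (auto intro: less_imp_le)
qed (simp add: dens_def)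

lemma is_volume_measure_vol: "is_volume_measure (region_mfd e) (gmetric e) (vol e)"
  unfolding is_volume_measure_def
proof (intro conjI ballI impI)
  show "space (vol e) = pts (region_mfd e)" by (simp add: vol_def space_restrict_space)
  have "sets (vol e) = (\<inter>) (region e) ` sigma_sets UNIV {S. open S}"
    by (simp add: vol_def sets_restrict_space borel_def)
  also have "\<dots> = sigma_sets (region e) ((\<inter>) (region e) ` {S. open S})"
    using open_region by (intro sigma_sets_Int) auto
  also have "(\<inter>) (region e) ` {S. open S} = {U. openin (mtop (region_mfd e)) U}"
    by (auto simp: openin_open)
  finally show "sets (vol e) = sigma_sets (pts (region_mfd e)) {U. openin (mtop (region_mfd e)) U}" by simp
  fix c A assume "c \<in> atlas (region_mfd e)" and A: "A \<in> sets (vol e)" "A \<subseteq> fst c"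
  then have c: "c = (region e, id)" by simp
  have Ab: "A \<in> sets borel" and AU: "A \<subseteq> region e"
    using A by (auto simp: vol_def sets_restrict_space c)
  have "emeasure (vol e) A = emeasure (density lborel (\<lambda>x. ennreal (dens e x))) A"
    unfolding vol_def using AU by (intro emeasure_restrict_space) auto
  also have "\<dots> = (\<integral>\<^sup>+ y. ennreal (dens e y) * indicator A y \<partial>lborel)"
    using Ab by (intro emeasure_density) auto
  also have "\<dots> = (\<integral>\<^sup>+ y. ennreal (Re (det (gmetric e c (chart_inv c y)))) * indicator (snd c ` A) y \<partial>lborel)"
    using AU unfolding c by (intro nn_integral_cong) (auto simp: dens_def det_gmetric Re_complex_of_real split: split_indicator simp del: of_real_prod)
  finally show "emeasure (vol e) A = (\<integral>\<^sup>+y\<in>snd c ` A. ennreal (Re (det (gmetric e c (chart_inv c y)))) \<partial>lborel)" .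
qed

text \<open>The one chart covers the manifold, so the chart formula fixes the measure of every
  measurable set, and \<open>vol e\<close> is the only measure that fits the description.\<close>

lemma volume_measure_mfd: "volume_measure (region_mfd e) (gmetric e) = vol e"
  unfolding volume_measure_def
proof (rule the_equality[where P = "is_volume_measure (region_mfd e) (gmetric e)", OF is_volume_measure_vol])
  fix \<mu> assume \<mu>: "is_volume_measure (region_mfd e) (gmetric e) \<mu>"
  note v = is_volume_measure_vol[of e]
  show "\<mu> = vol e"
  proof (rule measure_eqI)
    show s: "sets \<mu> = sets (vol e)" using \<mu> v by (simp add: is_volume_measure_def)
    fix A assume A: "A \<in> sets \<mu>"
    then have "A \<subseteq> region e" using sets.sets_into_space[OF A] \<mu> by (simp add: is_volume_measure_def)
    then show "emeasure \<mu> A = emeasure (vol e) A"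
      using A s \<mu> v by (simp add: is_volume_measure_def)
  qed
qed

lemma
  fixes f :: "complex^'n \<Rightarrow> 'b::{banach, second_countable_topology}"
  assumes [measurable]: "(\<lambda>x. indicator (region e) x *\<^sub>R f x) \<in> borel_measurable borel"
  shows integral_vol: "integral\<^sup>L (vol e) f = (LINT x|lborel. dens e x *\<^sub>R f x)"
    and integrable_vol: "integrable (vol e) f \<longleftrightarrow> integrable lborel (\<lambda>x. dens e x *\<^sub>R f x)"
proof -
  have *: "dens e x *\<^sub>R indicator (region e) x *\<^sub>R f x = dens e x *\<^sub>R f x" for x
    by (simp add: dens_def indicator_def)
  have "integral\<^sup>L (vol e) f = (LINT x|density lborel (\<lambda>x. ennreal (dens e x)). indicator (region e) x *\<^sub>R f x)"
    unfolding vol_def by (intro integral_restrict_space) auto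
  also have "\<dots> = (LINT x|lborel. dens e x *\<^sub>R indicator (region e) x *\<^sub>R f x)"
    by (intro integral_density) (auto simp: dens_nonneg)
  finally show "integral\<^sup>L (vol e) f = (LINT x|lborel. dens e x *\<^sub>R f x)" unfolding * .
  have "integrable (vol e) f \<longleftrightarrow> integrable (density lborel (\<lambda>x. ennreal (dens e x))) (\<lambda>x. indicator (region e) x *\<^sub>R f x)"
    unfolding vol_def by (intro integrable_restrict_space) auto
  also have "\<dots> \<longleftrightarrow> integrable lborel (\<lambda>x. dens e x *\<^sub>R indicator (region e) x *\<^sub>R f x)"
    by (intro integrable_density) (auto simp: dens_nonneg)
  finally show "integrable (vol e) f \<longleftrightarrow> integrable lborel (\<lambda>x. dens e x *\<^sub>R f x)" unfolding * .
qed

section \<open>The span of the even monomials\<close>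

lemma dens_weight:
  assumes "x \<in> region e"
  shows "dens e x * weight e x ^ m = (\<Prod>i\<in>UNIV. rweight (e i) m (cmod (x $ i)))"
proof -
  have "gcoef (e i) ((cmod (x $ i))\<^sup>2) * ((1 + e i * ((cmod (x $ i))\<^sup>2)\<^sup>2) powr (- (1 / e i))) ^ m
      = rweight (e i) m (cmod (x $ i))" for i
  proof -
    define t X where "t = cmod (x $ i)" and "X = 1 + e i * t ^ 4"
    have t4: "(t\<^sup>2)\<^sup>2 = t ^ 4" by (simp flip: power_mult)
    have t: "0 < t" "0 < X" using region_pos[OF assms, of i] unfolding X_def t_def t4[unfolded t_def] by auto
    have "(X powr (- (1 / e i))) ^ m = X powr (- (real m / e i))"
      using t by (simp add: powr_power)
    moreover have "X powr (- (real m / e i) - 2) = X powr (- (real m / e i)) / X\<^sup>2"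
      using t by (simp add: powr_diff powr_numeral)
    ultimately have "4 / pi * t\<^sup>2 / X\<^sup>2 * (X powr (- (1 / e i))) ^ m = 4 / pi * t\<^sup>2 * X powr (- (real m / e i) - 2)"
      by simp
    moreover have "rweight (e i) m t = 4 / pi * t\<^sup>2 * X powr (- (real m / e i) - 2)"
      using t unfolding X_def by (simp add: rweight_def)
    ultimately show ?thesis
      unfolding gcoef_def t4[unfolded t_def] unfolding X_def t_def by simp
  qed
  then show ?thesis
    using assms by (simp only: dens_def weight_def indicator_simps mult_1 prod_power_distrib prod.distrib[symmetric])
qed

lemma holo_on_linear_combination:
  assumes "holo_on f U" "holo_on g U"
  shows "holo_on (\<lambda>z. a * f z + b * g z) U"
  unfolding holo_on_def
proof (intro ballI)
  fix z assume "z \<in> U"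
  then obtain D E where "(f has_derivative D) (at z)" "(g has_derivative E) (at z)"
    and lin: "\<And>c v. D (c *s v) = c * D v" "\<And>c v. E (c *s v) = c * E v"
    using assms unfolding holo_on_def by metis
  then have "((\<lambda>z. a * f z + b * g z) has_derivative (\<lambda>v. a * D v + b * E v)) (at z)"
    by (intro has_derivative_add has_derivative_mult_right)
  then show "\<exists>D. ((\<lambda>z. a * f z + b * g z) has_derivative D) (at z) \<and> (\<forall>c v. D (c *s v) = c * D v)"
    by (intro exI[of _ "\<lambda>v. a * D v + b * E v"]) (simp add: lin algebra_simps)
qed

section \<open>The Bergman space as a weighted function space\<close>

locale torus_invariant_example =
  fixes e :: "'n::finite \<Rightarrow> real" and m :: nat
  assumes admissible: "\<And>i. admissible (e i) m"
begin

sublocale polarized "region_mfd e" "gmetric e" "lbundle e" "herm e" m .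

definition W :: "complex^'n \<Rightarrow> real" where
  "W x = (\<Prod>i\<in>UNIV. rweight (e i) m (cmod (x $ i)))"

text \<open>Both sides are 0 off the region, where some factor \<open>rweight\<close> vanishes;
  hence integrals over the manifold become integrals over all of complex n-space.\<close>

lemma W_eq: "W x = dens e x * weight e x ^ m"
proof (cases "x \<in> region e")
  case False
  then obtain i where i: "x $ i = 0 \<or> \<not> 0 < 1 + e i * ((cmod (x $ i))\<^sup>2)\<^sup>2" by (auto simp: region_def)
  moreover have "((cmod (x $ i))\<^sup>2)\<^sup>2 = cmod (x $ i) ^ 4" by (simp flip: power_mult)
  ultimately have "rweight (e i) m (cmod (x $ i)) = 0" by (auto simp: rweight_def)
  then have "W x = 0" unfolding W_def by (intro prod_zero) auto
  then show ?thesis using False by (simp add: dens_def)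
qed (simp add: W_def dens_weight)

lemma W_nonneg: "0 \<le> W x"
  unfolding W_def by (intro prod_nonneg) (simp add: rweight_nonneg)

lemma W_measurable [measurable]: "W \<in> borel_measurable borel"
proof -
  have "(\<lambda>x::complex^'n. cmod (x $ i)) \<in> borel_measurable borel" for i
    by (intro borel_measurable_continuous_onI continuous_intros)
  then have "(\<lambda>x::complex^'n. rweight (e i) m (cmod (x $ i))) \<in> borel_measurable borel" for i
    using rweight_measurable by (rule measurable_compose)
  then show ?thesis unfolding W_def[abs_def] by (intro borel_measurable_prod)
qed

text \<open>A section amounts to one holomorphic function on the region, its coordinate 0, extended
  by 0. Measurability of the extension comes from continuity on an open set.\<close>

lemma holo_sectionsD:
  assumes "s \<in> holo_sections (region_mfd e) (lbundle e)"
  shows "x \<in> region e \<Longrightarrow> s x i = s x 0" "x \<notin> region e \<Longrightarrow> s x i = 0"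
    "holo_on (\<lambda>x. s x 0) (region e)" "(\<lambda>x. s x 0) \<in> borel_measurable borel"
proof -
  have f: "s x \<in> fibre (lbundle e) x" for x using assms by (simp add: holo_sections_def)
  show "x \<in> region e \<Longrightarrow> s x i = s x 0" for x i using f[of x] by (simp add: fibre_lbundle)
  show z: "x \<notin> region e \<Longrightarrow> s x i = 0" for x i using f[of x] by (simp add: fibre_lbundle)
  show h: "holo_on (\<lambda>x. s x 0) (region e)" using assms by (simp add: holo_sections_def mholo_on_mfd)
  then have "continuous_on (region e) (\<lambda>x. s x 0)"
    unfolding holo_on_def by (metis (no_types, lifting) continuous_at_imp_continuous_on has_derivative_continuous)
  then have "(\<lambda>x. indicator (region e) x *\<^sub>R s x 0) \<in> borel_measurable borel"
    by (intro borel_measurable_continuous_on_indicator region_measurable)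
  moreover have "(\<lambda>x. indicator (region e) x *\<^sub>R s x 0) = (\<lambda>x. s x 0)"
    using z by (auto simp: fun_eq_iff indicator_def)
  ultimately show "(\<lambda>x. s x 0) \<in> borel_measurable borel" by simp
qed

lemma holo_sections_linear_combination:
  assumes "s \<in> holo_sections (region_mfd e) (lbundle e)" "t \<in> holo_sections (region_mfd e) (lbundle e)"
  shows "(\<lambda>x i. a * s x i + b * t x i) \<in> holo_sections (region_mfd e) (lbundle e)"
proof -
  have eq: "(\<lambda>x. a * s x i + b * t x i) = (\<lambda>x. a * s x 0 + b * t x 0)" for i
    using holo_sectionsD(1,2)[OF assms(1), of _ i] holo_sectionsD(1,2)[OF assms(2), of _ i]
      holo_sectionsD(2)[OF assms(1), of _ 0] holo_sectionsD(2)[OF assms(2), of _ 0] by (metis (no_types))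
  have "holo_on (\<lambda>x. a * s x i + b * t x i) (region e)" for i
    unfolding eq[of i] by (rule holo_on_linear_combination[OF holo_sectionsD(3)[OF assms(1)] holo_sectionsD(3)[OF assms(2)]])
  moreover have "(\<lambda>i. a * s x i + b * t x i) \<in> fibre (lbundle e) x" for x
    using holo_sectionsD(1,2)[OF assms(1), of x] holo_sectionsD(1,2)[OF assms(2), of x]
    unfolding fibre_lbundle by (metis (no_types) mult_zero_right add_0)
  ultimately show ?thesis by (simp add: holo_sections_def mholo_on_mfd)
qed

text \<open>\<open>power_metric\<close> picks an index by choice; since the coordinates of a section
  agree on the region, index 0 gives the same value. Off the region both sides vanish with the
  section.\<close>

lemma power_metric_eq:
  assumes s: "s \<in> holo_sections (region_mfd e) (lbundle e)" and t: "t \<in> holo_sections (region_mfd e) (lbundle e)"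
  shows "power_metric (lbundle e) (herm e) m x (s x) (t x) = of_real (weight e x ^ m) * (s x 0 * cnj (t x 0))"
proof (cases "x \<in> region e")
  case True
  then show ?thesis
    using holo_sectionsD(1)[OF s True] holo_sectionsD(1)[OF t True] by (simp add: power_metric_def herm_def Let_def) metis
next
  case False
  then show ?thesis
    using holo_sectionsD(2)[OF s False] by (simp add: power_metric_def Let_def)
qed

lemma bergman_space_iff:
  "s \<in> bergman_space \<longleftrightarrow> s \<in> holo_sections (region_mfd e) (lbundle e) \<and> integrable lborel (\<lambda>x. W x * (cmod (s x 0))\<^sup>2)"
proof (cases "s \<in> holo_sections (region_mfd e) (lbundle e)")
  case True
  have re: "Re (power_metric (lbundle e) (herm e) m x (s x) (s x)) = weight e x ^ m * (cmod (s x 0))\<^sup>2" for x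
    unfolding power_metric_eq[OF True True] complex_norm_square[symmetric] by (simp flip: of_real_mult of_real_power)
  have [measurable]: "(\<lambda>x. s x 0) \<in> borel_measurable borel" by (rule holo_sectionsD(4)[OF True])
  have "(\<lambda>x. indicator (region e) x *\<^sub>R (weight e x ^ m)) \<in> borel_measurable borel"
    using Ck_on.simps(1) smooth_weight[of e] unfolding smooth_on_def
    by (intro borel_measurable_continuous_on_indicator region_measurable continuous_on_power) blast
  then have "(\<lambda>x. (indicator (region e) x *\<^sub>R (weight e x ^ m)) * (cmod (s x 0))\<^sup>2) \<in> borel_measurable borel"
    by (intro borel_measurable_times) auto
  then have "integrable (vol e) (\<lambda>x. weight e x ^ m * (cmod (s x 0))\<^sup>2) \<longleftrightarrow> integrable lborel (\<lambda>x. W x * (cmod (s x 0))\<^sup>2)"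
    by (subst integrable_vol) (simp_all add: W_eq mult.assoc)
  then show ?thesis using True by (simp add: bergman_space_def volume_measure_mfd re)
qed (simp add: bergman_space_def)

lemma ip_eq:
  assumes s: "s \<in> holo_sections (region_mfd e) (lbundle e)" and t: "t \<in> holo_sections (region_mfd e) (lbundle e)"
  shows "ip s t = (LINT x|lborel. of_real (W x) * (s x 0 * cnj (t x 0)))"
proof -
  have [measurable]: "(\<lambda>x. s x 0) \<in> borel_measurable borel" "(\<lambda>x. t x 0) \<in> borel_measurable borel"
    using holo_sectionsD(4)[OF s] holo_sectionsD(4)[OF t] .
  have [measurable]: "cnj \<in> borel \<rightarrow>\<^sub>M borel"
    by (intro borel_measurable_continuous_onI continuous_intros)
  have "(\<lambda>x. indicator (region e) x *\<^sub>R (weight e x ^ m)) \<in> borel_measurable borel"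
    using Ck_on.simps(1) smooth_weight[of e] unfolding smooth_on_def
    by (intro borel_measurable_continuous_on_indicator region_measurable continuous_on_power) blast
  then have "(\<lambda>x. complex_of_real (indicator (region e) x *\<^sub>R (weight e x ^ m))) \<in> borel_measurable borel"
    by (rule measurable_compose[OF _ borel_measurable_continuous_onI]) (intro continuous_intros)
  moreover have "(\<lambda>x. s x 0 * cnj (t x 0)) \<in> borel_measurable borel" by measurable
  ultimately have "(\<lambda>x. complex_of_real (indicator (region e) x *\<^sub>R (weight e x ^ m)) * (s x 0 * cnj (t x 0))) \<in> borel_measurable borel"
    by (rule borel_measurable_times)
  then have "integral\<^sup>L (vol e) (\<lambda>x. of_real (weight e x ^ m) * (s x 0 * cnj (t x 0)))
      = (LINT x|lborel. dens e x *\<^sub>R (of_real (weight e x ^ m) * (s x 0 * cnj (t x 0))))"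
    by (intro integral_vol) (simp add: scaleR_conv_of_real mult.assoc)
  then show ?thesis
    unfolding ip_def volume_measure_mfd power_metric_eq[OF s t] by (simp add: W_eq scaleR_conv_of_real mult.assoc)
qed

lemma integrable_cross:
  assumes s: "s \<in> bergman_space" and t: "t \<in> bergman_space"
  shows "integrable lborel (\<lambda>x. of_real (W x) * (s x 0 * cnj (t x 0)))"
proof -
  have hs: "s \<in> holo_sections (region_mfd e) (lbundle e)" "t \<in> holo_sections (region_mfd e) (lbundle e)"
    using s t by (auto simp: bergman_space_iff)
  have [measurable]: "(\<lambda>x. s x 0) \<in> borel_measurable borel" "(\<lambda>x. t x 0) \<in> borel_measurable borel"
    using holo_sectionsD(4)[OF hs(1)] holo_sectionsD(4)[OF hs(2)] .
  have [measurable]: "cnj \<in> borel \<rightarrow>\<^sub>M borel"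
    by (intro borel_measurable_continuous_onI continuous_intros)
  have "integrable lborel (\<lambda>x. W x * (cmod (s x 0))\<^sup>2 + W x * (cmod (t x 0))\<^sup>2)"
    using s t by (intro Bochner_Integration.integrable_add) (auto simp: bergman_space_iff)
  then show ?thesis
  proof (rule Bochner_Integration.integrable_bound)
    show "AE x in lborel. norm (of_real (W x) * (s x 0 * cnj (t x 0))) \<le> norm (W x * (cmod (s x 0))\<^sup>2 + W x * (cmod (t x 0))\<^sup>2)"
    proof (intro AE_I2)
      fix x
      define A B where "A = cmod (s x 0)" and "B = cmod (t x 0)"
      have "0 \<le> A * B" by (simp add: A_def B_def)
      then have "A * B \<le> A\<^sup>2 + B\<^sup>2" using sum_squares_bound[of A B] by simp
      then have "W x * (A * B) \<le> W x * (A\<^sup>2 + B\<^sup>2)" by (intro mult_left_mono W_nonneg)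
      then show "norm (of_real (W x) * (s x 0 * cnj (t x 0))) \<le> norm (W x * (cmod (s x 0))\<^sup>2 + W x * (cmod (t x 0))\<^sup>2)"
        using W_nonneg[of x] by (simp add: norm_mult A_def B_def distrib_left)
    qed
  qed measurable
qed

lemma Re_ip_self:
  assumes s: "s \<in> bergman_space"
  shows "Re (ip s s) = (LINT x|lborel. W x * (cmod (s x 0))\<^sup>2)"
proof -
  have "of_real (W x) * (s x 0 * cnj (s x 0)) = complex_of_real (W x * (cmod (s x 0))\<^sup>2)" for x
    unfolding complex_norm_square[symmetric] by simp
  then show ?thesis using s by (simp only: ip_eq bergman_space_iff integral_complex_of_real Re_complex_of_real)
qed

lemma Re_ip_self_nonneg: "s \<in> bergman_space \<Longrightarrow> 0 \<le> Re (ip s s)"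
  by (simp add: Re_ip_self W_nonneg)

text \<open>Integrating \<open>|A + B|^2 \<le> 2 * |A|^2 + 2 * |B|^2\<close> gives both claims. The
  factor 2 in the norm bound is absorbed by the approximation arguments below.\<close>

lemma
  assumes s: "s \<in> bergman_space" and t: "t \<in> bergman_space"
  shows bergman_linear_combination: "(\<lambda>x i. a * s x i + b * t x i) \<in> bergman_space"
    and l2norm_linear_combination:
      "l2norm (\<lambda>x i. a * s x i + b * t x i) \<le> 2 * (cmod a * l2norm s + cmod b * l2norm t)"
proof -
  have hs: "s \<in> holo_sections (region_mfd e) (lbundle e)" "t \<in> holo_sections (region_mfd e) (lbundle e)"
    using s t by (auto simp: bergman_space_iff)
  have [measurable]: "(\<lambda>x. s x 0) \<in> borel_measurable borel" "(\<lambda>x. t x 0) \<in> borel_measurable borel"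
    using holo_sectionsD(4)[OF hs(1)] holo_sectionsD(4)[OF hs(2)] .
  have bound: "W x * (cmod (a * s x 0 + b * t x 0))\<^sup>2
      \<le> 2 * (cmod a)\<^sup>2 * (W x * (cmod (s x 0))\<^sup>2) + 2 * (cmod b)\<^sup>2 * (W x * (cmod (t x 0))\<^sup>2)" for x
  proof -
    define A B where "A = cmod (a * s x 0)" and "B = cmod (b * t x 0)"
    have "(cmod (a * s x 0 + b * t x 0))\<^sup>2 \<le> (A + B)\<^sup>2"
      unfolding A_def B_def by (intro power_mono norm_triangle_ineq) auto
    also have "\<dots> \<le> 2 * A\<^sup>2 + 2 * B\<^sup>2"
      using sum_squares_bound[of A B] by (simp add: power2_sum)
    finally have "W x * (cmod (a * s x 0 + b * t x 0))\<^sup>2 \<le> W x * (2 * A\<^sup>2 + 2 * B\<^sup>2)"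
      by (intro mult_left_mono W_nonneg)
    then show ?thesis by (simp add: A_def B_def norm_mult power_mult_distrib algebra_simps)
  qed
  have int: "integrable lborel (\<lambda>x. 2 * (cmod a)\<^sup>2 * (W x * (cmod (s x 0))\<^sup>2) + 2 * (cmod b)\<^sup>2 * (W x * (cmod (t x 0))\<^sup>2))"
    using s t by (intro Bochner_Integration.integrable_add integrable_mult_right) (auto simp: bergman_space_iff)
  then have int2: "integrable lborel (\<lambda>x. W x * (cmod (a * s x 0 + b * t x 0))\<^sup>2)"
    by (rule Bochner_Integration.integrable_bound) (use bound W_nonneg in \<open>auto intro!: AE_I2 order_trans[OF _ abs_ge_self]\<close>)
  then show mem: "(\<lambda>x i. a * s x i + b * t x i) \<in> bergman_space"
    using hs by (simp add: bergman_space_iff holo_sections_linear_combination)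
  have "Re (ip (\<lambda>x i. a * s x i + b * t x i) (\<lambda>x i. a * s x i + b * t x i))
      \<le> 2 * (cmod a)\<^sup>2 * Re (ip s s) + 2 * (cmod b)\<^sup>2 * Re (ip t t)"
  proof -
    have "(LINT x|lborel. W x * (cmod (a * s x 0 + b * t x 0))\<^sup>2)
        \<le> (LINT x|lborel. 2 * (cmod a)\<^sup>2 * (W x * (cmod (s x 0))\<^sup>2) + 2 * (cmod b)\<^sup>2 * (W x * (cmod (t x 0))\<^sup>2))"
      by (intro integral_mono int int2 bound)
    also have "\<dots> = 2 * (cmod a)\<^sup>2 * Re (ip s s) + 2 * (cmod b)\<^sup>2 * Re (ip t t)"
      using s t unfolding Re_ip_self[OF s] Re_ip_self[OF t]
      by (subst Bochner_Integration.integral_add) (auto simp: bergman_space_iff)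
    finally show ?thesis by (simp only: Re_ip_self[OF mem])
  qed
  also have "\<dots> \<le> (2 * (cmod a * l2norm s + cmod b * l2norm t))\<^sup>2"
  proof -
    define A B where "A = cmod a * l2norm s" and "B = cmod b * l2norm t"
    have AB: "0 \<le> A" "0 \<le> B" "A\<^sup>2 = (cmod a)\<^sup>2 * Re (ip s s)" "B\<^sup>2 = (cmod b)\<^sup>2 * Re (ip t t)"
      using Re_ip_self_nonneg[OF s] Re_ip_self_nonneg[OF t] by (auto simp: A_def B_def l2norm_def power_mult_distrib)
    have "2 * A\<^sup>2 + 2 * B\<^sup>2 \<le> (2 * (A + B))\<^sup>2"
      using AB(1,2) by (simp add: power_mult_distrib power2_sum)
    then show ?thesis by (simp add: AB A_def[symmetric] B_def[symmetric] mult.assoc)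
  qed
  finally have "l2norm (\<lambda>x i. a * s x i + b * t x i) \<le> sqrt ((2 * (cmod a * l2norm s + cmod b * l2norm t))\<^sup>2)"
    unfolding l2norm_def by (rule real_sqrt_le_mono)
  also have "\<dots> = 2 * (cmod a * l2norm s + cmod b * l2norm t)"
    using Re_ip_self_nonneg[OF s] Re_ip_self_nonneg[OF t] by (simp add: l2norm_def)
  finally show "l2norm (\<lambda>x i. a * s x i + b * t x i) \<le> 2 * (cmod a * l2norm s + cmod b * l2norm t)" .
qed

section \<open>Closed spans of sections\<close>

lemma zero_bergman: "(\<lambda>x i. 0) \<in> bergman_space"
  by (simp add: bergman_space_iff holo_sections_def fibre_lbundle mholo_on_mfd holo_on_const)

lemma sum_bergman:
  assumes "finite F" "F \<subseteq> bergman_space"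
  shows "(\<lambda>x i. \<Sum>b\<in>F. c b * b x i) \<in> bergman_space"
  using assms
proof (induction F rule: finite_induct)
  case (insert b F)
  then show ?case
    using bergman_linear_combination[of b "\<lambda>x i. \<Sum>b\<in>F. c b * b x i" "c b" 1] by simp
qed (simp add: zero_bergman)

text \<open>Worded like the density clause of \<open>orthonormal_basis\<close>, so that an
  orthonormal set is a basis of its closed span by definition.\<close>

definition closed_span :: "(complex^'n) sec set \<Rightarrow> (complex^'n) sec set" where
  "closed_span B = {s \<in> bergman_space. \<forall>\<epsilon>>0. \<exists>F c. finite F \<and> F \<subseteq> B \<and>
     l2norm (\<lambda>x i. s x i - (\<Sum>b\<in>F. c b * b x i)) < \<epsilon>}"

lemma subset_closed_span:
  assumes "B \<subseteq> bergman_space"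
  shows "B \<subseteq> closed_span B"
proof
  fix b assume b: "b \<in> B"
  have "l2norm (\<lambda>x i. b x i - (\<Sum>b\<in>{b}. 1 * b x i)) = 0"
    using zero_bergman by (simp add: l2norm_def Re_ip_self)
  then have "\<exists>F c. finite F \<and> F \<subseteq> B \<and> l2norm (\<lambda>x i. b x i - (\<Sum>b\<in>F. c b * b x i)) < \<epsilon>" if "\<epsilon> > 0" for \<epsilon>
    using b that by (intro exI[of _ "{b}"] exI[of _ "\<lambda>_. 1"]) simp
  then show "b \<in> closed_span B" using assms b by (auto simp: closed_span_def)
qed

lemma closed_subspace_closed_span:
  assumes B: "B \<subseteq> bergman_space"
  shows "closed_subspace (closed_span B)"
  unfolding closed_subspace_def
proof (intro conjI ballI allI impI)
  show "closed_span B \<subseteq> bergman_space" by (auto simp: closed_span_def)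
  have "l2norm (\<lambda>x i. 0 - (\<Sum>b\<in>{}. 0 * b x i)) = 0"
    using zero_bergman by (simp add: l2norm_def Re_ip_self)
  then show "(\<lambda>x i. 0) \<in> closed_span B"
    unfolding closed_span_def mem_Collect_eq using zero_bergman
    by (intro conjI allI impI exI[of _ "{}"] exI[of _ "\<lambda>_. 0"]) auto
next
  fix s t a b assume s: "s \<in> closed_span B" and t: "t \<in> closed_span B"
  then have st: "s \<in> bergman_space" "t \<in> bergman_space" by (auto simp: closed_span_def)
  show "(\<lambda>x i. a * s x i + b * t x i) \<in> closed_span B"
    unfolding closed_span_def mem_Collect_eq
  proof (intro conjI allI impI bergman_linear_combination st)
    fix \<epsilon> :: real assume \<epsilon>: "\<epsilon> > 0"
    \<comment> \<open>The error of the combined approximation is at most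
      \<open>2 * (cmod a + cmod b) * \<delta>\<close>; the added 1 keeps the denominator positive
      and the final bound strict.\<close>
    define \<delta> where "\<delta> = \<epsilon> / (2 * (cmod a + cmod b) + 1)"
    have den: "0 < 2 * (cmod a + cmod b) + 1" by (intro add_nonneg_pos mult_nonneg_nonneg add_nonneg_nonneg) simp_all
    then have \<delta>: "\<delta> > 0" "\<delta> * (2 * (cmod a + cmod b) + 1) = \<epsilon>" using \<epsilon> by (auto simp: \<delta>_def)
    obtain F c where F: "finite F" "F \<subseteq> B" "l2norm (\<lambda>x i. s x i - (\<Sum>b\<in>F. c b * b x i)) < \<delta>"
      using s \<delta>(1) unfolding closed_span_def by blast
    obtain G d where G: "finite G" "G \<subseteq> B" "l2norm (\<lambda>x i. t x i - (\<Sum>b\<in>G. d b * b x i)) < \<delta>"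
      using t \<delta>(1) unfolding closed_span_def by blast
    \<comment> \<open>Where \<open>F\<close> and \<open>G\<close> overlap, both coefficients
      contribute.\<close>
    define k where "k = (\<lambda>f. a * (if f \<in> F then c f else 0) + b * (if f \<in> G then d f else 0))"
    have k: "(\<Sum>f\<in>F \<union> G. k f * f x i) = a * (\<Sum>f\<in>F. c f * f x i) + b * (\<Sum>f\<in>G. d f * f x i)" for x i
    proof -
      have "(\<Sum>f\<in>F. c f * f x i) = (\<Sum>f\<in>F \<union> G. (if f \<in> F then c f else 0) * f x i)"
        using F G by (intro sum.mono_neutral_cong_left) auto
      moreover have "(\<Sum>f\<in>G. d f * f x i) = (\<Sum>f\<in>F \<union> G. (if f \<in> G then d f else 0) * f x i)"
        using F G by (intro sum.mono_neutral_cong_left) auto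
      ultimately show ?thesis
        by (simp only: k_def sum_distrib_left distrib_right sum.distrib mult.assoc)
    qed
    define s' t' where "s' = (\<lambda>x i. s x i - (\<Sum>b\<in>F. c b * b x i))" and "t' = (\<lambda>x i. t x i - (\<Sum>b\<in>G. d b * b x i))"
    have s': "s' \<in> bergman_space"
      using bergman_linear_combination[OF st(1) sum_bergman[of F c], of 1 "-1"] F B by (auto simp: s'_def)
    have t': "t' \<in> bergman_space"
      using bergman_linear_combination[OF st(2) sum_bergman[of G d], of 1 "-1"] G B by (auto simp: t'_def)
    have "(\<lambda>x i. a * s x i + b * t x i - (\<Sum>f\<in>F \<union> G. k f * f x i)) = (\<lambda>x i. a * s' x i + b * t' x i)"
      unfolding k s'_def t'_def by (simp add: algebra_simps)
    then have "l2norm (\<lambda>x i. a * s x i + b * t x i - (\<Sum>f\<in>F \<union> G. k f * f x i)) \<le> 2 * (cmod a * l2norm s' + cmod b * l2norm t')"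
      using l2norm_linear_combination[OF s' t'] by simp
    also have "\<dots> \<le> 2 * (cmod a * \<delta> + cmod b * \<delta>)"
      using F(3) G(3) by (intro mult_left_mono add_mono) (auto simp: s'_def t'_def less_imp_le)
    also have "\<dots> < \<epsilon>" using \<delta> by (simp add: algebra_simps)
    finally show "\<exists>F c. finite F \<and> F \<subseteq> B \<and> l2norm (\<lambda>x i. a * s x i + b * t x i - (\<Sum>b\<in>F. c b * b x i)) < \<epsilon>"
      using F G by (intro exI[of _ "F \<union> G"] exI[of _ k]) auto
  qed
next
  fix f s assume "(\<forall>k::nat. f k \<in> closed_span B) \<and> s \<in> bergman_space \<and> (\<lambda>k. l2norm (\<lambda>x i. f k x i - s x i)) \<longlonglongrightarrow> 0"
  then have f: "\<And>k. f k \<in> closed_span B" and s: "s \<in> bergman_space"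
    and lim: "(\<lambda>k. l2norm (\<lambda>x i. f k x i - s x i)) \<longlonglongrightarrow> 0" by auto
  show "s \<in> closed_span B"
    unfolding closed_span_def mem_Collect_eq
  proof (intro conjI allI impI s)
    fix \<epsilon> :: real assume \<epsilon>: "\<epsilon> > 0"
    \<comment> \<open>Two errors below a quarter of \<open>\<epsilon>\<close> each, doubled by
      \<open>l2norm_linear_combination\<close>, stay below \<open>\<epsilon>\<close>.\<close>
    have "eventually (\<lambda>k. l2norm (\<lambda>x i. f k x i - s x i) < \<epsilon> / 4) sequentially"
      using order_tendstoD(2)[OF lim, of "\<epsilon> / 4"] \<epsilon> by simp
    then obtain k where k: "l2norm (\<lambda>x i. f k x i - s x i) < \<epsilon> / 4"
      by (auto simp: eventually_sequentially)
    have fk: "f k \<in> bergman_space" using f by (simp add: closed_span_def)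
    obtain F c where F: "finite F" "F \<subseteq> B" "l2norm (\<lambda>x i. f k x i - (\<Sum>b\<in>F. c b * b x i)) < \<epsilon> / 4"
      using f[of k] \<epsilon> unfolding closed_span_def by (auto dest!: spec[of _ "\<epsilon> / 4"])
    define p q where "p = (\<lambda>x i. f k x i - s x i)" and "q = (\<lambda>x i. f k x i - (\<Sum>b\<in>F. c b * b x i))"
    have p: "p \<in> bergman_space"
      using bergman_linear_combination[OF fk s, of 1 "-1"] by (auto simp: p_def)
    have q: "q \<in> bergman_space"
      using bergman_linear_combination[OF fk sum_bergman[of F c], of 1 "-1"] F B by (auto simp: q_def)
    have "(\<lambda>x i. s x i - (\<Sum>b\<in>F. c b * b x i)) = (\<lambda>x i. -1 * p x i + 1 * q x i)"
      by (simp add: p_def q_def)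
    then have "l2norm (\<lambda>x i. s x i - (\<Sum>b\<in>F. c b * b x i)) \<le> 2 * (l2norm p + l2norm q)"
      using l2norm_linear_combination[OF p q, of "-1" 1] by simp
    also have "\<dots> < \<epsilon>" using k F(3) by (simp add: p_def q_def)
    finally show "\<exists>F c. finite F \<and> F \<subseteq> B \<and> l2norm (\<lambda>x i. s x i - (\<Sum>b\<in>F. c b * b x i)) < \<epsilon>"
      using F by blast
  qed
qed

text \<open>Pythagoras: w is orthogonal to every finite combination u of elements of
  \<open>B\<close>, so w - u has norm at least that of w, and w cannot be approximated.\<close>

lemma not_in_closed_span:
  assumes B: "B \<subseteq> bergman_space" and w: "w \<in> bergman_space" "0 < Re (ip w w)"
    and orth: "\<And>b. b \<in> B \<Longrightarrow> ip w b = 0"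
  shows "w \<notin> closed_span B"
proof
  assume "w \<in> closed_span B"
  moreover have "0 < l2norm w" using w(2) by (simp add: l2norm_def)
  ultimately obtain F c where F: "finite F" "F \<subseteq> B" "l2norm (\<lambda>x i. w x i - (\<Sum>b\<in>F. c b * b x i)) < l2norm w"
    unfolding closed_span_def by blast
  define u where "u = (\<lambda>x i. \<Sum>b\<in>F. c b * b x i)"
  have u: "u \<in> bergman_space" unfolding u_def using F B by (intro sum_bergman) auto
  have wu: "(\<lambda>x i. w x i - u x i) \<in> bergman_space"
    using bergman_linear_combination[OF w(1) u, of 1 "-1"] by simp
  have bs: "b \<in> bergman_space" if "b \<in> F" for b using that F B by auto
  have hs: "s \<in> holo_sections (region_mfd e) (lbundle e)" if "s \<in> bergman_space" for s using that by (simp add: bergman_space_iff)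
  have "ip w u = (LINT x|lborel. (\<Sum>b\<in>F. cnj (c b) * (of_real (W x) * (w x 0 * cnj (b x 0)))))"
    unfolding ip_eq[OF hs[OF w(1)] hs[OF u]]
    by (intro Bochner_Integration.integral_cong refl) (simp add: u_def sum_distrib_left mult_ac)
  also have "\<dots> = (\<Sum>b\<in>F. cnj (c b) * ip w b)"
    using integrable_cross[OF w(1) bs]
    by (subst Bochner_Integration.integral_sum) (auto intro!: sum.cong simp: ip_eq[OF hs[OF w(1)] hs[OF bs]])
  also have "\<dots> = 0" using orth F by (intro sum.neutral) auto
  finally have 0: "ip w u = 0" .
  have "(LINT x|lborel. W x * (cmod (w x 0 - u x 0))\<^sup>2)
      = (LINT x|lborel. W x * (cmod (w x 0))\<^sup>2 + W x * (cmod (u x 0))\<^sup>2 - 2 * Re (of_real (W x) * (w x 0 * cnj (u x 0))))"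
    by (intro Bochner_Integration.integral_cong refl) (unfold cmod_power2, simp add: power2_eq_square algebra_simps)
  also have "\<dots> = (LINT x|lborel. W x * (cmod (w x 0))\<^sup>2) + (LINT x|lborel. W x * (cmod (u x 0))\<^sup>2)
      - 2 * (LINT x|lborel. Re (of_real (W x) * (w x 0 * cnj (u x 0))))"
    using w(1) u integrable_Re[OF integrable_cross[OF w(1) u]]
    by (subst Bochner_Integration.integral_diff Bochner_Integration.integral_add, simp_all add: bergman_space_iff del: times_complex.simps)+
  also have "\<dots> = Re (ip w w) + Re (ip u u) - 2 * Re (ip w u)"
    unfolding Re_ip_self[OF w(1)] Re_ip_self[OF u] ip_eq[OF hs[OF w(1)] hs[OF u]]
    by (simp only: integral_Re[OF integrable_cross[OF w(1) u]])
  finally have "Re (ip (\<lambda>x i. w x i - u x i) (\<lambda>x i. w x i - u x i)) \<ge> Re (ip w w)"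
    using Re_ip_self_nonneg[OF u] 0 unfolding Re_ip_self[OF wu] by simp
  then have "l2norm w \<le> l2norm (\<lambda>x i. w x i - u x i)" by (simp add: l2norm_def)
  then show False using F(3) by (simp add: u_def)
qed

end

section \<open>Monomial sections and the constant kernel\<close>

definition monomial :: "('n::finite \<Rightarrow> nat) \<Rightarrow> complex^'n \<Rightarrow> complex" where
  "monomial a x = (\<Prod>i\<in>UNIV. (x $ i) ^ a i)"

lemma holo_monomial: "holo_on (monomial a) U"
  unfolding holo_on_def
proof
  fix z :: "complex^'a"
  define D where "D = (\<lambda>v. \<Sum>i\<in>UNIV. (of_nat (a i) * v $ i * (z $ i) ^ (a i - 1)) * (\<Prod>j\<in>UNIV - {i}. (z $ j) ^ a j))"
  have "(monomial a has_derivative D) (at z)"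
    unfolding monomial_def[abs_def] D_def
    by (intro has_derivative_prod has_derivative_power bounded_linear_imp_has_derivative bounded_linear_vec_nth)
  moreover have "D (c *s v) = c * D v" for c v
    by (simp add: D_def sum_distrib_left mult_ac)
  ultimately show "\<exists>D. (monomial a has_derivative D) (at z) \<and> (\<forall>c v. D (c *s v) = c * D v)" by blast
qed

context torus_invariant_example
begin

definition monomial_sec :: "complex \<Rightarrow> ('n \<Rightarrow> nat) \<Rightarrow> (complex^'n) sec" where
  "monomial_sec c a x i = (if x \<in> region e then c * monomial a x else 0)"

lemma sec_holo: "monomial_sec c a \<in> holo_sections (region_mfd e) (lbundle e)"
proof -
  have "holo_on (\<lambda>x. c * monomial a x) (region e)"
    using holo_on_linear_combination[OF holo_monomial[of a] holo_on_const, of c 0] by simp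
  then have "holo_on (\<lambda>x. monomial_sec c a x i) (region e)" for i
    by (subst holo_on_cong[OF open_region, of _ _ "\<lambda>x. c * monomial a x"]) (auto simp: monomial_sec_def)
  then show ?thesis by (simp add: holo_sections_def mholo_on_mfd fibre_lbundle monomial_sec_def)
qed

lemma W_sec:
  "of_real (W x) * (monomial_sec c a x 0 * cnj (monomial_sec d b x 0))
    = c * cnj d * (\<Prod>i\<in>UNIV. of_real (rweight (e i) m (cmod (x $ i))) * (x $ i) ^ a i * cnj (x $ i) ^ b i)"
proof (cases "x \<in> region e")
  case True
  then show ?thesis by (simp add: monomial_sec_def W_def monomial_def prod.distrib)
next
  case False
  have *: "(\<Prod>i\<in>UNIV. of_real (rweight (e i) m (cmod (x $ i))) * (x $ i) ^ a i * cnj (x $ i) ^ b i)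
      = of_real (W x) * (monomial a x * cnj (monomial b x))"
    by (simp add: W_def monomial_def prod.distrib)
  have "W x = 0" using False by (simp add: W_eq dens_def)
  then show ?thesis unfolding * by simp
qed

lemma
  assumes a: "\<And>i. a i \<in> admissible.exponents (e i) m" and b: "\<And>i. b i \<in> admissible.exponents (e i) m"
  shows integrable_W_sec: "integrable lborel (\<lambda>x. of_real (W x) * (monomial_sec c a x 0 * cnj (monomial_sec d b x 0)))"
    and ip_sec: "ip (monomial_sec c a) (monomial_sec d b)
      = c * cnj d * (\<Prod>i\<in>UNIV. LINT z|lborel. of_real (rweight (e i) m (cmod z)) * z ^ a i * cnj z ^ b i)"
proof -
  note int = admissible.integrable_rweight_monomials[OF admissible a b]
  show "integrable lborel (\<lambda>x. of_real (W x) * (monomial_sec c a x 0 * cnj (monomial_sec d b x 0)))"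
    unfolding W_sec by (intro integrable_mult_right integrable_prod_vec[OF int])
  show "ip (monomial_sec c a) (monomial_sec d b)
      = c * cnj d * (\<Prod>i\<in>UNIV. LINT z|lborel. of_real (rweight (e i) m (cmod z)) * z ^ a i * cnj z ^ b i)"
    unfolding ip_eq[OF sec_holo sec_holo] W_sec by (simp add: integral_prod_vec[OF int])
qed

lemma sec_bergman:
  assumes "\<And>i. a i \<in> admissible.exponents (e i) m"
  shows "monomial_sec c a \<in> bergman_space"
proof -
  have "cmod (of_real (W x) * (monomial_sec c a x 0 * cnj (monomial_sec c a x 0))) = W x * (cmod (monomial_sec c a x 0))\<^sup>2" for x
    using W_nonneg[of x] by (simp add: norm_mult power2_eq_square)
  then show ?thesis
    using integrable_norm[OF integrable_W_sec[of a a c c, OF assms assms]] by (simp add: bergman_space_iff sec_holo)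
qed

definition degs :: "('n \<Rightarrow> nat) set" where
  "degs = {k. \<forall>i. k i \<in> degrees (e i) m}"

text \<open>By \<open>integral_rweight_monomials\<close> this is the inverse of the squared norm of
  the monomial with exponents \<open>2 * k i\<close>; its square root normalizes
  \<open>basis_sec\<close>.\<close>

definition coef :: "('n \<Rightarrow> nat) \<Rightarrow> real" where
  "coef k = (\<Prod>i\<in>UNIV. expansion_coeff (e i) m (k i) / (4 * admissible.moment (e i) m 0))"

definition basis_sec :: "('n \<Rightarrow> nat) \<Rightarrow> (complex^'n) sec" where
  "basis_sec k = monomial_sec (of_real (sqrt (coef k))) (\<lambda>i. 2 * k i)"

lemma coef_pos: "k \<in> degs \<Longrightarrow> 0 < coef k"
  unfolding coef_def degs_def using admissible.expansion_coeff_pos[OF admissible] admissible.moment_0_pos[OF admissible]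
  by (intro prod_pos) auto

lemma basis_sec_bergman: "k \<in> degs \<Longrightarrow> basis_sec k \<in> bergman_space"
  unfolding basis_sec_def degs_def using admissible.even_exponent[OF admissible] by (intro sec_bergman) auto

text \<open>The exponents a range over all square integrable ones, so the formula yields both the
  orthonormality of the basis and the orthogonality of the odd section to it.\<close>

lemma ip_sec_basis_sec:
  assumes a: "\<And>i. a i \<in> admissible.exponents (e i) m" and k: "k \<in> degs"
  shows "ip (monomial_sec c a) (basis_sec k)
    = c * of_real (sqrt (coef k)) * (if a = (\<lambda>i. 2 * k i) then of_real (1 / coef k) else 0)"
proof -
  have k': "k i \<in> degrees (e i) m" for i using k by (simp add: degs_def)
  have "ip (monomial_sec c a) (basis_sec k) = c * of_real (sqrt (coef k)) *
      (\<Prod>i\<in>UNIV. if a i = 2 * k i then of_real (4 * admissible.moment (e i) m 0 / expansion_coeff (e i) m (k i)) else 0)"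
    unfolding basis_sec_def using a k' admissible.even_exponent[OF admissible]
    by (subst ip_sec) (auto simp: admissible.integral_rweight_monomials[OF admissible] simp del: of_real_divide of_real_mult intro!: prod.cong)
  also have "(\<Prod>i\<in>UNIV. if a i = 2 * k i then of_real (4 * admissible.moment (e i) m 0 / expansion_coeff (e i) m (k i)) else 0)
      = (if a = (\<lambda>i. 2 * k i) then complex_of_real (1 / coef k) else 0)"
  proof (cases "a = (\<lambda>i. 2 * k i)")
    case True
    then show ?thesis by (simp add: coef_def prod_dividef)
  next
    case False
    then obtain i where "a i \<noteq> 2 * k i" by auto
    then show ?thesis using False by (auto intro!: prod_zero exI[of _ i])
  qed
  finally show ?thesis .
qed

lemma ip_basis_sec:
  assumes "k \<in> degs" "l \<in> degs"
  shows "ip (basis_sec k) (basis_sec l) = (if k = l then 1 else 0)"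
proof -
  have "(\<lambda>i. 2 * k i) = (\<lambda>i. 2 * l i) \<longleftrightarrow> k = l" by (auto simp: fun_eq_iff)
  moreover have "ip (monomial_sec (of_real (sqrt (coef k))) (\<lambda>i. 2 * k i)) (basis_sec l)
      = of_real (sqrt (coef k)) * of_real (sqrt (coef l)) * (if (\<lambda>i. 2 * k i) = (\<lambda>i. 2 * l i) then of_real (1 / coef l) else 0)"
    using assms admissible.even_exponent[OF admissible] by (intro ip_sec_basis_sec) (auto simp: degs_def)
  moreover have "sqrt (coef l) * sqrt (coef l) * (1 / coef l) = 1" using coef_pos[OF assms(2)] by simp
  ultimately show ?thesis
    unfolding basis_sec_def[of k] by (auto simp flip: of_real_mult)
qed

lemma inj_basis_sec: "inj_on basis_sec degs"
  by (rule inj_onI) (metis ip_basis_sec zero_neq_one)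

lemma W_pos: "x \<in> region e \<Longrightarrow> 0 < W x"
  using gcoef_pos[of x e] weight_pos[of x e] by (auto simp: W_eq dens_def intro!: mult_pos_pos prod_pos)

text \<open>Otherwise the nonnegative integrand vanishes almost everywhere; being positive on the
  region, it would make the region a null set, which a nonempty open set is not.\<close>

lemma ip_self_pos:
  assumes s: "s \<in> bergman_space" and nz: "\<And>x. x \<in> region e \<Longrightarrow> s x 0 \<noteq> 0"
  shows "0 < Re (ip s s)"
proof (rule ccontr)
  assume "\<not> 0 < Re (ip s s)"
  then have "(LINT x|lborel. W x * (cmod (s x 0))\<^sup>2) = 0"
    using Re_ip_self_nonneg[OF s] Re_ip_self[OF s] by simp
  then have "AE x in lborel. W x * (cmod (s x 0))\<^sup>2 = 0"
    using s by (subst (asm) integral_nonneg_eq_0_iff_AE) (auto simp: bergman_space_iff W_nonneg)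
  then have "AE x in lborel. x \<notin> region e"
    by eventually_elim (use W_pos nz in force)
  then have "AE x in lebesgue. x \<notin> region e" by (rule AE_completion)
  then have "negligible (region e)" by (simp add: negligible_iff_null_sets AE_iff_null_sets[OF sets_completionI_sets[of _ lborel]])
  then show False using open_not_negligible[OF open_region region_nonempty] by blast
qed

definition odd_sec :: "'n \<Rightarrow> (complex^'n) sec" where
  "odd_sec j = monomial_sec 1 (\<lambda>i. if i = j then Suc 0 else 0)"

lemma odd_exponents: "(if i = j then Suc 0 else 0) \<in> admissible.exponents (e i) m"
proof -
  have "0 \<in> degrees (e i) m" by (simp add: degrees_def)
  then show ?thesis
    using admissible.even_exponent[OF admissible, of 0 i] admissible.Suc_0_exponent[OF admissible, of i] by auto
qed

lemma odd_sec_bergman: "odd_sec j \<in> bergman_space"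
  unfolding odd_sec_def by (intro sec_bergman odd_exponents)

lemma odd_sec_notin: "odd_sec j \<notin> closed_span (basis_sec ` degs)"
proof (rule not_in_closed_span)
  show "basis_sec ` degs \<subseteq> bergman_space" using basis_sec_bergman by auto
  show "odd_sec j \<in> bergman_space" by (rule odd_sec_bergman)
  show "0 < Re (ip (odd_sec j) (odd_sec j))"
  proof (rule ip_self_pos[OF odd_sec_bergman])
    fix x assume "x \<in> region e"
    then show "odd_sec j x 0 \<noteq> 0" by (simp add: odd_sec_def monomial_sec_def monomial_def region_def)
  qed
  fix b assume "b \<in> basis_sec ` degs"
  then obtain k where k: "k \<in> degs" "b = basis_sec k" by auto
  have "(\<lambda>i. if i = j then Suc 0 else 0) \<noteq> (\<lambda>i. 2 * k i)"
  proof
    assume "(\<lambda>i. if i = j then Suc 0 else 0) = (\<lambda>i. 2 * k i)"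
    from fun_cong[OF this, of j] show False by presburger
  qed
  then show "ip (odd_sec j) b = 0"
    unfolding odd_sec_def k(2) by (subst ip_sec_basis_sec[OF odd_exponents k(1)]) simp
qed

text \<open>Index set and summands are products, so the sum factors. In each coordinate the binomial
  series sums to \<open>(1 + e i * s i) powr (m / e i)\<close>, which is cancelled by the m-th power
  of the bundle metric.\<close>

lemma kernel_constant:
  assumes x: "x \<in> region e"
  shows "partial_bergman_kernel (basis_sec ` degs) x = (\<Prod>i\<in>UNIV. 1 / (4 * admissible.moment (e i) m 0))"
proof -
  define s where "s = (\<lambda>i. ((cmod (x $ i))\<^sup>2)\<^sup>2)"
  define A where "A = (\<lambda>i. 4 * admissible.moment (e i) m 0)"
  define f where "f = (\<lambda>i k. (expansion_coeff (e i) m k * s i ^ k) * ((1 + e i * s i) powr (- (real m / e i)) / A i))"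
  have s: "0 \<le> s i" "0 < 1 + e i * s i" for i using region_pos(1)[OF x, of i] by (auto simp: s_def)
  have hs: "(f i has_sum 1 / A i) (degrees (e i) m)" for i
  proof -
    have "(f i has_sum (1 + e i * s i) powr (real m / e i) * ((1 + e i * s i) powr (- (real m / e i)) / A i)) (degrees (e i) m)"
      unfolding f_def by (intro has_sum_cmult_left admissible.has_sum_cf[OF admissible] s)
    moreover have "(1 + e i * s i) powr (real m / e i) * ((1 + e i * s i) powr (- (real m / e i)) / A i) = 1 / A i"
      using s(2)[of i] by (simp add: powr_minus)
    ultimately show ?thesis by (simp only:)
  qed
  have nonneg: "0 \<le> f i k" if "k \<in> degrees (e i) m" for i k
    using admissible.expansion_coeff_pos[OF admissible that] admissible.moment_0_pos[OF admissible, of i] s[of i] by (simp add: f_def A_def)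
  have summand: "Re (power_metric (lbundle e) (herm e) m x (basis_sec k x) (basis_sec k x)) = (\<Prod>i\<in>UNIV. f i (k i))"
    if k: "k \<in> degs" for k
  proof -
    have "Re (power_metric (lbundle e) (herm e) m x (basis_sec k x) (basis_sec k x))
        = weight e x ^ m * (cmod (basis_sec k x 0))\<^sup>2"
      using power_metric_eq[of "basis_sec k" "basis_sec k" x] basis_sec_bergman[OF k]
      unfolding complex_norm_square[symmetric] by (simp add: bergman_space_iff flip: of_real_mult of_real_power)
    also have "(cmod (basis_sec k x 0))\<^sup>2 = coef k * (\<Prod>i\<in>UNIV. s i ^ k i)"
    proof -
      have "(cmod (monomial (\<lambda>i. 2 * k i) x))\<^sup>2 = (\<Prod>i\<in>UNIV. s i ^ k i)"
        unfolding monomial_def prod_norm[symmetric] prod_power_distrib s_def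
        by (intro prod.cong refl) (simp add: norm_power mult.commute flip: power_mult)
      then show ?thesis
        using coef_pos[OF k] x by (simp add: basis_sec_def monomial_sec_def norm_mult power_mult_distrib)
    qed
    also have "weight e x ^ m = (\<Prod>i\<in>UNIV. (1 + e i * s i) powr (- (real m / e i)))"
    proof -
      have "((1 + e i * s i) powr (- (1 / e i))) ^ m = (1 + e i * s i) powr (- (real m / e i))" for i
        using s(2)[of i] by (simp add: powr_power)
      then show ?thesis unfolding weight_def prod_power_distrib s_def by simp
    qed
    finally show ?thesis
      by (simp add: f_def coef_def A_def prod.distrib prod_dividef mult_ac)
  qed
  have "partial_bergman_kernel (basis_sec ` degs) x = (\<Sum>\<^sub>\<infinity>k\<in>degs. \<Prod>i\<in>UNIV. f i (k i))"
    unfolding partial_bergman_kernel_def by (subst infsum_reindex[OF inj_basis_sec]) (auto intro!: infsum_cong simp: summand)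
  also have "\<dots> = (\<Sum>\<^sub>\<infinity>k\<in>PiE UNIV (\<lambda>i. degrees (e i) m). \<Prod>i\<in>UNIV. f i (k i))"
    by (rule arg_cong[where f = "infsum _"]) (auto simp: degs_def)
  \<comment> \<open>Interchanging product and infinite sums rests on absolute summability, which
    holds because all terms are nonnegative.\<close>
  also have "\<dots> = (\<Prod>i\<in>UNIV. infsum (f i) (degrees (e i) m))"
  proof (rule infsum_prod_PiE_abs)
    fix i
    have "f i summable_on degrees (e i) m" using hs by (rule has_sum_imp_summable)
    then show "(\<lambda>k. norm (f i k)) summable_on degrees (e i) m"
      by (rule summable_on_cong[THEN iffD1, rotated]) (use nonneg in auto)
  qed simp
  also have "\<dots> = (\<Prod>i\<in>UNIV. 1 / A i)" by (intro prod.cong refl infsumI hs)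
  finally show ?thesis by (simp add: A_def)
qed

lemma strictly_balanced: "strictly_partially_balanced"
  unfolding strictly_partially_balanced_def
proof (intro exI conjI)
  let ?B = "basis_sec ` degs"
  have B: "?B \<subseteq> bergman_space" using basis_sec_bergman by auto
  show "closed_subspace (closed_span ?B)" by (rule closed_subspace_closed_span[OF B])
  show "closed_span ?B \<subset> bergman_space"
  proof
    show "closed_span ?B \<subseteq> bergman_space" by (auto simp: closed_span_def)
    show "closed_span ?B \<noteq> bergman_space" using odd_sec_notin odd_sec_bergman by metis
  qed
  show "orthonormal_basis (closed_span ?B) ?B"
    unfolding orthonormal_basis_def
  proof (intro conjI ballI subset_closed_span[OF B])
    fix s t assume "s \<in> ?B" "t \<in> ?B"
    then show "ip s t = (if s = t then 1 else 0)"
      using inj_basis_sec by (auto simp: ip_basis_sec inj_on_eq_iff)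
  qed (auto simp: closed_span_def)
  show "0 < (\<Prod>i\<in>UNIV. 1 / (4 * admissible.moment (e i) m 0))"
    using admissible.moment_0_pos[OF admissible] by (intro prod_pos) auto
  show "\<forall>x\<in>pts (region_mfd e). partial_bergman_kernel ?B x = (\<Prod>i\<in>UNIV. 1 / (4 * admissible.moment (e i) m 0))"
    using kernel_constant by simp
qed

end

section \<open>Partial regularity and the choice of exponents\<close>

lemma strictly_partially_regular_mfd:
  fixes e :: "'n::finite \<Rightarrow> real"
  assumes e: "\<And>i. e i = 1 \<or> e i < 0"
  shows "strictly_partially_regular (region_mfd e) (gmetric e)"
  unfolding strictly_partially_regular_def
proof (intro exI conjI)
  show "holomorphic_line_bundle (region_mfd e) (lbundle e)" by (rule holomorphic_lbundle)
  show "hermitian_metric (region_mfd e) (lbundle e) (herm e)" by (rule hermitian_herm)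
  have "e i \<noteq> 0" for i using e[of i] by auto
  then show "ric_eq_kahler_form (region_mfd e) (gmetric e) (lbundle e) (herm e)" by (rule ric_eq_herm)
  \<comment> \<open>From this bound on, m exceeds 0 and every \<open>- e i\<close> at once.\<close>
  have "eventually (\<lambda>m. 1 + (\<Sum>i\<in>UNIV. \<bar>e i\<bar>) < real m) sequentially"
    using filterlim_real_sequentially by (simp add: filterlim_at_top_dense)
  then show "\<forall>\<^sub>F m in sequentially. polarized.strictly_partially_balanced (region_mfd e) (gmetric e) (lbundle e) (herm e) m"
  proof eventually_elim
    case (elim m)
    have "torus_invariant_example e m"
    proof (unfold_locales)
      fix i
      have "\<bar>e i\<bar> \<le> (\<Sum>i\<in>UNIV. \<bar>e i\<bar>)" by (intro member_le_sum) auto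
      then show "- e i < real m" "0 < m" using elim by linarith+
      show "e i = 1 \<or> e i < 0" by (rule e)
    qed
    then show ?case by (rule torus_invariant_example.strictly_balanced)
  qed
qed

theorem theorem1p1:
  shows "(CARD('n::finite) \<ge> 2 \<longrightarrow>
      (\<exists>(M :: (complex^'n, 'n) cmanifold) g k.
         complex_manifold M \<and> \<not> compact_space (mtop M) \<and> kahler_metric M g \<and>
         strictly_partially_regular M g \<and> has_constant_scalar_curvature M g k)) \<and>
    (CARD('n) \<ge> 3 \<longrightarrow>
      (\<forall>\<epsilon>\<in>{0, 1, -1}. \<exists>(M :: (complex^'n, 'n) cmanifold) g k.
         complex_manifold M \<and> \<not> compact_space (mtop M) \<and> kahler_metric M g \<and>
         strictly_partially_regular M g \<and> has_constant_scalar_curvature M g k \<and>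
         sgn k = \<epsilon>))"
proof -
  have example: "\<exists>(M :: (complex^'n, 'n) cmanifold) g k.
         complex_manifold M \<and> \<not> compact_space (mtop M) \<and> kahler_metric M g \<and>
         strictly_partially_regular M g \<and> has_constant_scalar_curvature M g k \<and> sgn k = \<epsilon>"
    if "\<And>i. e i = 1 \<or> e i < 0" "sgn (\<Sum>i\<in>UNIV. e i) = \<epsilon>" for e :: "'n \<Rightarrow> real" and \<epsilon>
  proof (intro exI conjI)
    show "sgn (8 * pi * (\<Sum>i\<in>UNIV. e i)) = \<epsilon>" using that(2) by (simp add: sgn_mult)
  qed (rule complex_manifold_mfd not_compact_mfd kahler_gmetric constant_scalar_curvature
        strictly_partially_regular_mfd[OF that(1)])+
  \<comment> \<open>Up to the cover, all exponents 1 give a product of punctured Fubini-Study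
    planes, and all exponents -1 a product of punctured hyperbolic discs.\<close>
  have pos: "sgn (\<Sum>i\<in>(UNIV :: 'n set). 1 :: real) = 1" by (simp add: sgn_1_pos)
  have neg: "sgn (\<Sum>i\<in>(UNIV :: 'n set). - 1 :: real) = - 1" by (simp add: sgn_1_neg)
  have zero: "\<exists>e :: 'n \<Rightarrow> real. (\<forall>i. e i = 1 \<or> e i < 0) \<and> sgn (\<Sum>i\<in>UNIV. e i) = 0" if "CARD('n) \<ge> 3"
  proof -
    obtain j :: 'n where True by simp
    \<comment> \<open>All exponents but one are 1, and the remaining one balances them; it is
      negative because there are at least three coordinates.\<close>
    define e where "e = (\<lambda>i. if i = j then 1 - real CARD('n) else 1)"
    have "(\<Sum>i\<in>UNIV. e i) = e j + (\<Sum>i\<in>UNIV - {j}. e i)" by (simp add: sum.remove[of UNIV j])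
    also have "(\<Sum>i\<in>UNIV - {j}. e i) = (\<Sum>i\<in>UNIV - {j}. 1)" by (intro sum.cong) (auto simp: e_def)
    also have "e j + \<dots> = 0" using that by (simp add: e_def card_Diff_singleton of_nat_diff)
    finally show ?thesis using that by (intro exI[of _ e]) (auto simp: e_def)
  qed
  show ?thesis
  proof (intro conjI impI ballI)
    show "\<exists>(M :: (complex^'n, 'n) cmanifold) g k.
         complex_manifold M \<and> \<not> compact_space (mtop M) \<and> kahler_metric M g \<and>
         strictly_partially_regular M g \<and> has_constant_scalar_curvature M g k"
      using example[OF _ pos] by blast
  next
    fix \<epsilon> :: real assume n: "CARD('n) \<ge> 3" and "\<epsilon> \<in> {0, 1, -1}"
    then consider "\<epsilon> = 0" | "\<epsilon> = 1" | "\<epsilon> = -1" by auto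
    then show "\<exists>(M :: (complex^'n, 'n) cmanifold) g k.
         complex_manifold M \<and> \<not> compact_space (mtop M) \<and> kahler_metric M g \<and>
         strictly_partially_regular M g \<and> has_constant_scalar_curvature M g k \<and> sgn k = \<epsilon>"
    proof cases
      case 1
      then show ?thesis using zero[OF n] example by blast
    next
      case 2
      then show ?thesis using example[OF _ pos] by blast
    next
      case 3
      then show ?thesis using example[OF _ neg] by simp
    qed
  qed
qed

end
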